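(* Let $X$ be a compact Riemann surface of genus $g\ge2$ with $\Pi=\pi_1(X)$. The scale of the holonomy representation $\mathrm{hol}(\phi)$ is comparable to $\|\phi\|^{1/2}$, i.e.: (1) For each $\gamma\in\Pi$, the translation length of $\gamma$ in $\mathrm{hol}(\phi)$ acting on $\mathbb H^3$ is $O(\|\phi\|^{1/2})$: there exist constants $C>0$ and $N>0$ (depending on $\gamma$) such that $\ell(\rho_\phi(\gamma))\le C\|\phi\|^{1/2}$ for all $\phi\in Q(X)$ with $\|\phi\|>N$. (2) There is a uniform constant $c>0$ such that for every $\phi\in Q(X)$ there is an element $\gamma\in\Pi$ with $\ell(\rho_\phi(\gamma))\ge c\|\phi\|^{1/2}$.
   Context: $Q(X)$ is the vector space of holomorphic quadratic differentials on $X$, with norm $\|\phi\|=\int_X|\phi|$. For $A\in\mathrm{SL}_2(\mathbb C)$ acting on hyperbolic space $\mathbb H^3$ by isometries, $\ell(A)=\inf_{x\in\mathbb H^3}d(x,A\cdot x)$ is its translation length. Holonomy: identify the universal cover $\tilde X$ of $X$ with the upper half-plane $\mathbb H$. For $\phi\in Q(X)$ with lift $\tilde\phi$ to $\tilde X$ there is a locally injective holomorphic map $f_\phi:\tilde X\to\mathbb{CP}^1$, unique up to post-composition with a Möbius transformation, whose Schwarzian derivative $\left((f''/f')'-\tfrac12(f''/f')^2\right)dz^2$ equals $\tilde\phi$. It satisfies $f_\phi(\gamma x)=\rho_\phi(\gamma)f_\phi(x)$ for a homomorphism $\rho_\phi:\Pi\to \mathrm{PSL}_2(\mathbb C)$,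 unique up to conjugation. After fixing a spin structure on $X$, these are lifted consistently and continuously in $\phi$ to $\rho_\phi:\Pi\to\mathrm{SL}_2(\mathbb C)$; $\mathrm{hol}(\phi)$ is the character of $\rho_\phi$. *)

theory Defs
  imports
    "HOL-Complex_Analysis.Complex_Analysis"
    "HOL-Homology.Homology"
    "HOL-Algebra.Bij"
begin

section \<open>Compact Riemann surfaces\<close>

text \<open>A chart is a pair of a coordinate patch and a coordinate function; the values of the
  coordinate function outside the patch are irrelevant.\<close>

type_synonym 'a chart = "'a set \<times> ('a \<Rightarrow> complex)"

definition chart_inv :: "'a chart \<Rightarrow> complex \<Rightarrow> 'a" where
  "chart_inv c = inv_into (fst c) (snd c)"

definition complex_chart :: "'a::t2_space set \<Rightarrow> 'a chart \<Rightarrow> bool" where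
  "complex_chart X c \<longleftrightarrow>
     openin (top_of_set X) (fst c) \<and> open (snd c ` fst c) \<and>
     homeomorphism (fst c) (snd c ` fst c) (snd c) (chart_inv c)"

definition complex_atlas :: "'a::t2_space set \<Rightarrow> 'a chart set \<Rightarrow> bool" where
  "complex_atlas X A \<longleftrightarrow>
     (\<forall>c\<in>A. complex_chart X c) \<and> (\<Union>c\<in>A. fst c) = X \<and>
     (\<forall>c\<in>A. \<forall>d\<in>A. (snd d \<circ> chart_inv c) holomorphic_on (snd c ` (fst c \<inter> fst d)))"

definition compact_riemann_surface :: "'a::t2_space set \<Rightarrow> 'a chart set \<Rightarrow> bool" where
  "compact_riemann_surface X A \<longleftrightarrow> X \<noteq> {} \<and> compact X \<and> connected X \<and> complex_atlas X A"

text \<open>Genus \<open>g\<close> means that the first integral homology is free abelian of rank \<open>2 g\<close>.\<close>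

definition has_genus :: "'a::t2_space set \<Rightarrow> nat \<Rightarrow> bool" where
  "has_genus X g \<longleftrightarrow> homology_group 1 (top_of_set X) \<cong> free_Abelian_group {..<2 * g}"

section \<open>The universal cover and its deck group\<close>

definition upper_half_plane :: "complex set" where
  "upper_half_plane = {\<tau>. Im \<tau> > 0}"

text \<open>The half-plane is simply connected, so a holomorphic covering map defined on it is an
  identification of the universal cover of \<open>X\<close> with the half-plane.\<close>

definition uniformization :: "'a::t2_space set \<Rightarrow> 'a chart set \<Rightarrow> (complex \<Rightarrow> 'a) \<Rightarrow> bool" where
  "uniformization X A p \<longleftrightarrow>
     covering_space upper_half_plane p X \<and>
     (\<forall>c\<in>A. (snd c \<circ> p) holomorphic_on {\<tau> \<in> upper_half_plane. p \<tau> \<in> fst c})"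

text \<open>The fundamental group acting on the universal cover, i.e. the group of deck
  transformations. Elements of \<^const>\<open>Bij\<close> are extensional, so distinct elements of the carrier
  are distinct as maps of the half-plane.\<close>

definition deck_group :: "(complex \<Rightarrow> 'a) \<Rightarrow> (complex \<Rightarrow> complex) monoid" where
  "deck_group p = BijGroup upper_half_plane
     \<lparr>carrier := {\<gamma> \<in> Bij upper_half_plane.
        homeomorphic_map (top_of_set upper_half_plane) (top_of_set upper_half_plane) \<gamma> \<and>
        (\<forall>\<tau>\<in>upper_half_plane. p (\<gamma> \<tau>) = p \<tau>)}\<rparr>"

section \<open>Holomorphic quadratic differentials\<close>

text \<open>\<open>\<phi> c x\<close> is the coefficient at the point \<open>x\<close> in the coordinate \<open>z\<close> of the chart \<open>c\<close>, so that
  the differential is \<open>\<phi> c dz\<^sup>2\<close> there. Coefficients are \<open>0\<close> where they are meaningless; this makes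
  the set of quadratic differentials a subspace of a space of functions with pointwise
  operations.\<close>

type_synonym 'a qdiff = "'a chart \<Rightarrow> 'a \<Rightarrow> complex"

definition quadratic_differentials :: "'a chart set \<Rightarrow> 'a qdiff set" where
  "quadratic_differentials A = {\<phi>.
     (\<forall>c x. c \<notin> A \<or> x \<notin> fst c \<longrightarrow> \<phi> c x = 0) \<and>
     (\<forall>c\<in>A. (\<phi> c \<circ> chart_inv c) holomorphic_on (snd c ` fst c)) \<and>
     (\<forall>c\<in>A. \<forall>d\<in>A. \<forall>x \<in> fst c \<inter> fst d.
        \<phi> c x = \<phi> d x * (deriv (snd d \<circ> chart_inv c) (snd c x))\<^sup>2)}"

text \<open>The norm \<open>\<integral>\<^bsub>X\<^esub> \<bar>\<phi>\<bar>\<close> is computed by cutting \<open>X\<close> into finitely many disjoint Borel pieces, each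
  contained in a chart, and integrating \<open>\<bar>\<phi>(z)\<bar>\<close> against Lebesgue measure in the coordinate. By the
  transformation law the result does not depend on the chosen partition.\<close>

definition chart_partition ::
    "'a::t2_space set \<Rightarrow> 'a chart set \<Rightarrow> ('a chart \<Rightarrow> 'a set) \<Rightarrow> bool" where
  "chart_partition X A E \<longleftrightarrow>
     finite {c \<in> A. E c \<noteq> {}} \<and> (\<forall>c\<in>A. E c \<in> sets borel \<and> E c \<subseteq> fst c) \<and>
     disjoint_family_on E A \<and> (\<Union>c\<in>A. E c) = X"

definition qd_norm :: "'a::t2_space set \<Rightarrow> 'a chart set \<Rightarrow> 'a qdiff \<Rightarrow> real" where
  "qd_norm X A \<phi> =
     (let E = (SOME E. chart_partition X A E) in
      \<Sum>c | c \<in> A \<and> E c \<noteq> {}. LINT w:snd c ` E c|lborel. cmod (\<phi> c (chart_inv c w)))"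

text \<open>The coefficient with respect to \<open>d\<tau>\<^sup>2\<close> of the pullback of \<open>\<phi>\<close> to the half-plane. Here too the
  choice of chart is immaterial.\<close>

definition qd_lift :: "'a chart set \<Rightarrow> (complex \<Rightarrow> 'a) \<Rightarrow> 'a qdiff \<Rightarrow> complex \<Rightarrow> complex" where
  "qd_lift A p \<phi> \<tau> =
     (let c = (SOME c. c \<in> A \<and> p \<tau> \<in> fst c) in \<phi> c (p \<tau>) * (deriv (snd c \<circ> p) \<tau>)\<^sup>2)"

section \<open>Developing maps and holonomy\<close>

text \<open>The Riemann sphere, with \<^const>\<open>None\<close> as the point at infinity.\<close>

type_synonym sphere = "complex option"

fun sphere_inv :: "sphere \<Rightarrow> sphere" where
  "sphere_inv None = Some 0"
| "sphere_inv (Some z) = (if z = 0 then None else Some (1 / z))"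

fun moebius_act :: "complex^2^2 \<Rightarrow> sphere \<Rightarrow> sphere" where
  "moebius_act M None = (if M$2$1 = 0 then None else Some (M$1$1 / M$2$1))"
| "moebius_act M (Some z) =
     (if M$2$1 * z + M$2$2 = 0 then None
      else Some ((M$1$1 * z + M$1$2) / (M$2$1 * z + M$2$2)))"

definition schwarzian :: "(complex \<Rightarrow> complex) \<Rightarrow> complex \<Rightarrow> complex" where
  "schwarzian g z =
     deriv (\<lambda>w. deriv (deriv g) w / deriv g w) z - (deriv (deriv g) z / deriv g z)\<^sup>2 / 2"

text \<open>A locally injective holomorphic map from the half-plane to the sphere whose Schwarzian
  derivative is \<open>q\<close>. Locally the map is read off in the affine coordinate \<open>z\<close> or in \<open>1 / z\<close>; the
  Schwarzian derivative is the same in both.\<close>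

definition developing_map :: "(complex \<Rightarrow> complex) \<Rightarrow> (complex \<Rightarrow> sphere) \<Rightarrow> bool" where
  "developing_map q f \<longleftrightarrow>
     (\<forall>\<tau>\<in>upper_half_plane. \<exists>U g. open U \<and> \<tau> \<in> U \<and> U \<subseteq> upper_half_plane \<and>
        g holomorphic_on U \<and> inj_on g U \<and>
        ((\<forall>w\<in>U. f w = Some (g w)) \<or> (\<forall>w\<in>U. sphere_inv (f w) = Some (g w))) \<and>
        (\<forall>w\<in>U. schwarzian g w = q w))"

definition SL2C :: "(complex^2^2) monoid" where
  "SL2C = \<lparr>carrier = {M. det M = 1}, monoid.mult = (**), one = mat 1\<rparr>"

text \<open>\<open>r\<close> is a lift to \<open>SL(2,\<complex>)\<close> of a holonomy representation of \<open>\<phi>\<close>.\<close>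

definition holonomy_lift ::
    "'a chart set \<Rightarrow> (complex \<Rightarrow> 'a) \<Rightarrow> 'a qdiff \<Rightarrow> ((complex \<Rightarrow> complex) \<Rightarrow> complex^2^2) \<Rightarrow> bool" where
  "holonomy_lift A p \<phi> r \<longleftrightarrow>
     r \<in> hom (deck_group p) SL2C \<and>
     (\<exists>f. developing_map (qd_lift A p \<phi>) f \<and>
          (\<forall>\<gamma>\<in>carrier (deck_group p). \<forall>\<tau>\<in>upper_half_plane. f (\<gamma> \<tau>) = moebius_act (r \<gamma>) (f \<tau>)))"

text \<open>A choice of lifted holonomy representations for all \<open>\<phi>\<close>, continuous in \<open>\<phi>\<close>. Since each
  \<open>\<rho> \<phi>\<close> is only determined up to conjugation, continuity refers to its character. Such families
  correspond to the spin structures on \<open>X\<close>, together with a choice of a representation within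
  each conjugacy class of representations.\<close>

definition holonomy_family ::
    "'a::t2_space set \<Rightarrow> 'a chart set \<Rightarrow> (complex \<Rightarrow> 'a) \<Rightarrow>
     ('a qdiff \<Rightarrow> (complex \<Rightarrow> complex) \<Rightarrow> complex^2^2) \<Rightarrow> bool" where
  "holonomy_family X A p \<rho> \<longleftrightarrow>
     (\<forall>\<phi>\<in>quadratic_differentials A. holonomy_lift A p \<phi> (\<rho> \<phi>)) \<and>
     (\<forall>\<gamma>\<in>carrier (deck_group p). \<forall>\<phi>\<in>quadratic_differentials A. \<forall>e>0. \<exists>d>0.
        \<forall>\<psi>\<in>quadratic_differentials A. qd_norm X A (\<psi> - \<phi>) < d \<longrightarrow>
          cmod (trace (\<rho> \<psi> \<gamma>) - trace (\<rho> \<phi> \<gamma>)) < e)"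

section \<open>Hyperbolic space and translation length\<close>

text \<open>The upper half-space model of hyperbolic 3-space: pairs \<open>(z, t)\<close> with \<open>t > 0\<close>.\<close>

definition hyp3 :: "(complex \<times> real) set" where
  "hyp3 = {(z, t). t > 0}"

definition hyp3_dist :: "complex \<times> real \<Rightarrow> complex \<times> real \<Rightarrow> real" where
  "hyp3_dist = (\<lambda>(z, t) (w, s). arcosh (1 + ((cmod (z - w))\<^sup>2 + (t - s)\<^sup>2) / (2 * t * s)))"

text \<open>The Poincare extension of a Moebius transformation to the upper half-space.\<close>

definition hyp3_act :: "complex^2^2 \<Rightarrow> complex \<times> real \<Rightarrow> complex \<times> real" where
  "hyp3_act M = (\<lambda>(z, t).
     let a = M$1$1; b = M$1$2; c = M$2$1; d = M$2$2;
         n = (cmod (c * z + d))\<^sup>2 + (cmod c)\<^sup>2 * t\<^sup>2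
     in (((a * z + b) * cnj (c * z + d) + a * cnj c * of_real (t\<^sup>2)) / of_real n, t / n))"

definition translation_length :: "complex^2^2 \<Rightarrow> real" where
  "translation_length M = (INF x\<in>hyp3. hyp3_dist x (hyp3_act M x))"

end

theory Submission
  imports Defs
begin

text \<open>Write \<open>q\<close> for the lift of \<open>\<phi>\<close> to the half-plane and \<open>f\<close> for the developing map. Locally \<open>f = u / v\<close> for two solutions of
\<open>u'' = - (q/2) u\<close> with \<open>u v' - v u' = -1\<close>, so the theorem is a quantitative statement about a linear equation: a potential
of size \<open>\<parallel>\<phi>\<parallel>\<close> makes solutions grow like \<open>exp \<surd>\<parallel>\<phi>\<parallel>\<close>, and no less than that. The pair \<open>(u, v)\<close> is defined only up
to a common sign, but its quadratic forms \<open>Y = (a u + b v)\<^sup>2\<close> are globally defined holomorphic functions on the half-plane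
(\<open>developing_form\<close>). They satisfy \<open>Y'\<^sup>2 - 2 Y Y'' = 2 q Y\<^sup>2\<close>, and a deck transformation \<open>\<gamma>\<close> with holonomy \<open>M\<close>
moves \<open>(u, v)\<close> to \<open>M (u, v)\<close> times a square root of \<open>\<gamma>'\<close>, where \<open>\<bar>\<gamma>'(z)\<bar> = Im (\<gamma> z) / Im z\<close>
(\<open>developing_form_equivariant\<close>, \<open>deck_Im\<close>). In hyperbolic space, a matrix moves a point by at most the logarithm of the
squared Frobenius norm of the corresponding conjugate, and every point by at least \<open>2 ln (\<bar>tr\<bar> / 2)\<close>
(\<open>translation_length_le\<close>, \<open>translation_length_ge\<close>).

Upper bound. On a compact set \<open>\<bar>q\<bar>\<close> is at most \<open>\<kappa>\<^sup>2 = C \<parallel>\<phi>\<parallel>\<close> by the mean value property (\<open>sup_le_qd_norm\<close>). A Gronwall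
estimate bounds the quadratic forms of the basis normalized at \<open>\<i>\<close> by \<open>exp (O(\<kappa>))\<close> on a convex compact set containing \<open>\<i>\<close> and a
neighbourhood of \<open>\<gamma> \<i>\<close> (\<open>third_order_growth\<close>). The transformation rule expresses the entries of the holonomy of \<open>\<gamma>\<close>
in that basis through these values, so the squared Frobenius norm is \<open>exp (O(\<kappa>))\<close>.

Lower bound. Choose a compact disc \<open>K\<close> that maps onto the surface and finitely many deck transformations \<open>S\<close> whose translates of \<open>K\<close>
cover a larger compact set. If all traces of elements of \<open>S\<close> and of their products have modulus at most \<open>\<tau>\<close>, then a single
conjugation makes all of \<open>S\<close> of squared norm \<open>O(\<tau>\<^sup>2)\<close> (\<open>conj_bounded_by_traces\<close>). In these coordinates some
form \<open>Y\<close> has value 1 at a point of \<open>K\<close> and is \<open>O(\<tau>\<^sup>2)\<close> on the larger set (\<open>extremal_form\<close>). The key fact is a converse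
of Gronwall's inequality: such a bounded growth of \<open>Y\<close> forces \<open>\<bar>q\<bar> = O((1 + ln \<tau>)\<^sup>2)\<close> on \<open>K\<close> (\<open>potential_le_growth\<close>),
because \<open>\<surd>\<bar>q\<bar>\<close> is dominated by the logarithmic derivatives of \<open>Y\<close> and \<open>Y'\<close>, and the logarithmic derivative of a
function with few zeros has small integral (\<open>log_deriv_bound\<close>). Hence \<open>\<surd>\<parallel>\<phi>\<parallel> = O(1 + ln \<tau>)\<close>, and an element of trace \<open>\<tau>\<close>
has translation length at least \<open>2 ln (\<tau> / 2)\<close>.

This comparison needs \<open>\<tau>\<close> bounded away from 2, uniformly in \<open>\<phi>\<close>. The same extremal form gives this bound: restricted to a large hyperbolic disc and read in its disc coordinate, it contradicts the maximum principle
unless \<open>\<tau> > 4\<close> (\<open>form_forces_expansion\<close>).\<close>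

no_notation fps_nth (infixl "$" 75)

section \<open>Hyperbolic displacement and Frobenius norms\<close>

lemma mat2_mult:
  fixes A B :: "complex^2^2"
  shows "(A ** B)$1$1 = A$1$1 * B$1$1 + A$1$2 * B$2$1"
    and "(A ** B)$1$2 = A$1$1 * B$1$2 + A$1$2 * B$2$2"
    and "(A ** B)$2$1 = A$2$1 * B$1$1 + A$2$2 * B$2$1"
    and "(A ** B)$2$2 = A$2$1 * B$1$2 + A$2$2 * B$2$2"
  by (simp_all add: matrix_matrix_mult_def sum_2)

lemma mat2_eq_iff:
  fixes A B :: "complex^2^2"
  shows "A = B \<longleftrightarrow> A$1$1 = B$1$1 \<and> A$1$2 = B$1$2 \<and> A$2$1 = B$2$1 \<and> A$2$2 = B$2$2"
  by (auto simp: vec_eq_iff forall_2)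

lemma mat2_one: "(mat 1 :: complex^2^2)$1$1 = 1" "(mat 1 :: complex^2^2)$1$2 = 0"
    "(mat 1 :: complex^2^2)$2$1 = 0" "(mat 1 :: complex^2^2)$2$2 = 1"
  by (simp_all add: mat_def)

definition mat2 :: "complex \<Rightarrow> complex \<Rightarrow> complex \<Rightarrow> complex \<Rightarrow> complex^2^2" where
  "mat2 a b c d = vector [vector [a, b], vector [c, d]]"

lemma mat2_nth [simp]: "mat2 a b c d $1$1 = a" "mat2 a b c d $1$2 = b" "mat2 a b c d $2$1 = c"
    "mat2 a b c d $2$2 = d"
  by (simp_all add: mat2_def)

definition frobenius_sq :: "complex^2^2 \<Rightarrow> real" where
  "frobenius_sq M = (cmod (M$1$1))\<^sup>2 + (cmod (M$1$2))\<^sup>2 + (cmod (M$2$1))\<^sup>2 + (cmod (M$2$2))\<^sup>2"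

lemma of_real_cmod_sq: "(complex_of_real (cmod z))\<^sup>2 = z * cnj z"
  by (metis complex_norm_square of_real_power)

text \<open>The squared Frobenius norm of the conjugate of \<open>M\<close> by an upper triangular matrix that carries the base point \<open>(0, 1)\<close> to
\<open>(z, t)\<close>.\<close>

definition displacement_form :: "complex^2^2 \<Rightarrow> complex \<Rightarrow> real \<Rightarrow> real" where
  "displacement_form M z t = (cmod (M$1$1 - z * M$2$1))\<^sup>2
     + (cmod (M$1$1 * z + M$1$2 - z * (M$2$1 * z + M$2$2)))\<^sup>2 / t\<^sup>2
     + t\<^sup>2 * (cmod (M$2$1))\<^sup>2 + (cmod (M$2$1 * z + M$2$2))\<^sup>2"

lemma cmod_add_sq: "(cmod (x + y))\<^sup>2 \<le> 2 * (cmod x)\<^sup>2 + 2 * (cmod y)\<^sup>2"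
proof -
  have "(cmod (x + y))\<^sup>2 \<le> (cmod x + cmod y)\<^sup>2"
    by (intro power_mono norm_triangle_ineq) auto
  also have "\<dots> \<le> 2 * (cmod x)\<^sup>2 + 2 * (cmod y)\<^sup>2"
    using sum_squares_bound[of "cmod x" "cmod y"] by (simp add: power2_sum)
  finally show ?thesis .
qed

text \<open>The first and last summands of the form are the squared moduli of two numbers whose sum is the trace.\<close>

lemma trace_sq_le_displacement_form: "(cmod (trace M))\<^sup>2 \<le> 2 * displacement_form M z t"
proof -
  have "trace M = (M$1$1 - z * M$2$1) + (M$2$1 * z + M$2$2)"
    by (simp add: trace_def sum_2)
  then have "(cmod (trace M))\<^sup>2 \<le> 2 * (cmod (M$1$1 - z * M$2$1))\<^sup>2 + 2 * (cmod (M$2$1 * z + M$2$2))\<^sup>2"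
    using cmod_add_sq by metis
  moreover have "0 \<le> (cmod (M$1$1 * z + M$1$2 - z * (M$2$1 * z + M$2$2)))\<^sup>2 / t\<^sup>2"
    "0 \<le> t\<^sup>2 * (cmod (M$2$1))\<^sup>2" by simp_all
  ultimately show ?thesis unfolding displacement_form_def distrib_left by linarith
qed

lemma det_le_frobenius: "2 * cmod (a * d - b * c) \<le> (cmod a)\<^sup>2 + (cmod b)\<^sup>2 + (cmod c)\<^sup>2 + (cmod d)\<^sup>2"
proof -
  have "cmod (a * d - b * c) \<le> cmod a * cmod d + cmod b * cmod c"
    by (metis norm_mult norm_triangle_ineq4)
  with sum_squares_bound[of "cmod a" "cmod d"] sum_squares_bound[of "cmod b" "cmod c"]
  show ?thesis by simp
qed

lemma displacement_form_ge_2: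
  assumes "det M = 1" "t > 0"
  shows "displacement_form M z t \<ge> 2"
proof -
  define p where "p = M$1$1 * z + M$1$2 - z * (M$2$1 * z + M$2$2)"
  have d: "M$1$1 * M$2$2 - M$1$2 * M$2$1 = 1" using assms by (simp add: det_2)
  have "(M$1$1 - z * M$2$1) * (M$2$1 * z + M$2$2) - (p / of_real t) * (of_real t * M$2$1) = 1"
  proof -
    have "(p / of_real t) * (of_real t * M$2$1) = p * M$2$1" using assms(2) by simp
    then show ?thesis using d unfolding p_def by (simp add: algebra_simps)
  qed
  with det_le_frobenius[of "M$1$1 - z * M$2$1" "M$2$1 * z + M$2$2" "p / of_real t" "of_real t * M$2$1"]
  show ?thesis using assms(2)
    by (simp add: displacement_form_def p_def[symmetric] norm_divide norm_mult power_divide power_mult_distrib)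
qed

text \<open>For the base point \<open>(0, 1)\<close> this is the familiar \<open>2 cosh d = \<parallel>M\<parallel>\<^sup>2\<close>, and conjugation transports it to every point. The
horizontal distance is evaluated by Lagrange's identity for the entries of the conjugate, whose determinant is 1.\<close>

lemma hyp3_dist_act:
  assumes "det M = 1" "t > 0"
  shows "hyp3_dist (z, t) (hyp3_act M (z, t)) = arcosh (displacement_form M z t / 2)"
proof -
  define a b c d where "a = M$1$1" "b = M$1$2" "c = M$2$1" "d = M$2$2"
  note abcd = this
  define P where "P = a * z + b - z * (c * z + d)"
  define D where "D = c * z + d"
  define a' where "a' = a - z * c"
  define n where "n = (cmod D)\<^sup>2 + (cmod c)\<^sup>2 * t\<^sup>2"
  have dt: "a' * D - P * c = 1"
    using assms(1) unfolding abcd P_def D_def a'_def by (simp add: det_2 algebra_simps)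
  have n: "n > 0"
  proof -
    have "D \<noteq> 0 \<or> c \<noteq> 0" using dt by auto
    then show ?thesis using assms(2) by (auto simp: n_def intro: add_pos_nonneg add_nonneg_pos)
  qed
  define w where "w = ((a * z + b) * cnj D + a * cnj c * of_real (t\<^sup>2)) / of_real n"
  have act: "hyp3_act M (z, t) = (w, t / n)"
    by (simp add: hyp3_act_def Let_def abcd w_def n_def D_def)
  have nD: "complex_of_real n = D * cnj D + c * cnj c * of_real (t\<^sup>2)"
    by (simp add: n_def of_real_cmod_sq)
  have w1: "(w - z) * of_real n = P * cnj D + a' * cnj c * of_real (t\<^sup>2)"
  proof -
    have "w * of_real n = (a * z + b) * cnj D + a * cnj c * of_real (t\<^sup>2)"
      using n by (simp add: w_def)
    then show ?thesis
      unfolding left_diff_distrib nD by (simp add: P_def D_def a'_def algebra_simps)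
  qed
  have lag: "(cmod (P * cnj D + a' * cnj c * of_real (t\<^sup>2)))\<^sup>2 + t\<^sup>2
      = n * ((cmod a')\<^sup>2 * t\<^sup>2 + (cmod P)\<^sup>2)"
  proof -
    have e: "(cmod (a' * D - P * c))\<^sup>2 = 1" using dt by simp
    have "complex_of_real ((cmod (P * cnj D + a' * cnj c * of_real (t\<^sup>2)))\<^sup>2
           + (cmod (a' * D - P * c))\<^sup>2 * t\<^sup>2)
      = complex_of_real (n * ((cmod a')\<^sup>2 * t\<^sup>2 + (cmod P)\<^sup>2))"
      unfolding of_real_add of_real_mult complex_norm_square nD
      by (simp add: algebra_simps power2_eq_square)
    then have "(cmod (P * cnj D + a' * cnj c * of_real (t\<^sup>2)))\<^sup>2
           + (cmod (a' * D - P * c))\<^sup>2 * t\<^sup>2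
      = n * ((cmod a')\<^sup>2 * t\<^sup>2 + (cmod P)\<^sup>2)"
      unfolding of_real_eq_iff .
    then show ?thesis using e by simp
  qed
  have "(cmod (w - z) * n)\<^sup>2 = (cmod ((w - z) * of_real n))\<^sup>2"
    using n by (simp add: norm_mult)
  also have "\<dots> = n * ((cmod a')\<^sup>2 * t\<^sup>2 + (cmod P)\<^sup>2) - t\<^sup>2"
    using lag w1 by simp
  finally have wz: "(cmod (w - z))\<^sup>2 * n\<^sup>2 = n * ((cmod a')\<^sup>2 * t\<^sup>2 + (cmod P)\<^sup>2) - t\<^sup>2"
    by (simp add: power_mult_distrib)
  have wz': "(cmod (z - w))\<^sup>2 = (n * ((cmod a')\<^sup>2 * t\<^sup>2 + (cmod P)\<^sup>2) - t\<^sup>2) / n\<^sup>2"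
    using wz n by (simp add: field_simps norm_minus_commute)
  have "1 + ((cmod (z - w))\<^sup>2 + (t - t / n)\<^sup>2) / (2 * t * (t / n))
     = ((cmod a')\<^sup>2 + (cmod P)\<^sup>2 / t\<^sup>2 + n) / 2"
    unfolding wz' using n assms(2) by (simp add: divide_simps power2_eq_square) (simp add: algebra_simps)
  also have "\<dots> = displacement_form M z t / 2"
    by (simp add: displacement_form_def a'_def P_def n_def D_def abcd algebra_simps)
  finally show ?thesis unfolding act hyp3_dist_def prod.case by (rule arg_cong)
qed

text \<open>For \<open>\<bar>x\<bar>\<^sup>2 + \<bar>y\<bar>\<^sup>2 = 1\<close> this is the element of \<open>SU(2)\<close> with first column \<open>(x, y)\<close>; \<open>rot'\<close> is then its inverse.\<close>

definition rot :: "complex \<Rightarrow> complex \<Rightarrow> complex^2^2" where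
  "rot x y = mat2 x (- cnj y) y (cnj x)"

definition rot' :: "complex \<Rightarrow> complex \<Rightarrow> complex^2^2" where
  "rot' x y = mat2 (cnj x) (cnj y) (- y) x"

lemma rot_inverse:
  assumes "(cmod x)\<^sup>2 + (cmod y)\<^sup>2 = 1"
  shows "rot x y ** rot' x y = mat 1" "rot' x y ** rot x y = mat 1"
proof -
  have "complex_of_real ((cmod x)\<^sup>2 + (cmod y)\<^sup>2) = 1" using assms by simp
  then have "x * cnj x + y * cnj y = 1" by (simp add: of_real_cmod_sq)
  then show "rot x y ** rot' x y = mat 1" "rot' x y ** rot x y = mat 1"
    unfolding mat2_eq_iff mat2_mult mat2_one rot_def rot'_def by (auto simp: algebra_simps)
qed

lemma frobenius_sq_complex: "complex_of_real (frobenius_sq M) = M$1$1 * cnj (M$1$1) + M$1$2 * cnj (M$1$2)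
   + M$2$1 * cnj (M$2$1) + M$2$2 * cnj (M$2$2)"
  by (simp add: frobenius_sq_def of_real_cmod_sq)

lemma frobenius_conj_rot:
  assumes "(cmod x)\<^sup>2 + (cmod y)\<^sup>2 = 1"
  shows "frobenius_sq (rot' x y ** M ** rot x y) = frobenius_sq M"
proof -
  have "complex_of_real ((cmod x)\<^sup>2 + (cmod y)\<^sup>2) = 1" using assms by simp
  then have e: "y * cnj y = 1 - x * cnj x" by (simp add: of_real_cmod_sq algebra_simps)
  have 1: "frobenius_sq (rot' x y ** N) = frobenius_sq N" for N
  proof -
    have "complex_of_real (frobenius_sq (rot' x y ** N)) = (x * cnj x + y * cnj y) * complex_of_real (frobenius_sq N)"
      unfolding frobenius_sq_complex mat2_mult rot'_def mat2_nth by (simp add: algebra_simps)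
    then show ?thesis unfolding e by simp
  qed
  have 2: "frobenius_sq (N ** rot x y) = frobenius_sq N" for N
  proof -
    have "complex_of_real (frobenius_sq (N ** rot x y)) = (x * cnj x + y * cnj y) * complex_of_real (frobenius_sq N)"
      unfolding frobenius_sq_complex mat2_mult rot_def mat2_nth by (simp add: algebra_simps)
    then show ?thesis unfolding e by simp
  qed
  show ?thesis using 1 2 by simp
qed

text \<open>An upper triangular matrix acts on hyperbolic space by sending the base point to \<open>(\<beta>/\<delta>, \<bar>\<alpha>/\<delta>\<bar>)\<close>, and conjugating by it
is the same as moving the base point there.\<close>

lemma frobenius_conj_upper:
  assumes "A ** B = mat 1" and c: "A$2$1 = 0"
  shows "\<exists>z t. t > 0 \<and> frobenius_sq (B ** M ** A) = displacement_form M z t"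
proof -
  define \<alpha> \<beta> \<delta> where "\<alpha> = A$1$1" "\<beta> = A$1$2" "\<delta> = A$2$2"
  note ab = this
  have e: "\<alpha> * B$1$1 + \<beta> * B$2$1 = 1" "\<alpha> * B$1$2 + \<beta> * B$2$2 = 0" "\<delta> * B$2$1 = 0" "\<delta> * B$2$2 = 1"
    using assms unfolding mat2_eq_iff mat2_mult mat2_one ab by auto
  have d0: "\<delta> \<noteq> 0" using e by auto
  have B: "B$2$1 = 0" "B$2$2 = 1 / \<delta>" using e d0 by (auto simp: field_simps)
  have a0: "\<alpha> \<noteq> 0" using e B by auto
  have B2: "B$1$1 = 1 / \<alpha>" "B$1$2 = - \<beta> / (\<alpha> * \<delta>)"
    using e B a0 d0 by (auto simp: field_simps add_eq_0_iff)
  define z where "z = \<beta> / \<delta>"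
  define t where "t = cmod (\<alpha> / \<delta>)"
  have t: "t > 0" using a0 d0 by (simp add: t_def)
  define N where "N = B ** M ** A"
  have N: "N$1$1 = M$1$1 - z * M$2$1"
     "N$1$2 = (M$1$1 * z + M$1$2 - z * (M$2$1 * z + M$2$2)) / (\<alpha> / \<delta>)"
     "N$2$1 = (\<alpha> / \<delta>) * M$2$1" "N$2$2 = M$2$1 * z + M$2$2"
    unfolding N_def mat2_mult B B2 ab[symmetric] c z_def using a0 d0 by (simp_all add: field_simps)
  have "frobenius_sq N = displacement_form M z t"
    unfolding frobenius_sq_def displacement_form_def N norm_divide norm_mult power_mult_distrib power_divide
    by (simp add: t_def norm_divide power_divide)
  with t show ?thesis unfolding N_def by blast
qed

text \<open>Every conjugating matrix is an upper triangular one times a unitary one, and the Frobenius norm does not see the unitary factor.\<close>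

lemma frobenius_conj_displacement:
  assumes AB: "A ** B = mat 1"
  shows "\<exists>z t. t > 0 \<and> frobenius_sq (B ** M ** A) = displacement_form M z t"
proof -
  define n where "n = sqrt ((cmod (A$2$1))\<^sup>2 + (cmod (A$2$2))\<^sup>2)"
  have "A$2$1 \<noteq> 0 \<or> A$2$2 \<noteq> 0"
    using AB unfolding mat2_eq_iff mat2_mult mat2_one by auto
  then have "(cmod (A$2$1))\<^sup>2 + (cmod (A$2$2))\<^sup>2 > 0"
    by (auto intro: add_pos_nonneg add_nonneg_pos)
  then have n: "n > 0" "n\<^sup>2 = (cmod (A$2$1))\<^sup>2 + (cmod (A$2$2))\<^sup>2" by (auto simp: n_def)
  define x y where "x = A$2$2 / of_real n" "y = - A$2$1 / of_real n"
  note xy = this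
  have u: "(cmod x)\<^sup>2 + (cmod y)\<^sup>2 = 1"
  proof -
    have "(cmod x)\<^sup>2 + (cmod y)\<^sup>2 = ((cmod (A$2$1))\<^sup>2 + (cmod (A$2$2))\<^sup>2) / n\<^sup>2"
      using n(1) by (simp add: xy norm_divide power_divide add_divide_distrib add.commute)
    then show ?thesis unfolding n(2)[symmetric] using n(1) by simp
  qed
  have "(A ** rot x y) ** (rot' x y ** B) = A ** (rot x y ** rot' x y) ** B"
    by (simp add: matrix_mul_assoc)
  also have "\<dots> = mat 1" using AB by (simp add: rot_inverse(1)[OF u])
  finally have i: "(A ** rot x y) ** (rot' x y ** B) = mat 1" .
  have "(A ** rot x y)$2$1 = 0" using n by (simp add: mat2_mult rot_def xy field_simps)
  from frobenius_conj_upper[OF i this, of M] obtain z t where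
     zt: "t > 0" "frobenius_sq (rot' x y ** B ** M ** (A ** rot x y)) = displacement_form M z t" by blast
  have "rot' x y ** B ** M ** (A ** rot x y) = rot' x y ** (B ** M ** A) ** rot x y"
    by (simp add: matrix_mul_assoc)
  then have "frobenius_sq (B ** M ** A) = displacement_form M z t" using zt(2) frobenius_conj_rot[OF u] by metis
  with zt(1) show ?thesis by blast
qed

lemma ln_le_arcosh: "x \<ge> 1 \<Longrightarrow> ln x \<le> arcosh (x::real)"
proof -
  assume x: "x \<ge> 1"
  then have "sqrt (x\<^sup>2 - 1) \<ge> 0" by simp
  with x have "ln x \<le> ln (x + sqrt (x\<^sup>2 - 1))" by (subst ln_le_cancel_iff) linarith+
  with x show ?thesis by (simp add: arcosh_real_def)
qed

lemma arcosh_le_ln: "x \<ge> 1 \<Longrightarrow> arcosh (x::real) \<le> ln (2 * x)"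
proof -
  assume x: "x \<ge> 1"
  have "sqrt (x\<^sup>2 - 1) \<le> sqrt (x\<^sup>2)" by (rule real_sqrt_le_mono) simp
  then have "sqrt (x\<^sup>2 - 1) \<le> x" using x by simp
  moreover have "sqrt (x\<^sup>2 - 1) \<ge> 0" using x by (simp add: one_le_power)
  ultimately have "ln (x + sqrt (x\<^sup>2 - 1)) \<le> ln (2 * x)"
    using x by (subst ln_le_cancel_iff) linarith+
  then show ?thesis using x by (simp add: arcosh_real_def)
qed

text \<open>The norm of any conjugate is the displacement form of some point, and the infimum over points is at most its value there.\<close>

lemma translation_length_le:
  assumes "det M = 1" "A ** B = mat 1"
  shows "translation_length M \<le> ln (frobenius_sq (B ** M ** A))"
proof -
  obtain z t where zt: "t > 0" "frobenius_sq (B ** M ** A) = displacement_form M z t" using frobenius_conj_displacement assms by blast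
  have "translation_length M \<le> hyp3_dist (z, t) (hyp3_act M (z, t))"
    unfolding translation_length_def
  proof (rule cINF_lower)
    show "bdd_below ((\<lambda>x. hyp3_dist x (hyp3_act M x)) ` hyp3)"
    proof (rule bdd_belowI2[of _ 0])
      fix x assume "x \<in> hyp3"
      then obtain z t where x: "x = (z, t)" "t > 0" by (auto simp: hyp3_def)
      have "displacement_form M z t / 2 \<ge> 1" using displacement_form_ge_2[OF assms(1) x(2), of z] by simp
      then have "0 \<le> arcosh (displacement_form M z t / 2)" using ln_le_arcosh ln_ge_zero order_trans by blast
      then show "0 \<le> hyp3_dist x (hyp3_act M x)" using hyp3_dist_act[OF assms(1) x(2)] x by simp
    qed
  qed (use zt in \<open>simp add: hyp3_def\<close>)
  also have "\<dots> = arcosh (displacement_form M z t / 2)" using hyp3_dist_act assms zt by blast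
  also have "\<dots> \<le> ln (displacement_form M z t)"
    using arcosh_le_ln[of "displacement_form M z t / 2"] displacement_form_ge_2[OF assms(1) zt(1), of z] by simp
  finally show ?thesis using zt by simp
qed

text \<open>The trace is the same for all conjugates, so it bounds the displacement at every point from below.\<close>

lemma translation_length_ge:
  assumes "det M = 1" "cmod (trace M) \<ge> 2"
  shows "translation_length M \<ge> 2 * ln (cmod (trace M) / 2)"
proof -
  define x where "x = (cmod (trace M) / 2)\<^sup>2"
  have x: "x \<ge> 1" using assms(2) by (simp add: x_def one_le_power)
  have "ln x \<le> translation_length M"
    unfolding translation_length_def
  proof (rule cINF_greatest)
    show "hyp3 \<noteq> {}" by (auto simp: hyp3_def intro: exI[of _ 1])
    fix y assume "y \<in> hyp3"
    then obtain z t where y: "y = (z, t)" "t > 0" by (auto simp: hyp3_def)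
    have "x \<le> displacement_form M z t / 2" using trace_sq_le_displacement_form[of M z t] by (simp add: x_def power_divide)
    then have "ln x \<le> ln (displacement_form M z t / 2)" using x by simp
    also have "\<dots> \<le> arcosh (displacement_form M z t / 2)"
      using displacement_form_ge_2[OF assms(1) y(2), of z] by (intro ln_le_arcosh) simp
    also have "\<dots> = hyp3_dist y (hyp3_act M y)" using y hyp3_dist_act assms by simp
    finally show "ln x \<le> hyp3_dist y (hyp3_act M y)" .
  qed
  moreover have "ln x = 2 * ln (cmod (trace M) / 2)" using assms(2) by (simp add: x_def ln_realpow)
  ultimately show ?thesis by simp
qed


lemma entry_le_frobenius:
  "(cmod (M$1$1))\<^sup>2 \<le> frobenius_sq M" "(cmod (M$1$2))\<^sup>2 \<le> frobenius_sq M" "(cmod (M$2$1))\<^sup>2 \<le> frobenius_sq M"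
  "(cmod (M$2$2))\<^sup>2 \<le> frobenius_sq M"
  by (simp_all add: frobenius_sq_def)

text \<open>Schur's triangular form: the first column of the unitary matrix is a normalized eigenvector, here \<open>(l - M\<^sub>2\<^sub>2, M\<^sub>2\<^sub>1)\<close> for an
eigenvalue \<open>l\<close>.\<close>

lemma rot_triangularizes:
  obtains x y where "(cmod x)\<^sup>2 + (cmod y)\<^sup>2 = 1" "(rot' x y ** M ** rot x y)$2$1 = 0"
proof (cases "M$2$1 = 0")
  case True
  show ?thesis by (rule that[of 1 0]) (simp_all add: mat2_mult rot_def rot'_def True)
next
  case False
  define T where "T = M$1$1 + M$2$2"
  define r where "r = csqrt (T\<^sup>2 - 4 * (M$1$1 * M$2$2 - M$1$2 * M$2$1))"
  define l where "l = (T + r) / 2"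
  have r2: "r * r = T * T - 4 * (M$1$1 * M$2$2 - M$1$2 * M$2$1)"
    using power2_csqrt[of "T\<^sup>2 - 4 * (M$1$1 * M$2$2 - M$1$2 * M$2$1)"] by (simp add: r_def power2_eq_square)
  have "4 * (l * l) = T * T + 2 * T * r + r * r" by (simp add: l_def algebra_simps)
  also have "\<dots> = 4 * (l * T - (M$1$1 * M$2$2 - M$1$2 * M$2$1))"
    unfolding r2 by (simp add: l_def algebra_simps)
  finally have l: "l * l = l * T - (M$1$1 * M$2$2 - M$1$2 * M$2$1)"
    unfolding mult_cancel_left by simp
  define v where "v = l - M$2$2"
  define n where "n = sqrt ((cmod v)\<^sup>2 + (cmod (M$2$1))\<^sup>2)"
  have "(cmod v)\<^sup>2 + (cmod (M$2$1))\<^sup>2 > 0" using False by (auto intro: add_nonneg_pos)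
  then have n: "n > 0" "n\<^sup>2 = (cmod v)\<^sup>2 + (cmod (M$2$1))\<^sup>2" by (auto simp: n_def)
  define x y where "x = v / of_real n" "y = M$2$1 / of_real n"
  note xy = this
  have u: "(cmod x)\<^sup>2 + (cmod y)\<^sup>2 = 1"
  proof -
    have "(cmod x)\<^sup>2 + (cmod y)\<^sup>2 = ((cmod v)\<^sup>2 + (cmod (M$2$1))\<^sup>2) / n\<^sup>2"
      using n(1) by (simp add: xy norm_divide power_divide add_divide_distrib)
    then show ?thesis unfolding n(2)[symmetric] using n(1) by simp
  qed
  have "(- M$2$1 * M$1$1 + v * M$2$1) * v + (- M$2$1 * M$1$2 + v * M$2$2) * M$2$1
      = M$2$1 * (l * l - (l * T - (M$1$1 * M$2$2 - M$1$2 * M$2$1)))"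
    by (simp add: v_def T_def algebra_simps)
  then have e: "(- M$2$1 * M$1$1 + v * M$2$1) * v + (- M$2$1 * M$1$2 + v * M$2$2) * M$2$1 = 0"
    using l by simp
  have "(rot' x y ** M ** rot x y)$2$1
      = ((- M$2$1 * M$1$1 + v * M$2$1) * v + (- M$2$1 * M$1$2 + v * M$2$2) * M$2$1) / (of_real n)\<^sup>2"
    using n(1) by (simp add: mat2_mult rot_def rot'_def xy field_simps power2_eq_square)
  then have "(rot' x y ** M ** rot x y)$2$1 = 0" unfolding e by simp
  with u show ?thesis using that by blast
qed

text \<open>If the largest matrix is upper triangular and much larger than the traces, its size sits in its upper right corner \<open>b\<close>, since the
diagonal is controlled by the trace and the determinant. The trace of its product with \<open>s\<close> contains the product of \<open>b\<close> with
the lower left entry of \<open>s\<close>, so that entry is \<open>O(\<tau>)\<close> for every \<open>s\<close>; determinant and trace then bound the diagonal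
entries by \<open>O(\<surd>(\<tau> l))\<close>. Only upper right entries are large, and a diagonal conjugation makes them smaller.\<close>

lemma conj_contract_triangular:
  assumes det: "\<And>s. s \<in> S \<Longrightarrow> det s = 1" and \<tau>: "\<tau> \<ge> 1"
    and tr1: "\<And>s. s \<in> S \<Longrightarrow> cmod (trace s) \<le> \<tau>"
    and tr2: "\<And>s t. s \<in> S \<Longrightarrow> t \<in> S \<Longrightarrow> cmod (trace (s ** t)) \<le> \<tau>"
    and s0: "s0 \<in> S" "s0$2$1 = 0" "frobenius_sq s0 = l\<^sup>2"
    and max: "\<And>s. s \<in> S \<Longrightarrow> frobenius_sq s \<le> l\<^sup>2" and l: "l > 72 * \<tau>"
  obtains A B where "A ** B = mat 1" "\<And>s. s \<in> S \<Longrightarrow> frobenius_sq (B ** s ** A) < l\<^sup>2 / 2"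
proof -
  \<comment> \<open>Upper right entries, at most \<open>l\<close>, are divided by \<open>k\<close>, and lower left ones, at most \<open>8 \<tau>\<close>, multiplied by it. Both squares become \<open>8 \<tau> l\<close>.\<close>
  define k where "k = sqrt (l / (8 * \<tau>))"
  have k: "k > 0" "k\<^sup>2 = l / (8 * \<tau>)" using l \<tau> by (auto simp: k_def)
  define A B where "A = mat2 (of_real k) 0 0 1" "B = mat2 (1 / of_real k) 0 0 1"
  note AB = this
  have l1: "1 \<le> \<tau> * l" "l > 0" "\<tau> \<le> \<tau> * l"
  proof -
    show "l > 0" using l \<tau> by simp
    show "\<tau> \<le> \<tau> * l" using l \<tau> by simp
    with \<tau> show "1 \<le> \<tau> * l" by linarith
  qed
  define a b d where "a = s0$1$1" "b = s0$1$2" "d = s0$2$2"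
  note abd = this
  have ad: "a * d = 1" using det[OF s0(1)] s0(2) by (simp add: det_2 abd)
  have tad: "cmod (a + d) \<le> \<tau>" using tr1[OF s0(1)] by (simp add: trace_def sum_2 abd)
  have diag: "cmod u \<le> 2 * \<tau>" if "u * v = 1" "cmod (u + v) \<le> \<tau>" for u v
  proof (rule ccontr)
    assume "\<not> cmod u \<le> 2 * \<tau>"
    then have u: "cmod u > 2 * \<tau>" by simp
    have "cmod u * cmod v = 1" using that(1) by (metis norm_mult norm_one)
    moreover have "cmod u > 1" using u \<tau> by simp
    ultimately have "cmod v \<le> 1"
      by (metis less_eq_real_def linorder_not_less mult_le_cancel_left1 norm_ge_zero not_one_le_zero order_trans zero_le_one)
    moreover have "cmod u \<le> cmod (u + v) + cmod v"
      by (metis add_diff_cancel_right' norm_triangle_ineq4)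
    ultimately show False using u that(2) \<tau> by linarith
  qed
  have a: "cmod a \<le> 2 * \<tau>" using diag[OF ad tad] .
  have d: "cmod d \<le> 2 * \<tau>" using diag[of d a] ad tad by (simp add: mult.commute add.commute)
  have "(cmod a)\<^sup>2 + (cmod b)\<^sup>2 + (cmod d)\<^sup>2 = l\<^sup>2"
    using s0(3) s0(2) by (simp add: frobenius_sq_def abd)
  moreover have "(cmod a)\<^sup>2 \<le> 4 * \<tau>\<^sup>2" "(cmod d)\<^sup>2 \<le> 4 * \<tau>\<^sup>2"
    using power_mono[OF a norm_ge_zero, of 2] power_mono[OF d norm_ge_zero, of 2]
    by (simp_all add: power_mult_distrib)
  moreover have "5184 * \<tau>\<^sup>2 \<le> l\<^sup>2"
    using power_mono[of "72 * \<tau>" l 2] l \<tau> by (simp add: power_mult_distrib)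
  moreover have "0 \<le> l\<^sup>2" by simp
  ultimately have "25 * l\<^sup>2 \<le> 64 * (cmod b)\<^sup>2" by linarith
  then have "(5 / 8 * l)\<^sup>2 \<le> (cmod b)\<^sup>2" by (simp add: power_mult_distrib power_divide)
  then have b: "5 / 8 * l \<le> cmod b" by (rule power2_le_imp_le) simp
  have small: "frobenius_sq (B ** s ** A) < l\<^sup>2 / 2" if s: "s \<in> S" for s
  proof -
    define a' b' c' d' where "a' = s$1$1" "b' = s$1$2" "c' = s$2$1" "d' = s$2$2"
    note abcd = this
    have ent: "cmod a' \<le> l" "cmod b' \<le> l" "cmod d' \<le> l"
      using entry_le_frobenius[of s] max[OF s] l1(2) unfolding abcd
      by (meson order_trans power2_le_imp_le less_imp_le)+
    have t1: "cmod (a' + d') \<le> \<tau>" using tr1[OF s] by (simp add: trace_def sum_2 abcd)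
    have dd: "a' * d' = 1 + b' * c'" using det[OF s] by (simp add: det_2 abcd algebra_simps)
    have "trace (s0 ** s) = a * a' + b * c' + d * d'"
      by (simp add: trace_def sum_2 mat2_mult abd abcd s0(2))
    then have bc: "b * c' = trace (s0 ** s) - (a * a' + d * d')" by simp
    have "cmod (b * c') \<le> cmod (trace (s0 ** s)) + (cmod a * cmod a' + cmod d * cmod d')"
      using norm_triangle_ineq4[of "trace (s0 ** s)" "a * a' + d * d'"] norm_triangle_ineq[of "a * a'" "d * d'"]
      unfolding bc norm_mult[of a] norm_mult[of d] by linarith
    moreover have "cmod a * cmod a' \<le> 2 * \<tau> * l" "cmod d * cmod d' \<le> 2 * \<tau> * l"
      using a d ent \<tau> by (auto intro!: mult_mono)
    ultimately have "cmod b * cmod c' \<le> 5 * (\<tau> * l)"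
      using tr2[OF s0(1) s] l1 by (simp add: norm_mult)
    moreover have "5 / 8 * (l * cmod c') \<le> cmod b * cmod c'"
      using mult_right_mono[OF b norm_ge_zero[of c']] by (simp only: mult.assoc)
    ultimately have "l * cmod c' \<le> 8 * (\<tau> * l)" by linarith
    then have "l * cmod c' \<le> l * (8 * \<tau>)" by (simp only: ac_simps)
    then have c': "cmod c' \<le> 8 * \<tau>" using l1(2) by (simp only: mult_le_cancel_left_pos)
    have "cmod (b' * c') \<le> l * (8 * \<tau>)" unfolding norm_mult using ent c' l1 \<tau> by (intro mult_mono) auto
    then have ad': "cmod (a' * d') \<le> 9 * (\<tau> * l)"
      unfolding dd using norm_triangle_ineq[of 1 "b' * c'"] l1 by (simp add: algebra_simps)
    have sq: "(cmod u)\<^sup>2 \<le> 10 * (\<tau> * l)" if "cmod (u * v) \<le> 9 * (\<tau> * l)" "cmod (u + v) \<le> \<tau>" "cmod u \<le> l" for u v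
    proof -
      have "u\<^sup>2 = u * (u + v) - u * v" by (simp add: algebra_simps power2_eq_square)
      then have "(cmod u)\<^sup>2 \<le> cmod u * cmod (u + v) + cmod (u * v)"
        by (metis norm_mult norm_power norm_triangle_ineq4)
      moreover have "cmod u * cmod (u + v) \<le> l * \<tau>" using that l1 by (intro mult_mono) auto
      ultimately show ?thesis using that(1) by (simp add: mult.commute)
    qed
    have a2: "(cmod a')\<^sup>2 \<le> 10 * (\<tau> * l)" using sq[OF ad' t1 ent(1)] .
    have d2: "(cmod d')\<^sup>2 \<le> 10 * (\<tau> * l)"
      using sq[of d' a'] ad' t1 ent(3) by (simp add: mult.commute add.commute)
    have b2: "(cmod b')\<^sup>2 / k\<^sup>2 \<le> 8 * (\<tau> * l)"
    proof -
      have "(cmod b')\<^sup>2 / k\<^sup>2 \<le> l\<^sup>2 / k\<^sup>2" using ent by (intro divide_right_mono power_mono) auto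
      also have "\<dots> = 8 * (\<tau> * l)" unfolding k(2) using l1 \<tau> by (simp add: power2_eq_square)
      finally show ?thesis .
    qed
    have c2: "(cmod c')\<^sup>2 * k\<^sup>2 \<le> 8 * (\<tau> * l)"
    proof -
      have "(cmod c')\<^sup>2 * k\<^sup>2 \<le> (8 * \<tau>)\<^sup>2 * k\<^sup>2" using c' by (intro mult_right_mono power_mono) auto
      also have "\<dots> = 8 * (\<tau> * l)" unfolding k(2) using l1 \<tau> by (simp add: power2_eq_square)
      finally show ?thesis .
    qed
    have "frobenius_sq (B ** s ** A) = (cmod a')\<^sup>2 + (cmod b')\<^sup>2 / k\<^sup>2 + (cmod c')\<^sup>2 * k\<^sup>2 + (cmod d')\<^sup>2"
      using k(1) by (simp add: frobenius_sq_def mat2_mult AB abcd norm_mult norm_divide power_mult_distrib power_divide)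
    also have "\<dots> \<le> 36 * (\<tau> * l)" using a2 b2 c2 d2 by simp
    also have "\<dots> < l\<^sup>2 / 2" using l l1(2) by (simp add: power2_eq_square)
    finally show ?thesis .
  qed
  have "A ** B = mat 1" using k(1) by (simp add: mat2_eq_iff mat2_mult mat2_one AB)
  then show ?thesis using small that by blast
qed

lemma trace_conj:
  fixes A B M :: "complex^2^2"
  assumes "A ** B = mat 1"
  shows "trace (B ** M ** A) = trace M"
  by (metis assms matrix_mul_assoc matrix_mul_lid trace_mul_sym)

text \<open>Take a simultaneous conjugation whose largest Frobenius norm is within a factor of two of the infimum. A unitary conjugation makes the largest
element triangular without changing norms; if it exceeded \<open>72 \<tau>\<close>, a diagonal conjugation would
bring all squared norms below half of the chosen value, hence below the infimum.\<close>

lemma conj_bounded_by_traces: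
  fixes S :: "(complex^2^2) set"
  assumes fin: "finite S" and det: "\<And>s. s \<in> S \<Longrightarrow> det s = 1" and \<tau>: "\<tau> \<ge> 1"
    and tr1: "\<And>s. s \<in> S \<Longrightarrow> cmod (trace s) \<le> \<tau>"
    and tr2: "\<And>s t. s \<in> S \<Longrightarrow> t \<in> S \<Longrightarrow> cmod (trace (s ** t)) \<le> \<tau>"
  obtains A B where "A ** B = mat 1" "\<And>s. s \<in> S \<Longrightarrow> frobenius_sq (B ** s ** A) \<le> 5184 * \<tau>\<^sup>2"
proof (cases "S = {}")
  case True
  show ?thesis by (rule that[of "mat 1" "mat 1"]) (simp_all add: True)
next
  case ne: False
  define f where "f = (\<lambda>(A, B). MAX s\<in>S. frobenius_sq (B ** s ** A))"
  define P where "P = {(A :: complex^2^2, B). A ** B = mat 1}"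
  define I where "I = (INF p\<in>P. f p)"
  have detc: "det (B ** s ** A) = 1" if "A ** B = mat 1" "s \<in> S" for A B s :: "complex^2^2"
  proof -
    have "det (B ** s ** A) = det (A ** B) * det s" by (simp only: det_mul ac_simps)
    then show ?thesis using that det by simp
  qed
  have f2: "f p \<ge> 2" if "p \<in> P" for p
  proof -
    obtain A B where p: "p = (A, B)" "A ** B = mat 1" using \<open>p \<in> P\<close> by (auto simp: P_def)
    obtain s where s: "s \<in> S" using ne by blast
    have "frobenius_sq (B ** s ** A) \<ge> 2"
      using det_le_frobenius[of "(B ** s ** A)$1$1" "(B ** s ** A)$2$2" "(B ** s ** A)$1$2" "(B ** s ** A)$2$1"]
        detc[OF p(2) s] by (simp add: det_2 frobenius_sq_def)
    also have "\<dots> \<le> f p" unfolding f_def p prod.case by (rule Max_ge) (use fin s in auto)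
    finally show ?thesis .
  qed
  have Pne: "P \<noteq> {}" by (auto simp: P_def intro!: exI[of _ "mat 1"])
  have bdd: "bdd_below (f ` P)" using f2 by (meson bdd_belowI2)
  have I2: "I \<ge> 2" unfolding I_def using Pne f2 by (rule cINF_greatest)
  \<comment> \<open>The infimum need not be attained; a value below its double is enough.\<close>
  have "I < 2 * I" using I2 by simp
  then obtain p where p: "p \<in> P" "f p < 2 * I"
    unfolding I_def using cINF_less_iff[OF Pne bdd] by blast
  obtain A B where AB: "p = (A, B)" "A ** B = mat 1" using p(1) by (auto simp: P_def)
  have le: "frobenius_sq (B ** s ** A) \<le> f p" if "s \<in> S" for s
    unfolding f_def AB prod.case by (rule Max_ge) (use fin that in auto)
  have "f p \<in> (\<lambda>s. frobenius_sq (B ** s ** A)) ` S" unfolding f_def AB prod.case by (rule Max_in) (use fin ne in auto)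
  then obtain s0 where s0: "s0 \<in> S" "f p = frobenius_sq (B ** s0 ** A)" by blast
  define l where "l = sqrt (f p)"
  have l: "l\<^sup>2 = f p" using f2[OF p(1)] by (simp add: l_def)
  have "l \<le> 72 * \<tau>"
  proof (rule ccontr)
    assume "\<not> l \<le> 72 * \<tau>"
    then have l72: "l > 72 * \<tau>" by simp
    obtain x y where xy: "(cmod x)\<^sup>2 + (cmod y)\<^sup>2 = 1" "(rot' x y ** (B ** s0 ** A) ** rot x y)$2$1 = 0"
      by (rule rot_triangularizes)
    define A1 B1 where "A1 = A ** rot x y" "B1 = rot' x y ** B"
    have AB1: "A1 ** B1 = mat 1"
      by (metis A1_B1_def AB(2) matrix_mul_assoc matrix_mul_rid rot_inverse(1) xy(1))
    define S1 where "S1 = (\<lambda>s. B1 ** s ** A1) ` S"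
    have c: "B1 ** s ** A1 = rot' x y ** (B ** s ** A) ** rot x y" for s
      by (simp add: A1_B1_def matrix_mul_assoc)
    have fr: "frobenius_sq (B1 ** s ** A1) = frobenius_sq (B ** s ** A)" for s
      unfolding c by (rule frobenius_conj_rot[OF xy(1)])
    have prd: "(B1 ** s ** A1) ** (B1 ** t ** A1) = B1 ** (s ** t) ** A1" for s t
      by (metis AB1 matrix_mul_assoc matrix_mul_rid)
    obtain A2 B2 where AB2: "A2 ** B2 = mat 1" "\<And>s. s \<in> S1 \<Longrightarrow> frobenius_sq (B2 ** s ** A2) < l\<^sup>2 / 2"
    proof (rule conj_contract_triangular[of S1 \<tau> "B1 ** s0 ** A1" l])
      show "det s = 1" if "s \<in> S1" for s using that detc AB1 by (auto simp: S1_def)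
      show "cmod (trace s) \<le> \<tau>" if "s \<in> S1" for s using that tr1 trace_conj[OF AB1] by (auto simp: S1_def)
      show "cmod (trace (s ** t)) \<le> \<tau>" if "s \<in> S1" "t \<in> S1" for s t
        using that tr2 trace_conj[OF AB1] by (auto simp: S1_def prd)
      show "B1 ** s0 ** A1 \<in> S1" using s0 by (simp add: S1_def)
      show "(B1 ** s0 ** A1) $ 2 $ 1 = 0" using xy(2) c by simp
      show "frobenius_sq (B1 ** s0 ** A1) = l\<^sup>2" using fr l s0 by simp
      show "frobenius_sq s \<le> l\<^sup>2" if "s \<in> S1" for s using that fr l le by (auto simp: S1_def)
    qed (use \<tau> l72 in auto)
    define q where "q = (A1 ** A2, B2 ** B1)"
    have q: "q \<in> P"
      unfolding q_def P_def using AB1 AB2(1) by (simp, metis matrix_mul_assoc matrix_mul_rid)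
    have "f q \<in> (\<lambda>s. frobenius_sq (B2 ** B1 ** s ** (A1 ** A2))) ` S"
      unfolding f_def q_def prod.case by (rule Max_in) (use fin ne in auto)
    then obtain s where s: "s \<in> S" "f q = frobenius_sq (B2 ** (B1 ** s ** A1) ** A2)"
      by (auto simp: matrix_mul_assoc)
    then have "f q < l\<^sup>2 / 2" using AB2(2) by (auto simp: S1_def)
    then have "f q < I" using l p(2) by simp
    moreover have "I \<le> f q" unfolding I_def by (rule cINF_lower[OF bdd q])
    ultimately show False by simp
  qed
  moreover have "l \<ge> 0" using f2[OF p(1)] by (simp add: l_def)
  ultimately have "l\<^sup>2 \<le> (72 * \<tau>)\<^sup>2" by (intro power_mono)
  then have "f p \<le> 5184 * \<tau>\<^sup>2" using l by (simp add: power_mult_distrib)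
  then show ?thesis using that[OF AB(2)] le order_trans by blast
qed

section \<open>Change of variables for injective holomorphic maps\<close>

definition complex_to_vec :: "complex \<Rightarrow> real^2" where "complex_to_vec z = vector [Re z, Im z]"
definition vec_to_complex :: "real^2 \<Rightarrow> complex" where "vec_to_complex v = Complex (v$1) (v$2)"

lemma complex_to_vec_nth [simp]: "complex_to_vec z $ 1 = Re z" "complex_to_vec z $ 2 = Im z"
  by (simp_all add: complex_to_vec_def)

lemma vec_to_complex_to_vec [simp]: "vec_to_complex (complex_to_vec z) = z" and complex_to_vec_to_complex [simp]: "complex_to_vec (vec_to_complex v) = v"
  by (simp_all add: vec_to_complex_def vec_eq_iff forall_2)

lemma bounded_linear_complex_to_vec: "bounded_linear complex_to_vec" and bounded_linear_vec_to_complex: "bounded_linear vec_to_complex"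
  by (auto intro!: linearI simp: vec_eq_iff forall_2 vec_to_complex_def complex_eq_iff
      simp flip: linear_conv_bounded_linear)

lemma measurable_complex_to_vec [measurable]: "complex_to_vec \<in> borel_measurable borel"
  and measurable_vec_to_complex [measurable]: "vec_to_complex \<in> borel_measurable borel"
  using bounded_linear_complex_to_vec bounded_linear_vec_to_complex
  by (auto intro!: borel_measurable_continuous_onI linear_continuous_on)

lemma complex_to_vec_image: "complex_to_vec ` B = vec_to_complex -` B"
  by (metis (no_types, opaque_lifting) bij_image_Collect_eq bij_vimage_eq_inv_image complex_to_vec_to_complex inv_unique_comp
      o_def surj_imp_inv_eq vec_to_complex_to_vec bijI inj_on_inverseI surjI inv_equality)

lemma distr_lborel_complex_to_vec: "distr lborel borel complex_to_vec = (lborel :: (real^2) measure)"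
proof (rule lborel_eqI[symmetric])
  have B2: "(Basis :: (real^2) set) = {axis 1 1, axis 2 1}"
    by (auto simp: Basis_vec_def UNIV_2)
  have ne: "axis 1 1 \<noteq> (axis 2 1 :: real^2)" by (simp add: axis_eq_axis)
  fix l u :: "real^2" assume lu: "\<And>b. b \<in> Basis \<Longrightarrow> l \<bullet> b \<le> u \<bullet> b"
  have le: "l$1 \<le> u$1" "l$2 \<le> u$2" using lu[of "axis 1 1"] lu[of "axis 2 1"] unfolding B2 by (auto simp: inner_axis)
  have "complex_to_vec -` box l u = box (Complex (l$1) (l$2)) (Complex (u$1) (u$2))"
    by (auto simp: box_def B2 inner_axis Basis_complex_def)
  then have "emeasure (distr lborel borel complex_to_vec) (box l u)
     = emeasure lborel (box (Complex (l$1) (l$2)) (Complex (u$1) (u$2)))"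
    by (subst emeasure_distr) auto
  also have "\<dots> = ennreal ((u$1 - l$1) * (u$2 - l$2))"
    using le by (subst emeasure_lborel_box) (auto simp: Basis_complex_def inner_complex_def)
  also have "(u$1 - l$1) * (u$2 - l$2) = (\<Prod>b\<in>Basis. (u - l) \<bullet> b)"
    unfolding B2 using ne by (simp add: inner_axis)
  finally show "emeasure (distr lborel borel complex_to_vec) (box l u) = ennreal (\<Prod>b\<in>Basis. (u - l) \<bullet> b)"
    by simp
qed simp

text \<open>The real derivative of a holomorphic map is multiplication by \<open>f'\<close>, whose determinant is \<open>\<bar>f'\<bar>\<^sup>2\<close>. Boundedness makes all
measures finite, as the change of variables formula for Lebesgue measurable sets requires; the detour through \<open>\<real>\<^sup>2\<close> is there because
determinants are taken of matrices.\<close>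

lemma emeasure_image_holomorphic_bounded:
  assumes U: "open U" and f: "f holomorphic_on U" "inj_on f U"
    and B: "B \<in> sets borel" "B \<subseteq> U" "f ` B \<in> sets borel" and bdd: "bounded B" "\<And>z. z \<in> B \<Longrightarrow> cmod (deriv f z) \<le> n"
  shows "emeasure lborel (f ` B) = (\<integral>\<^sup>+z\<in>B. ennreal ((cmod (deriv f z))\<^sup>2) \<partial>lborel)"
proof -
  define F where "F = complex_to_vec \<circ> f \<circ> vec_to_complex"
  define F' where "F' = (\<lambda>v. complex_to_vec \<circ> (\<lambda>h. deriv f (vec_to_complex v) * h) \<circ> vec_to_complex)"
  define S where "S = complex_to_vec ` B"
  have S: "S \<in> sets borel" unfolding S_def complex_to_vec_image using measurable_sets[OF measurable_vec_to_complex B(1)] by simp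
  have FS: "F ` S = complex_to_vec ` (f ` B)" by (auto simp: F_def S_def image_image)
  have FS': "F ` S \<in> sets borel" unfolding FS complex_to_vec_image using measurable_sets[OF measurable_vec_to_complex B(3)] by simp
  have der: "(F has_derivative F' v) (at v within S)" if "v \<in> S" for v
  proof -
    have vU: "vec_to_complex v \<in> U" using that B(2) by (auto simp: S_def)
    have "(f has_derivative (\<lambda>h. deriv f (vec_to_complex v) * h)) (at (vec_to_complex v))"
      using holomorphic_derivI[OF f(1) U vU] by (simp add: has_field_derivative_def)
    moreover have "(vec_to_complex has_derivative vec_to_complex) (at v within S)"
      by (rule bounded_linear_imp_has_derivative[OF bounded_linear_vec_to_complex])
    ultimately have "((\<lambda>v. f (vec_to_complex v)) has_derivative (\<lambda>h. deriv f (vec_to_complex v) * vec_to_complex h)) (at v within S)"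
      by (rule has_derivative_compose[rotated])
    then show ?thesis unfolding F_def F'_def o_def
      by (rule bounded_linear.has_derivative[OF bounded_linear_complex_to_vec])
  qed
  have inj: "inj_on F S"
  proof (rule inj_onI)
    fix v w assume "v \<in> S" "w \<in> S" "F v = F w"
    then have "f (vec_to_complex v) = f (vec_to_complex w)" "vec_to_complex v \<in> U" "vec_to_complex w \<in> U"
      using B(2) by (auto simp: F_def S_def dest: arg_cong[where f = vec_to_complex])
    then have "vec_to_complex v = vec_to_complex w" using f(2) by (auto dest: inj_onD)
    then show "v = w" by (metis complex_to_vec_to_complex)
  qed
  have det: "\<bar>det (matrix (F' v))\<bar> = (cmod (deriv f (vec_to_complex v)))\<^sup>2" for v
  proof -
    have "vec_to_complex (axis 1 1) = 1" "vec_to_complex (axis 2 1) = \<i>" by (simp_all add: vec_to_complex_def axis_def complex_eq_iff)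
    then show ?thesis by (simp add: det_2 matrix_def F'_def cmod_def power2_eq_square)
  qed
  define h where "h = (\<lambda>z. (cmod (deriv f z))\<^sup>2)"
  have hm: "(\<lambda>z. indicator B z *\<^sub>R h z) \<in> borel_measurable borel"
  proof -
    have "continuous_on U h" unfolding h_def
      by (intro continuous_intros holomorphic_on_imp_continuous_on holomorphic_deriv f U)
    then have "(\<lambda>z. indicator U z *\<^sub>R h z) \<in> borel_measurable borel"
      using U by (intro borel_measurable_continuous_on_indicator) auto
    then have "(\<lambda>z. indicator B z *\<^sub>R (indicator U z *\<^sub>R h z)) \<in> borel_measurable borel"
      using B(1) by measurable
    moreover have "indicator B z *\<^sub>R (indicator U z *\<^sub>R h z) = indicator B z *\<^sub>R h z" for z
      using B(2) by (auto simp: indicator_def)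
    ultimately show ?thesis by (simp only:)
  qed
  have hi: "integrable lborel (\<lambda>z. indicator B z *\<^sub>R h z)"
  proof (rule integrableI_bounded_set[where A = B and B = "n\<^sup>2"])
    show "emeasure lborel B < \<infinity>" using emeasure_bounded_finite[OF bdd(1)] .
    show "AE x in lborel. x \<in> B \<longrightarrow> norm (indicator B x *\<^sub>R h x) \<le> n\<^sup>2"
      using bdd(2) by (auto simp: h_def intro!: power_mono)
  qed (use B hm in \<open>auto simp: indicator_def\<close>)
  have ind: "indicator S (complex_to_vec z) = (indicator B z :: real)" for z
    by (auto simp: indicator_def S_def dest: arg_cong[where f = vec_to_complex])
  have Sm: "(\<lambda>v. indicator S v *\<^sub>R h (vec_to_complex v)) \<in> borel_measurable borel"
  proof -
    have "(\<lambda>v. indicator B (vec_to_complex v) *\<^sub>R h (vec_to_complex v)) \<in> borel_measurable borel"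
      using measurable_compose[OF measurable_vec_to_complex hm] .
    moreover have "indicator B (vec_to_complex v) = (indicator S v :: real)" for v using ind[of "vec_to_complex v"] by simp
    ultimately show ?thesis by simp
  qed
  have Si: "set_integrable lborel S (\<lambda>v. h (vec_to_complex v))"
    unfolding set_integrable_def distr_lborel_complex_to_vec[symmetric]
    by (subst integrable_distr_eq) (use hi Sm in \<open>auto simp: ind\<close>)
  have SI: "(LINT v:S|lborel. h (vec_to_complex v)) = (LINT z:B|lborel. h z)"
    unfolding set_lebesgue_integral_def distr_lborel_complex_to_vec[symmetric]
    by (subst integral_distr) (use Sm in \<open>auto simp: ind\<close>)
  have io: "(\<lambda>v. \<bar>det (matrix (F' v))\<bar>) integrable_on S"
    unfolding det using set_borel_integral_eq_integral(1)[OF Si] by (simp add: h_def)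
  have Sl: "S \<in> sets lebesgue" using S by auto
  have m: "F ` S \<in> lmeasurable"
    using measurable_differentiable_image_eq[OF Sl der inj] io by blast
  have "measure lebesgue (F ` S) = integral S (\<lambda>v. \<bar>det (matrix (F' v))\<bar>)"
    by (rule measure_differentiable_image_eq[OF Sl der inj io])
  also have "\<dots> = (LINT z:B|lborel. h z)"
    unfolding det using set_borel_integral_eq_integral(2)[OF Si] SI by (simp add: h_def)
  finally have M: "measure lebesgue (F ` S) = (LINT z:B|lborel. h z)" .
  have "emeasure lborel (f ` B) = emeasure (distr lborel borel complex_to_vec) (F ` S)"
  proof (subst emeasure_distr)
    have "complex_to_vec -` (F ` S) = f ` B" unfolding FS by (auto dest: arg_cong[where f = vec_to_complex])
    then show "emeasure lborel (f ` B) = emeasure lborel (complex_to_vec -` F ` S \<inter> space lborel)" by simp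
  qed (use FS' in auto)
  also have "\<dots> = emeasure lebesgue (F ` S)" unfolding distr_lborel_complex_to_vec using FS' by simp
  also have "\<dots> = ennreal (measure lebesgue (F ` S))"
    using m by (simp add: emeasure_eq_measure2 fmeasurableD2)
  also have "\<dots> = ennreal (LINT z|lborel. indicator B z *\<^sub>R h z)" unfolding M set_lebesgue_integral_def ..
  also have "\<dots> = (\<integral>\<^sup>+z. ennreal (indicator B z *\<^sub>R h z) \<partial>lborel)"
    by (rule nn_integral_eq_integral[OF hi, symmetric]) (auto simp: h_def)
  also have "\<dots> = (\<integral>\<^sup>+z\<in>B. ennreal ((cmod (deriv f z))\<^sup>2) \<partial>lborel)"
    by (intro nn_integral_cong) (auto simp: h_def indicator_def)
  finally show ?thesis .
qed

text \<open>The image is a preimage under the holomorphic inverse.\<close>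

lemma borel_image_holomorphic:
  assumes U: "open U" and f: "f holomorphic_on U" "inj_on f U" and B: "B \<in> sets borel" "B \<subseteq> U"
  shows "f ` B \<in> sets borel"
proof -
  obtain g where g: "g holomorphic_on f ` U" "\<And>z. z \<in> U \<Longrightarrow> g (f z) = z"
    using holomorphic_has_inverse[OF f(1) U f(2)] by metis
  have fU: "open (f ` U)" using open_mapping_thm3[OF f(1) U f(2)] .
  have "g -` B \<inter> f ` U \<in> sets (restrict_space borel (f ` U))"
    using measurable_sets[OF borel_measurable_continuous_on_restrict[OF holomorphic_on_imp_continuous_on[OF g(1)]] B(1)]
    by (simp add: space_restrict_space)
  then have "g -` B \<inter> f ` U \<in> sets borel" using fU by (auto simp: sets_restrict_space_iff)
  also have "g -` B \<inter> f ` U = f ` B" using g(2) B(2) by (auto intro!: image_eqI)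
  finally show ?thesis .
qed

definition jacobian_measure :: "complex set \<Rightarrow> (complex \<Rightarrow> complex) \<Rightarrow> complex measure" where
  "jacobian_measure U f = density lborel (\<lambda>z. indicator U z * ennreal ((cmod (deriv f z))\<^sup>2))"

lemma jacobian_density_measurable:
  assumes U: "open U" and f: "f holomorphic_on U"
  shows "(\<lambda>z. indicator U z * ennreal ((cmod (deriv f z))\<^sup>2)) \<in> borel_measurable borel"
proof -
  have "continuous_on U (\<lambda>z. (cmod (deriv f z))\<^sup>2)"
    by (intro continuous_intros holomorphic_on_imp_continuous_on holomorphic_deriv f U)
  then have "(\<lambda>z. indicator U z *\<^sub>R (cmod (deriv f z))\<^sup>2) \<in> borel_measurable borel"
    using U by (intro borel_measurable_continuous_on_indicator) auto
  then have "(\<lambda>z. ennreal (indicator U z *\<^sub>R (cmod (deriv f z))\<^sup>2)) \<in> borel_measurable borel"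
    by measurable
  moreover have "ennreal (indicator U z *\<^sub>R (cmod (deriv f z))\<^sup>2) = indicator U z * ennreal ((cmod (deriv f z))\<^sup>2)" for z
    by (auto simp: indicator_def)
  ultimately show ?thesis by (simp only:)
qed

lemma emeasure_jacobian_measure:
  assumes U: "open U" and f: "f holomorphic_on U" and B: "B \<in> sets borel" "B \<subseteq> U"
  shows "emeasure (jacobian_measure U f) B = (\<integral>\<^sup>+z\<in>B. ennreal ((cmod (deriv f z))\<^sup>2) \<partial>lborel)"
proof -
  have "emeasure (jacobian_measure U f) B
     = (\<integral>\<^sup>+z. indicator U z * ennreal ((cmod (deriv f z))\<^sup>2) * indicator B z \<partial>lborel)"
    unfolding jacobian_measure_def using jacobian_density_measurable[OF U f] B(1)
    by (subst emeasure_density) auto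
  also have "\<dots> = (\<integral>\<^sup>+z\<in>B. ennreal ((cmod (deriv f z))\<^sup>2) \<partial>lborel)"
    using B(2) by (intro nn_integral_cong) (auto simp: indicator_def)
  finally show ?thesis .
qed

text \<open>The domain is cut into countably many pieces on which both the points and the derivative are bounded.\<close>

lemma emeasure_image_holomorphic:
  assumes U: "open U" and f: "f holomorphic_on U" "inj_on f U" and B: "B \<in> sets borel" "B \<subseteq> U"
  shows "emeasure lborel (f ` B) = (\<integral>\<^sup>+z\<in>B. ennreal ((cmod (deriv f z))\<^sup>2) \<partial>lborel)"
proof -
  define V where "V = (\<lambda>n::nat. {z \<in> U. cmod z + cmod (deriv f z) < real n})"
  have V: "open (V n)" for n
  proof -
    have "continuous_on U (\<lambda>z. cmod z + cmod (deriv f z))"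
      by (intro continuous_intros holomorphic_on_imp_continuous_on holomorphic_deriv f U)
    then have "open (U \<inter> (\<lambda>z. cmod z + cmod (deriv f z)) -` {..<real n})"
      using U by (intro continuous_open_preimage) auto
    also have "U \<inter> (\<lambda>z. cmod z + cmod (deriv f z)) -` {..<real n} = V n" by (auto simp: V_def)
    finally show ?thesis .
  qed
  define D where "D = (\<lambda>n. B \<inter> disjointed V n)"
  have "range V \<subseteq> sets borel" using V by auto
  then have "range (disjointed V) \<subseteq> sets borel" by (rule sets.range_disjointed_sets)
  then have Dm: "D n \<in> sets borel" for n unfolding D_def using B(1) by auto
  have DU: "D n \<subseteq> U" for n using B(2) by (auto simp: D_def)
  have Ddisj: "disjoint_family D"
    using disjoint_family_disjointed[of V] unfolding D_def disjoint_family_on_def by blast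
  have "U = (\<Union>n. V n)" unfolding V_def using reals_Archimedean2 by blast
  then have DB: "B = (\<Union>n. D n)" using B(2) UN_disjointed_eq[of V] unfolding D_def by blast
  have fD: "f ` D n \<in> sets borel" for n by (rule borel_image_holomorphic[OF U f Dm DU])
  have e: "emeasure lborel (f ` D n) = (\<integral>\<^sup>+z\<in>D n. ennreal ((cmod (deriv f z))\<^sup>2) \<partial>lborel)" for n
  proof (rule emeasure_image_holomorphic_bounded[OF U f Dm DU fD])
    have DV: "D n \<subseteq> V n" using disjointed_subset[of V n] by (auto simp: D_def)
    show "bounded (D n)"
    proof (rule boundedI)
      fix z assume "z \<in> D n"
      then have "cmod z + cmod (deriv f z) < real n" using DV by (auto simp: V_def)
      then show "norm z \<le> real n" using norm_ge_zero[of "deriv f z"] by linarith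
    qed
    show "cmod (deriv f z) \<le> real n" if "z \<in> D n" for z
    proof -
      have "cmod z + cmod (deriv f z) < real n" using DV that by (auto simp: V_def)
      then show ?thesis using norm_ge_zero[of z] by linarith
    qed
  qed
  have "disjoint_family (\<lambda>n. f ` D n)"
    unfolding disjoint_family_on_def
  proof (intro ballI impI)
    fix m n :: nat assume mn: "m \<noteq> n"
    have "f ` D m \<inter> f ` D n = f ` (D m \<inter> D n)"
      using inj_on_image_Int[OF f(2) DU DU] by simp
    then show "f ` D m \<inter> f ` D n = {}" using Ddisj mn by (auto simp: disjoint_family_on_def)
  qed
  then have "emeasure lborel (\<Union>n. f ` D n) = suminf (\<lambda>n. emeasure lborel (f ` D n))"
    using fD by (intro suminf_emeasure[symmetric]) auto
  also have "(\<Union>n. f ` D n) = f ` B" unfolding DB by auto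
  also have "suminf (\<lambda>n. emeasure lborel (f ` D n)) = suminf (\<lambda>n. emeasure (jacobian_measure U f) (D n))"
    using e emeasure_jacobian_measure[OF U f(1) Dm DU] by simp
  also have "\<dots> = emeasure (jacobian_measure U f) (\<Union>n. D n)"
    using Dm Ddisj by (intro suminf_emeasure) (auto simp: jacobian_measure_def)
  also have "\<dots> = (\<integral>\<^sup>+z\<in>B. ennreal ((cmod (deriv f z))\<^sup>2) \<partial>lborel)"
    unfolding DB[symmetric] by (rule emeasure_jacobian_measure[OF U f(1) B])
  finally show ?thesis .
qed

text \<open>The image under \<open>f\<close> of the measure with density \<open>\<bar>f'\<bar>\<^sup>2\<close> is Lebesgue measure on the range, because the two agree on
every Borel set.\<close>

theorem nn_integral_image_holomorphic:
  fixes F :: "complex \<Rightarrow> ennreal"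
  assumes U: "open U" and f: "f holomorphic_on U" "inj_on f U" and B: "B \<in> sets borel" "B \<subseteq> U"
    and F: "F \<in> borel_measurable borel"
  shows "(\<integral>\<^sup>+w\<in>f ` B. F w \<partial>lborel) = (\<integral>\<^sup>+z\<in>B. F (f z) * ennreal ((cmod (deriv f z))\<^sup>2) \<partial>lborel)"
proof -
  define f1 where "f1 = (\<lambda>z. if z \<in> U then f z else 0)"
  have f1: "f1 \<in> borel_measurable borel"
    unfolding f1_def using U f(1)
    by (intro borel_measurable_continuous_on_if) (auto intro: holomorphic_on_imp_continuous_on)
  have fU: "open (f ` U)" using open_mapping_thm3[OF f(1) U f(2)] .
  have fB: "f ` B \<in> sets borel" by (rule borel_image_holomorphic[OF U f B])
  have eq: "distr (jacobian_measure U f) borel f1 = density lborel (indicator (f ` U))"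
  proof (rule measure_eqI)
    fix A assume "A \<in> sets (distr (jacobian_measure U f) borel f1)"
    then have A: "A \<in> sets borel" by simp
    have P: "f1 -` A \<in> sets borel" using measurable_sets[OF f1 A] by simp
    define Q where "Q = U \<inter> f1 -` A"
    have Q: "Q \<in> sets borel" "Q \<subseteq> U" using P U by (auto simp: Q_def)
    have "emeasure (distr (jacobian_measure U f) borel f1) A = emeasure (jacobian_measure U f) (f1 -` A)"
      using f1 A by (subst emeasure_distr) (auto simp: jacobian_measure_def)
    also have "\<dots> = (\<integral>\<^sup>+z\<in>Q. ennreal ((cmod (deriv f z))\<^sup>2) \<partial>lborel)"
      using P jacobian_density_measurable[OF U f(1)] unfolding jacobian_measure_def
      by (subst emeasure_density)
         (auto intro!: nn_integral_cong simp: indicator_def Q_def)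
    also have "\<dots> = emeasure lborel (f ` Q)" by (rule emeasure_image_holomorphic[OF U f Q, symmetric])
    also have "f ` Q = f ` U \<inter> A" by (auto simp: Q_def f1_def)
    also have "emeasure lborel (f ` U \<inter> A) = emeasure (density lborel (indicator (f ` U))) A"
      using A fU by (subst emeasure_density) (auto simp: indicator_inter_arith[symmetric])
    finally show "emeasure (distr (jacobian_measure U f) borel f1) A = emeasure (density lborel (indicator (f ` U))) A" .
  qed simp
  have "(\<integral>\<^sup>+w\<in>f ` B. F w \<partial>lborel) = (\<integral>\<^sup>+w. indicator (f ` U) w * (F w * indicator (f ` B) w) \<partial>lborel)"
    using B(2) by (intro nn_integral_cong) (auto simp: indicator_def)
  also have "\<dots> = (\<integral>\<^sup>+w. F w * indicator (f ` B) w \<partial>density lborel (indicator (f ` U)))"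
    using fU fB F by (subst nn_integral_density) auto
  also have "\<dots> = (\<integral>\<^sup>+z. F (f1 z) * indicator (f ` B) (f1 z) \<partial>jacobian_measure U f)"
    unfolding eq[symmetric] using fB F f1 by (subst nn_integral_distr) (auto simp: jacobian_measure_def)
  also have "\<dots> = (\<integral>\<^sup>+z. indicator U z * ennreal ((cmod (deriv f z))\<^sup>2) * (F (f1 z) * indicator (f ` B) (f1 z)) \<partial>lborel)"
    unfolding jacobian_measure_def using jacobian_density_measurable[OF U f(1)] fB F f1
    by (subst nn_integral_density) auto
  also have "\<dots> = (\<integral>\<^sup>+z\<in>B. F (f z) * ennreal ((cmod (deriv f z))\<^sup>2) \<partial>lborel)"
  proof (intro nn_integral_cong)
    fix z
    show "indicator U z * ennreal ((cmod (deriv f z))\<^sup>2) * (F (f1 z) * indicator (f ` B) (f1 z))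
       = F (f z) * ennreal ((cmod (deriv f z))\<^sup>2) * indicator B z"
    proof (cases "z \<in> U")
      case True
      then have "f z \<in> f ` B \<longleftrightarrow> z \<in> B" using f(2) B(2) by (auto dest: inj_onD)
      then show ?thesis using True by (auto simp: f1_def indicator_def mult.commute)
    qed (use B(2) in \<open>auto simp: indicator_def\<close>)
  qed
  finally show ?thesis .
qed

section \<open>The logarithmic derivative of a holomorphic function\<close>

lemma one_minus_cnj_mult_nonzero:
  assumes "cmod a < 1" "cmod z \<le> 1"
  shows "1 - cnj a * z \<noteq> 0"
proof
  assume "1 - cnj a * z = 0"
  then have "cmod (cnj a * z) = 1" by (metis eq_iff_diff_eq_0 norm_one)
  moreover have "cmod (cnj a * z) \<le> cmod a * 1" unfolding norm_mult using assms by (intro mult_mono) auto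
  ultimately show False using assms by simp
qed

lemma blaschke_on_circle:
  assumes "cmod z = 1"
  shows "cmod (1 - cnj a * z) = cmod (z - a)"
proof -
  have "z * cnj z = 1" using complex_norm_square[of z] assms by simp
  then have "1 - cnj a * z = z * cnj (z - a)" by (simp add: algebra_simps)
  then show ?thesis using assms by (metis norm_mult complex_mod_cnj mult_1)
qed

text \<open>From \<open>\<bar>1 - cnj a z\<bar>\<^sup>2 - \<bar>z - a\<bar>\<^sup>2 = (1 - \<bar>a\<bar>\<^sup>2) (1 - \<bar>z\<bar>\<^sup>2)\<close>: away from the unit circle a Blaschke factor is
smaller than 1 by a definite amount.\<close>

lemma blaschke_contracts:
  assumes "cmod a \<le> s" "cmod z \<le> s" "s < 1"
  shows "cmod (z - a) \<le> sqrt (1 - (1 - s\<^sup>2)\<^sup>2 / 4) * cmod (1 - cnj a * z)"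
proof -
  have s0: "0 \<le> s" using assms(1) norm_ge_zero order_trans by blast
  have "complex_of_real ((cmod (1 - cnj a * z))\<^sup>2 - (cmod (z - a))\<^sup>2)
      = complex_of_real ((1 - (cmod a)\<^sup>2) * (1 - (cmod z)\<^sup>2))"
    unfolding of_real_diff of_real_mult complex_norm_square of_real_1 by (simp add: algebra_simps)
  then have e: "(cmod (1 - cnj a * z))\<^sup>2 - (cmod (z - a))\<^sup>2 = (1 - (cmod a)\<^sup>2) * (1 - (cmod z)\<^sup>2)"
    unfolding of_real_eq_iff .
  have s2: "s\<^sup>2 \<le> 1" using s0 assms(3) by (simp add: power_le_one)
  have "(1 - s\<^sup>2) * (1 - s\<^sup>2) \<le> (1 - (cmod a)\<^sup>2) * (1 - (cmod z)\<^sup>2)"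
  proof (intro mult_mono diff_left_mono)
    show "(cmod a)\<^sup>2 \<le> s\<^sup>2" "(cmod z)\<^sup>2 \<le> s\<^sup>2" using assms by (auto intro!: power_mono)
    then show "0 \<le> 1 - (cmod a)\<^sup>2" using s2 by linarith
    show "0 \<le> 1 - s\<^sup>2" using s2 by simp
  qed
  then have 1: "(cmod (z - a))\<^sup>2 \<le> (cmod (1 - cnj a * z))\<^sup>2 - (1 - s\<^sup>2)\<^sup>2"
    using e by (simp add: power2_eq_square)
  have "cmod (1 - cnj a * z) \<le> 1 + cmod a * cmod z"
    using norm_triangle_ineq4[of 1 "cnj a * z"] by (simp add: norm_mult)
  also have "cmod a * cmod z \<le> 1 * 1" using assms by (intro mult_mono) auto
  finally have "(cmod (1 - cnj a * z))\<^sup>2 \<le> 2\<^sup>2" by (intro power_mono) auto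
  then have "(1 - s\<^sup>2)\<^sup>2 / 4 * (cmod (1 - cnj a * z))\<^sup>2 \<le> (1 - s\<^sup>2)\<^sup>2 / 4 * 4"
    by (intro mult_left_mono) auto
  with 1 have "(cmod (z - a))\<^sup>2 \<le> (1 - (1 - s\<^sup>2)\<^sup>2 / 4) * (cmod (1 - cnj a * z))\<^sup>2"
    by (simp add: algebra_simps)
  then have "sqrt ((cmod (z - a))\<^sup>2) \<le> sqrt ((1 - (1 - s\<^sup>2)\<^sup>2 / 4) * (cmod (1 - cnj a * z))\<^sup>2)"
    by (rule real_sqrt_le_mono)
  then show ?thesis by (simp add: real_sqrt_mult)
qed

text \<open>A Blaschke factor has modulus 1 on the unit circle, so dividing by it preserves the maximum there and hence, by the maximum principle, inside.\<close>

lemma divide_by_blaschke: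
  assumes U: "open U" "cball 0 1 \<subseteq> U" and g: "g holomorphic_on U" "g a = 0" and a: "cmod a < 1"
    and K: "\<And>z. cmod z \<le> 1 \<Longrightarrow> cmod (g z) \<le> K"
  obtains h where "h holomorphic_on U" "\<And>z. z \<in> U \<Longrightarrow> g z * (1 - cnj a * z) = (z - a) * h z"
    "\<And>z. cmod z \<le> 1 \<Longrightarrow> cmod (h z) \<le> K"
proof -
  define k where "k = (\<lambda>z. if z = a then deriv g a else (g z - g a) / (z - a))"
  define h where "h = (\<lambda>z. k z * (1 - cnj a * z))"
  have k: "k holomorphic_on U" unfolding k_def by (rule pole_lemma_open[OF g(1) U(1)])
  have h: "h holomorphic_on U" unfolding h_def by (intro holomorphic_intros k)
  have eq: "g z * (1 - cnj a * z) = (z - a) * h z" for z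
    using g(2) by (auto simp: h_def k_def)
  have bd: "cmod (h z) \<le> K" if "cmod z \<le> 1" for z
  proof (rule maximum_modulus_frontier[of h "cball 0 1"])
    show "h holomorphic_on interior (cball 0 1)"
      using h U(2) by (metis holomorphic_on_subset interior_subset order_trans)
    show "continuous_on (closure (cball 0 1)) h"
      using h U(2) by (metis closed_cball closure_closed continuous_on_subset holomorphic_on_imp_continuous_on)
    fix w :: complex assume "w \<in> frontier (cball 0 1)"
    then have w: "cmod w = 1" by (simp add: frontier_cball)
    have nz: "w - a \<noteq> 0" using a w by auto
    have "cmod (g w) * cmod (1 - cnj a * w) = cmod (w - a) * cmod (h w)" by (metis eq norm_mult)
    then have "cmod (h w) = cmod (g w)" using blaschke_on_circle[OF w, of a] nz by simp
    then show "cmod (h w) \<le> K" using K w by simp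
  qed (use that in auto)
  show ?thesis using that[OF h eq bd] by blast
qed

text \<open>Jensen's argument in multiplicative form. Dividing out the Blaschke factor of a zero in the smaller disc keeps the bound \<open>K\<close> and raises the
value at \<open>z1\<close> by the factor \<open>1/\<delta>\<close>; since that value cannot exceed \<open>K\<close>, at most \<open>N\<close> zeros can be removed. Each removal costs
the logarithmic derivative of the Blaschke factor, a simple pole plus a bounded term.\<close>

lemma extract_zeros:
  fixes s \<delta> :: real
  assumes s: "0 < s" "s < 1" and \<delta>: "\<delta> = sqrt (1 - (1 - s\<^sup>2)\<^sup>2 / 4)"
    and U: "open U" "cball 0 1 \<subseteq> U" and z1: "cmod z1 \<le> s"
  shows "g holomorphic_on U \<Longrightarrow> (\<And>z. cmod z \<le> 1 \<Longrightarrow> cmod (g z) \<le> K) \<Longrightarrow> 1 \<le> cmod (g z1) \<Longrightarrow> K * \<delta> ^ N < 1 \<Longrightarrow>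
    \<exists>as h. length as \<le> N \<and> set as \<subseteq> cball 0 s \<and> h holomorphic_on U \<and> (\<forall>z\<in>cball 0 s. h z \<noteq> 0) \<and>
       (\<forall>z. cmod z \<le> 1 \<longrightarrow> cmod (h z) \<le> K) \<and> 1 \<le> cmod (h z1) \<and>
       (\<forall>z\<in>ball 0 1. g z \<noteq> 0 \<longrightarrow> h z \<noteq> 0 \<and>
          cmod (deriv g z / g z - deriv h z / h z) \<le> (\<Sum>a\<leftarrow>as. 1 / cmod (z - a) + 1 / (1 - s)))"
proof (induction N arbitrary: g K)
  case 0
  have "cmod (g z1) \<le> K" using 0(2)[of z1] z1 s by simp
  with 0 show ?case by simp
next
  case (Suc N)
  show ?case
  proof (cases "\<exists>a\<in>cball 0 s. g a = 0")
    case False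
    then show ?thesis using Suc.prems by (intro exI[of _ "[]"] exI[of _ g]) auto
  next
    case True
    then obtain a where a: "cmod a \<le> s" "g a = 0" by auto
    have \<delta>0: "0 < \<delta>" "\<delta> < 1"
    proof -
      have "s\<^sup>2 < 1" using s by (simp add: power_less_one_iff)
      then have "(1 - s\<^sup>2) > 0" "(1 - s\<^sup>2) \<le> 1" by auto
      then have "(1 - s\<^sup>2)\<^sup>2 > 0" "(1 - s\<^sup>2)\<^sup>2 \<le> 1" by (auto simp: power_le_one)
      then show "0 < \<delta>" "\<delta> < 1" unfolding \<delta> by auto
    qed
    obtain h where h: "h holomorphic_on U" "\<And>z. z \<in> U \<Longrightarrow> g z * (1 - cnj a * z) = (z - a) * h z"
        "\<And>z. cmod z \<le> 1 \<Longrightarrow> cmod (h z) \<le> K"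
    proof (rule divide_by_blaschke[OF U Suc.prems(1) a(2), of K])
      show "cmod a < 1" using a s by simp
    qed (use Suc.prems(2) in auto)
    have z1U: "z1 \<in> U" using U z1 s by auto
    have "cmod (g z1) * cmod (1 - cnj a * z1) = cmod (z1 - a) * cmod (h z1)"
      using h(2)[OF z1U] by (metis norm_mult)
    also have "\<dots> \<le> (\<delta> * cmod (1 - cnj a * z1)) * cmod (h z1)"
      using blaschke_contracts[OF a(1) z1 s(2)] unfolding \<delta> by (intro mult_right_mono) auto
    finally have "cmod (g z1) * cmod (1 - cnj a * z1) \<le> \<delta> * cmod (h z1) * cmod (1 - cnj a * z1)"
      by (simp add: ac_simps)
    moreover have "cmod (1 - cnj a * z1) > 0" using one_minus_cnj_mult_nonzero[of a z1] a z1 s by simp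
    ultimately have "cmod (g z1) \<le> \<delta> * cmod (h z1)" by simp
    then have h1: "1 \<le> \<delta> * cmod (h z1)" using Suc.prems(3) by linarith
    \<comment> \<open>Scaling by \<open>\<delta>\<close> keeps the value at \<open>z1\<close> at least 1 and lowers the bound from \<open>K\<close> to \<open>\<delta> K\<close>, which is what the induction consumes.\<close>
    define k where "k = (\<lambda>z. of_real \<delta> * h z)"
    define Q where "Q = (\<lambda>(as :: complex list) h. length as \<le> N \<and> set as \<subseteq> cball 0 s \<and> h holomorphic_on U \<and> (\<forall>z\<in>cball 0 s. h z \<noteq> 0) \<and>
       (\<forall>z. cmod z \<le> 1 \<longrightarrow> cmod (h z) \<le> \<delta> * K) \<and> 1 \<le> cmod (h z1) \<and>
       (\<forall>z\<in>ball 0 1. k z \<noteq> 0 \<longrightarrow> h z \<noteq> 0 \<and>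
          cmod (deriv k z / k z - deriv h z / h z) \<le> (\<Sum>a\<leftarrow>as. 1 / cmod (z - a) + 1 / (1 - s))))"
    have "\<exists>as h. Q as h" unfolding Q_def
    proof (rule Suc.IH)
      show "k holomorphic_on U" unfolding k_def by (intro holomorphic_intros h)
      show "cmod (k z) \<le> \<delta> * K" if "cmod z \<le> 1" for z
        using h(3)[OF that] \<delta>0 by (simp add: k_def norm_mult)
      show "1 \<le> cmod (k z1)" using h1 \<delta>0 by (simp add: k_def norm_mult)
      show "\<delta> * K * \<delta> ^ N < 1" using Suc.prems(4) by (simp add: ac_simps)
    qed
    then obtain as l where Ql: "Q as l" by blast
    note l0 = Ql[unfolded Q_def]
    note l = l0[THEN conjunct1]
      l0[THEN conjunct2, THEN conjunct1]
      l0[THEN conjunct2, THEN conjunct2, THEN conjunct1]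
      l0[THEN conjunct2, THEN conjunct2, THEN conjunct2, THEN conjunct1]
      l0[THEN conjunct2, THEN conjunct2, THEN conjunct2, THEN conjunct2, THEN conjunct1]
      l0[THEN conjunct2, THEN conjunct2, THEN conjunct2, THEN conjunct2, THEN conjunct2, THEN conjunct1]
      and l7 = l0[THEN conjunct2, THEN conjunct2, THEN conjunct2, THEN conjunct2, THEN conjunct2, THEN conjunct2, THEN bspec, THEN mp]
    have K0: "K \<ge> 0" using order_trans[OF norm_ge_zero Suc.prems(2)[of 0]] by simp
    have "cmod (l z) \<le> K" if "cmod z \<le> 1" for z
    proof -
      have "cmod (l z) \<le> \<delta> * K" using l(5) that by blast
      also have "\<dots> \<le> 1 * K" using \<delta>0 K0 by (intro mult_right_mono) auto
      finally show ?thesis by simp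
    qed
    moreover have "l z \<noteq> 0 \<and> cmod (deriv g z / g z - deriv l z / l z) \<le> (\<Sum>a\<leftarrow>a # as. 1 / cmod (z - a) + 1 / (1 - s))"
      if z: "z \<in> ball 0 1" "g z \<noteq> 0" for z
    proof -
      have zU: "z \<in> U" using U z by auto
      have nz: "1 - cnj a * z \<noteq> 0" using one_minus_cnj_mult_nonzero[of a z] a z s by auto
      have za: "z - a \<noteq> 0" using z a by auto
      have hz: "h z \<noteq> 0" using h(2)[OF zU] nz z by auto
      have kz: "k z \<noteq> 0" using hz \<delta>0 by (simp add: k_def)
      have gd: "(g has_field_derivative deriv g z) (at z)" and hd: "(h has_field_derivative deriv h z) (at z)"
        using Suc.prems(1) h(1) U(1) zU holomorphic_derivI by blast+
      have kd: "deriv k z = of_real \<delta> * deriv h z"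
        unfolding k_def by (rule DERIV_imp_deriv) (auto intro!: derivative_eq_intros hd)
      have d1: "((\<lambda>z. g z * (1 - cnj a * z)) has_field_derivative deriv g z * (1 - cnj a * z) - cnj a * g z) (at z)"
        by (auto intro!: derivative_eq_intros gd)
      have d2: "((\<lambda>z. g z * (1 - cnj a * z)) has_field_derivative h z + (z - a) * deriv h z) (at z)"
      proof (rule has_field_derivative_transform_within_open[OF _ U(1) zU])
        show "((\<lambda>z. (z - a) * h z) has_field_derivative h z + (z - a) * deriv h z) (at z)"
          by (auto intro!: derivative_eq_intros hd)
        show "\<And>w. w \<in> U \<Longrightarrow> (w - a) * h w = g w * (1 - cnj a * w)" using h(2) by simp
      qed
      have eq: "deriv g z * (1 - cnj a * z) - cnj a * g z = h z + (z - a) * deriv h z"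
        using DERIV_unique[OF d1 d2] .
      have gz: "g z = (z - a) * h z / (1 - cnj a * z)" using h(2)[OF zU] nz by (simp add: field_simps)
      have gen: "d / v = c / w + x / (w * v)" if "d * w - c * v = x" "w \<noteq> 0" "v \<noteq> 0" for d v c w x :: complex
        using that by (auto simp: field_simps)
      have "deriv g z / g z = cnj a / (1 - cnj a * z) + (h z + (z - a) * deriv h z) / ((1 - cnj a * z) * g z)"
        using eq nz z(2) by (rule gen)
      also have "(1 - cnj a * z) * g z = (z - a) * h z" using gz nz by simp
      also have "(h z + (z - a) * deriv h z) / ((z - a) * h z) = 1 / (z - a) + deriv h z / h z"
        using za hz by (simp add: field_simps)
      also have "deriv h z / h z = deriv k z / k z" using \<delta>0 unfolding kd by (simp add: k_def)
      finally have E: "deriv g z / g z - deriv l z / l z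
          = (1 / (z - a) + cnj a / (1 - cnj a * z)) + (deriv k z / k z - deriv l z / l z)" by simp
      have "cmod (cnj a * z) \<le> s * 1" unfolding norm_mult using a z s by (intro mult_mono) auto
      then have "cmod (1 - cnj a * z) \<ge> 1 - s" using norm_triangle_ineq2[of 1 "cnj a * z"] by simp
      then have "cmod (cnj a / (1 - cnj a * z)) \<le> 1 / (1 - s)"
        unfolding norm_divide using a s by (intro frac_le) auto
      then have "cmod (1 / (z - a) + cnj a / (1 - cnj a * z)) \<le> 1 / cmod (z - a) + 1 / (1 - s)"
        using norm_triangle_ineq[of "1 / (z - a)" "cnj a / (1 - cnj a * z)"] by (simp add: norm_divide)
      moreover have "cmod (deriv k z / k z - deriv l z / l z) \<le> (\<Sum>a\<leftarrow>as. 1 / cmod (z - a) + 1 / (1 - s))"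
        using l7[OF z(1) kz] by blast
      ultimately show ?thesis
        unfolding E using l7[OF z(1) kz] norm_triangle_ineq[of "1 / (z - a) + cnj a / (1 - cnj a * z)" "deriv k z / k z - deriv l z / l z"]
        by simp
    qed
    ultimately show ?thesis
      using l(1,2,3,4,6) a by (intro exI[of _ "a # as"] exI[of _ l] conjI) auto
  qed
qed

text \<open>The Schwarz lemma for maps into the right half-plane, after composing with the Cayley transform that sends \<open>F w\<close> to 0.\<close>

lemma deriv_bound_right_half_plane:
  assumes F: "F holomorphic_on ball w d" "\<And>z. z \<in> ball w d \<Longrightarrow> Re (F z) > 0" and d: "d > 0"
  shows "cmod (deriv F w) \<le> 2 * Re (F w) / d"
proof -
  define f where "f = (\<lambda>\<zeta>. (F (w + of_real d * \<zeta>) - F w) / (F (w + of_real d * \<zeta>) + cnj (F w)))"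
  have in_ball: "w + of_real d * \<zeta> \<in> ball w d" if "cmod \<zeta> < 1" for \<zeta>
    using that d by (simp add: dist_norm norm_mult)
  have pos: "Re (F (w + of_real d * \<zeta>)) > 0" if "cmod \<zeta> < 1" for \<zeta> using F(2) in_ball that by blast
  have w: "Re (F w) > 0" using F(2) d by simp
  have den: "F (w + of_real d * \<zeta>) + cnj (F w) \<noteq> 0" if "cmod \<zeta> < 1" for \<zeta>
  proof
    assume "F (w + of_real d * \<zeta>) + cnj (F w) = 0"
    then have "Re (F (w + of_real d * \<zeta>) + cnj (F w)) = 0" by simp
    then show False using pos[OF that] w by simp
  qed
  have hF: "(\<lambda>\<zeta>. F (w + of_real d * \<zeta>)) holomorphic_on ball 0 1"
    using holomorphic_on_compose_gen[of "\<lambda>\<zeta>. w + of_real d * \<zeta>" "ball 0 1" F "ball w d"] F(1) in_ball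
    by (force simp: o_def intro!: holomorphic_intros)
  have f: "f holomorphic_on ball 0 1" unfolding f_def using den by (intro holomorphic_intros hF) auto
  have f0: "f 0 = 0" by (simp add: f_def)
  have f1: "cmod (f \<zeta>) < 1" if z: "cmod \<zeta> < 1" for \<zeta>
  proof -
    define A where "A = F (w + of_real d * \<zeta>)"
    have "complex_of_real ((cmod (A + cnj (F w)))\<^sup>2 - (cmod (A - F w))\<^sup>2) = (A + cnj A) * (F w + cnj (F w))"
      unfolding of_real_diff complex_norm_square by (simp add: algebra_simps)
    also have "\<dots> = complex_of_real (4 * Re A * Re (F w))" by (simp add: complex_add_cnj)
    finally have "(cmod (A + cnj (F w)))\<^sup>2 - (cmod (A - F w))\<^sup>2 = 4 * Re A * Re (F w)"
      unfolding of_real_eq_iff .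
    moreover have "4 * Re A * Re (F w) > 0" using pos[OF z] w by (simp add: A_def)
    ultimately have "(cmod (A - F w))\<^sup>2 < (cmod (A + cnj (F w)))\<^sup>2" by simp
    then have "cmod (A - F w) < cmod (A + cnj (F w))" by (rule power2_less_imp_less) simp
    moreover have "A + cnj (F w) \<noteq> 0" using den[OF z] by (simp add: A_def)
    ultimately show ?thesis by (simp add: f_def A_def[symmetric] norm_divide)
  qed
  have "cmod (deriv f 0) \<le> 1" by (rule Schwarz_Lemma(2)[OF f f0 f1, of 0]) auto
  moreover have "deriv f 0 = of_real d * deriv F w / of_real (2 * Re (F w))"
  proof (rule DERIV_imp_deriv)
    have "(F has_field_derivative deriv F w) (at (w + of_real d * 0))"
      using holomorphic_derivI[OF F(1)] d by simp
    then have "((\<lambda>\<zeta>. F (w + of_real d * \<zeta>)) has_field_derivative deriv F w * of_real d) (at 0)"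
      by (rule DERIV_chain2) (auto intro!: derivative_eq_intros)
    moreover have c: "F w + cnj (F w) = of_real (2 * Re (F w))" by (simp add: complex_add_cnj)
    ultimately show "(f has_field_derivative of_real d * deriv F w / of_real (2 * Re (F w))) (at 0)"
      unfolding f_def using w by (auto intro!: derivative_eq_intros simp: c power2_eq_square)
  qed
  ultimately show ?thesis using d w by (simp add: norm_divide norm_mult field_simps)
qed

text \<open>A branch of \<open>- ln h\<close>, shifted by \<open>1 + ln K\<close>, maps into the right half-plane. The Schwarz lemma bounds its derivative by its real part, so the
logarithm of the real part is Lipschitz; at \<open>z1\<close> that real part is at most \<open>1 + ln K\<close>, hence (Harnack) comparable to this on the whole smaller disc.\<close>

lemma zero_free_log_deriv_bound:
  fixes s s' :: real
  assumes s: "0 < s" "s < s'" "s' < 1"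
    and U: "open U" "cball 0 1 \<subseteq> U" and h: "h holomorphic_on U" "\<And>z. z \<in> cball 0 s' \<Longrightarrow> h z \<noteq> 0"
    "\<And>z. cmod z \<le> 1 \<Longrightarrow> cmod (h z) \<le> K" and z1: "cmod z1 \<le> s" "1 \<le> cmod (h z1)" and z: "cmod z \<le> s"
  shows "cmod (deriv h z / h z) \<le> 2 / (s' - s) * exp (4 / (s' - s)) * (1 + ln K)"
proof -
  have sub: "ball 0 s' \<subseteq> U" using U(2) s by auto
  have hb: "h holomorphic_on ball 0 s'" using h(1) sub holomorphic_on_subset by blast
  obtain G where G: "G holomorphic_on ball 0 s'" "\<And>z. z \<in> ball 0 s' \<Longrightarrow> h z = exp (G z)"
    using contractible_imp_holomorphic_log[OF hb] h(2) convex_imp_contractible[OF convex_ball, of "0 :: complex" s'] by auto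
  \<comment> \<open>The summand 1 keeps the real part away from 0, so that its logarithm is defined.\<close>
  define F where "F = (\<lambda>z. of_real (1 + ln K) - G z)"
  have F: "F holomorphic_on ball 0 s'" unfolding F_def by (intro holomorphic_intros G)
  have K: "K \<ge> 1" using h(3)[of z1] z1 s by simp
  have ReF: "Re (F z) \<ge> 1" if "z \<in> ball 0 s'" for z
  proof -
    have "exp (Re (G z)) = cmod (h z)" using G(2)[OF that] by simp
    also have "\<dots> \<le> K" using h(3) that s by auto
    finally have "Re (G z) \<le> ln K" using K by (simp add: ln_ge_iff)
    then show ?thesis by (simp add: F_def)
  qed
  define c where "c = 2 / (s' - s)"
  have c: "c > 0" using s by (simp add: c_def)
  have dF: "cmod (deriv F w) \<le> c * Re (F w)" if "cmod w \<le> s" for w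
  proof -
    have sb: "ball w (s' - s) \<subseteq> ball 0 s'" 
    proof
      fix v assume "v \<in> ball w (s' - s)"
      then have "cmod (v - w) < s' - s" by (simp add: dist_norm norm_minus_commute)
      then show "v \<in> ball 0 s'" using norm_triangle_ineq[of w "v - w"] that by simp
    qed
    have "cmod (deriv F w) \<le> 2 * Re (F w) / (s' - s)"
    proof (rule deriv_bound_right_half_plane)
      show "F holomorphic_on ball w (s' - s)" using F sb holomorphic_on_subset by blast
      show "Re (F z) > 0" if "z \<in> ball w (s' - s)" for z using ReF[of z] that sb by force
    qed (use s in auto)
    then show ?thesis by (simp add: c_def)
  qed
  define p where "p = (\<lambda>t. z1 + t *\<^sub>R (z - z1))"
  have p: "cmod (p t) \<le> s" if "0 \<le> t" "t \<le> 1" for t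
  proof -
    have "p t = (1 - t) *\<^sub>R z1 + t *\<^sub>R z" by (simp add: p_def algebra_simps)
    then have "cmod (p t) \<le> (1 - t) * cmod z1 + t * cmod z"
      using norm_triangle_ineq[of "(1 - t) *\<^sub>R z1" "t *\<^sub>R z"] that by simp
    also have "\<dots> \<le> (1 - t) * s + t * s" using that z z1 by (intro add_mono mult_left_mono) auto
    finally show ?thesis by (simp add: algebra_simps)
  qed
  have pb: "p t \<in> ball 0 s'" if "0 \<le> t" "t \<le> 1" for t using p[OF that] s by simp
  define \<phi> where "\<phi> = (\<lambda>t. ln (Re (F (p t))))"
  have d\<phi>: "(\<phi> has_real_derivative Re (deriv F (p t) * (z - z1)) / Re (F (p t))) (at t)" if "0 \<le> t" "t \<le> 1" for t
  proof -
    have "(F has_field_derivative deriv F (p t)) (at (p t))"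
      using holomorphic_derivI[OF F _ pb[OF that]] by simp
    moreover have "(p has_vector_derivative (z - z1)) (at t)"
      unfolding p_def by (auto intro!: derivative_eq_intros)
    ultimately have "((F \<circ> p) has_vector_derivative (z - z1) * deriv F (p t)) (at t)"
      using field_vector_diff_chain_at by blast
    then have "((\<lambda>t. Re (F (p t))) has_vector_derivative Re ((z - z1) * deriv F (p t))) (at t)"
      using bounded_linear.has_vector_derivative[OF bounded_linear_Re] by (fastforce simp: o_def)
    then have "((\<lambda>t. Re (F (p t))) has_real_derivative Re (deriv F (p t) * (z - z1))) (at t)"
      by (simp add: has_real_derivative_iff_has_vector_derivative mult.commute)
    moreover have "Re (F (p t)) > 0" using ReF[OF pb[OF that]] by simp
    ultimately have "((\<lambda>t. ln (Re (F (p t)))) has_real_derivative 1 / Re (F (p t)) * Re (deriv F (p t) * (z - z1))) (at t)"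
      by (intro DERIV_chain2[OF DERIV_ln_divide])
    then show ?thesis unfolding \<phi>_def by simp
  qed
  obtain t where t: "0 < t" "t < 1" "\<phi> 1 - \<phi> 0 = (1 - 0) * (Re (deriv F (p t) * (z - z1)) / Re (F (p t)))"
    using MVT2[of 0 1 \<phi> "\<lambda>t. Re (deriv F (p t) * (z - z1)) / Re (F (p t))"] d\<phi> by auto
  have Rt: "Re (F (p t)) > 0" using ReF[OF pb[of t]] t by auto
  have "Re (deriv F (p t) * (z - z1)) \<le> cmod (deriv F (p t)) * cmod (z - z1)"
    by (metis complex_Re_le_cmod norm_mult)
  also have "\<dots> \<le> (c * Re (F (p t))) * 2"
  proof (intro mult_mono)
    show "cmod (z - z1) \<le> 2" using norm_triangle_ineq4[of z z1] z z1 s by linarith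
  qed (use dF p t Rt c in auto)
  finally have "Re (deriv F (p t) * (z - z1)) / Re (F (p t)) \<le> 2 * c" using Rt by (simp add: field_simps)
  then have "\<phi> 1 \<le> \<phi> 0 + 2 * c" using t(3) by simp
  then have "exp (\<phi> 1) \<le> exp (\<phi> 0) * exp (2 * c)" by (simp flip: exp_add)
  then have Rz: "Re (F z) \<le> Re (F z1) * exp (2 * c)"
    using ReF[OF pb[of 0]] ReF[OF pb[of 1]] by (simp add: \<phi>_def p_def)
  have zb: "z \<in> ball 0 s'" "z1 \<in> ball 0 s'" using z z1 s by auto
  have "0 \<le> Re (G z1)"
  proof -
    have "exp (Re (G z1)) = cmod (h z1)" using G(2)[OF zb(2)] by simp
    then show ?thesis using z1(2) by (metis exp_le_cancel_iff exp_zero)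
  qed
  then have "Re (F z1) \<le> 1 + ln K" by (simp add: F_def)
  then have "Re (F z) \<le> (1 + ln K) * exp (2 * c)" using Rz
    by (meson exp_ge_zero mult_right_mono order_trans)
  then have "cmod (deriv F z) \<le> c * ((1 + ln K) * exp (2 * c))"
    using dF[OF z] c by (meson less_imp_le mult_left_mono order_trans)
  moreover have "deriv h z / h z = - deriv F z"
  proof -
    have Gd: "(G has_field_derivative deriv G z) (at z)" using holomorphic_derivI[OF G(1) _ zb(1)] by simp
    have "(h has_field_derivative exp (G z) * deriv G z) (at z)"
    proof (rule has_field_derivative_transform_within_open[of "\<lambda>z. exp (G z)" _ _ "ball 0 s'"])
      show "((\<lambda>z. exp (G z)) has_field_derivative exp (G z) * deriv G z) (at z)"
        by (auto intro!: derivative_eq_intros Gd)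
    qed (use zb G(2) in auto)
    then have "deriv h z = h z * deriv G z" using G(2)[OF zb(1)] by (simp add: DERIV_imp_deriv)
    moreover have "deriv F z = - deriv G z"
      unfolding F_def by (rule DERIV_imp_deriv) (auto intro!: derivative_eq_intros Gd)
    ultimately show ?thesis using G(2)[OF zb(1)] by simp
  qed
  ultimately show ?thesis by (simp add: c_def mult.assoc mult.commute mult.left_commute)
qed


text \<open>Split off the zeros, of which there are \<open>O(1 + ln K)\<close>, and apply the zero-free estimate to what remains.\<close>

lemma log_deriv_bound_unit:
  fixes s :: real
  assumes s: "0 < s" "s < 1"
  obtains C where "C > 0" "\<And>U g K z1. \<lbrakk>open U; cball 0 1 \<subseteq> U; g holomorphic_on U; \<And>z. cmod z \<le> 1 \<Longrightarrow> cmod (g z) \<le> K;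
      cmod z1 \<le> s; 1 \<le> cmod (g z1)\<rbrakk> \<Longrightarrow> \<exists>as. real (length as) \<le> C * (1 + ln K) \<and>
        (\<forall>z. cmod z \<le> s \<longrightarrow> g z \<noteq> 0 \<longrightarrow>
           cmod (deriv g z / g z) \<le> (\<Sum>a\<leftarrow>as. 1 / cmod (z - a)) + C * (1 + ln K))"
proof -
  define s' where "s' = (1 + s) / 2"
  have s': "0 < s'" "s < s'" "s' < 1" using s by (auto simp: s'_def)
  define \<delta> where "\<delta> = sqrt (1 - (1 - s'\<^sup>2)\<^sup>2 / 4)"
  have \<delta>: "0 < \<delta>" "\<delta> < 1"
  proof -
    have "s'\<^sup>2 < 1" using s' by (simp add: power_less_one_iff)
    then have "(1 - s'\<^sup>2) > 0" "(1 - s'\<^sup>2) \<le> 1" by auto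
    then have "(1 - s'\<^sup>2)\<^sup>2 > 0" "(1 - s'\<^sup>2)\<^sup>2 \<le> 1" by (auto simp: power_le_one)
    then show "0 < \<delta>" "\<delta> < 1" unfolding \<delta>_def by auto
  qed
  define D where "D = 1 / ln (1 / \<delta>)"
  have D: "D > 0" using \<delta> by (simp add: D_def)
  define C2 where "C2 = 2 / (s' - s) * exp (4 / (s' - s))"
  have C2: "C2 > 0" using s' by (simp add: C2_def)
  define C where "C = (D + 1) + (D + 1) / (1 - s') + C2"
  have q: "(D + 1) / (1 - s') > 0" using D s' by simp
  have C: "C > 0" "D + 1 \<le> C" "(D + 1) / (1 - s') + C2 \<le> C" using q D C2 by (simp_all add: C_def)
  show ?thesis
  proof (rule that[OF C(1)])
    fix U g K z1
    assume U: "open U" "cball 0 1 \<subseteq> U" and g: "g holomorphic_on U" "\<And>z. cmod z \<le> 1 \<Longrightarrow> cmod (g z) \<le> K"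
      and z1: "cmod z1 \<le> s" "1 \<le> cmod (g z1)"
    have K: "K \<ge> 1" using g(2)[of z1] z1 s by simp
    define L where "L = ln K"
    have L: "L \<ge> 0" using K by (simp add: L_def)
    \<comment> \<open>With \<open>D = 1 / ln (1/\<delta>)\<close>, this is a number of zeros for which \<open>K \<delta>\<^sup>N < 1\<close>.\<close>
    define N where "N = nat \<lfloor>L * D\<rfloor> + 1"
    have N: "real N \<le> L * D + 1" "L * D < real N"
    proof -
      have "0 \<le> L * D" using L D by simp
      then show "real N \<le> L * D + 1" by (simp add: N_def)
      show "L * D < real N" unfolding N_def by linarith
    qed
    have "L < real N / D" using N(2) D by (simp add: field_simps)
    then have "L < real N * ln (1 / \<delta>)" by (simp add: D_def)
    then have "L + real N * ln \<delta> < 0" using \<delta> by (simp add: ln_div)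
    moreover have "ln (K * \<delta> ^ N) = L + real N * ln \<delta>" using K \<delta> by (simp add: ln_mult ln_realpow L_def)
    moreover have "0 < K * \<delta> ^ N" using K \<delta> by simp
    ultimately have "K * \<delta> ^ N < 1" using ln_less_zero_iff[of "K * \<delta> ^ N"] by linarith
    moreover have "cmod z1 \<le> s'" using z1 s' by simp
    ultimately have "\<exists>as h. length as \<le> N \<and> set as \<subseteq> cball 0 s' \<and> h holomorphic_on U \<and> (\<forall>z\<in>cball 0 s'. h z \<noteq> 0) \<and>
       (\<forall>z. cmod z \<le> 1 \<longrightarrow> cmod (h z) \<le> K) \<and> 1 \<le> cmod (h z1) \<and>
       (\<forall>z\<in>ball 0 1. g z \<noteq> 0 \<longrightarrow> h z \<noteq> 0 \<and>
          cmod (deriv g z / g z - deriv h z / h z) \<le> (\<Sum>a\<leftarrow>as. 1 / cmod (z - a) + 1 / (1 - s')))"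
      using extract_zeros[OF s'(1,3) \<delta>_def U _ g z1(2), of N] by blast
    then obtain as h where h: "length as \<le> N" "h holomorphic_on U" "\<And>z. z \<in> cball 0 s' \<Longrightarrow> h z \<noteq> 0"
      "\<And>z. cmod z \<le> 1 \<Longrightarrow> cmod (h z) \<le> K" "1 \<le> cmod (h z1)"
      and ld: "\<And>z. z \<in> ball 0 1 \<Longrightarrow> g z \<noteq> 0 \<Longrightarrow>
          cmod (deriv g z / g z - deriv h z / h z) \<le> (\<Sum>a\<leftarrow>as. 1 / cmod (z - a) + 1 / (1 - s'))" by metis
    have len: "real (length as) \<le> (D + 1) * (1 + L)"
    proof -
      have "real (length as) \<le> L * D + 1" using h(1) N(1) by linarith
      also have "\<dots> \<le> (D + 1) * (1 + L)" using L D by (simp add: algebra_simps)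
      finally show ?thesis .
    qed
    have "cmod (deriv g z / g z) \<le> (\<Sum>a\<leftarrow>as. 1 / cmod (z - a)) + C * (1 + L)"
      if z: "cmod z \<le> s" "g z \<noteq> 0" for z
    proof -
      have "cmod (deriv h z / h z) \<le> C2 * (1 + L)"
        unfolding C2_def L_def using zero_free_log_deriv_bound[OF s(1) s'(2,3) U h(2,3,4) z1(1) h(5) z(1)] .
      moreover have "cmod (deriv g z / g z - deriv h z / h z) \<le> (\<Sum>a\<leftarrow>as. 1 / cmod (z - a)) + real (length as) * (1 / (1 - s'))"
        using ld[of z] z s by (simp add: sum_list_addf sum_list_triv)
      moreover have "real (length as) * (1 / (1 - s')) \<le> (D + 1) * (1 + L) * (1 / (1 - s'))"
        using len s' by (intro mult_right_mono) auto
      moreover have "(D + 1) * (1 + L) * (1 / (1 - s')) + C2 * (1 + L) = ((D + 1) / (1 - s') + C2) * (1 + L)"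
        by (simp add: distrib_right[of "(D + 1) / (1 - s')" C2 "1 + L"])
      moreover have "((D + 1) / (1 - s') + C2) * (1 + L) \<le> C * (1 + L)" using C L by (intro mult_right_mono) auto
      moreover have "cmod (deriv g z / g z) \<le> cmod (deriv g z / g z - deriv h z / h z) + cmod (deriv h z / h z)"
        by (metis diff_add_cancel norm_triangle_ineq)
      ultimately show ?thesis by linarith
    qed
    moreover have "(D + 1) * (1 + L) \<le> C * (1 + L)" using C L by (intro mult_right_mono) auto
    ultimately show "\<exists>as. real (length as) \<le> C * (1 + ln K) \<and>
        (\<forall>z. cmod z \<le> s \<longrightarrow> g z \<noteq> 0 \<longrightarrow>
           cmod (deriv g z / g z) \<le> (\<Sum>a\<leftarrow>as. 1 / cmod (z - a)) + C * (1 + ln K))"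
      using len unfolding L_def[symmetric] by (intro exI[of _ as]) auto
  qed
qed

text \<open>The growth \<open>ln K\<close> of a function controls its logarithmic derivative up to few simple poles; the constant depends on the two radii only.\<close>

lemma log_deriv_bound:
  fixes s R :: real
  assumes s: "0 < s" "s < R"
  obtains C where "C > 0" "\<And>U g K z1. \<lbrakk>open U; cball 0 R \<subseteq> U; g holomorphic_on U; \<And>z. cmod z \<le> R \<Longrightarrow> cmod (g z) \<le> K;
      cmod z1 \<le> s; 1 \<le> cmod (g z1)\<rbrakk> \<Longrightarrow> \<exists>as. real (length as) \<le> C * (1 + ln K) \<and>
        (\<forall>z. cmod z \<le> s \<longrightarrow> g z \<noteq> 0 \<longrightarrow>
           cmod (deriv g z / g z) \<le> (\<Sum>a\<leftarrow>as. 1 / cmod (z - a)) + C * (1 + ln K))"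
proof -
  have R: "R > 0" using s by simp
  have sR: "0 < s / R" "s / R < 1" using s by auto
  obtain C where C: "C > 0" "\<And>U g K z1. \<lbrakk>open U; cball 0 1 \<subseteq> U; g holomorphic_on U; \<And>z. cmod z \<le> 1 \<Longrightarrow> cmod (g z) \<le> K;
      cmod z1 \<le> s / R; 1 \<le> cmod (g z1)\<rbrakk> \<Longrightarrow> \<exists>as. real (length as) \<le> C * (1 + ln K) \<and>
        (\<forall>z. cmod z \<le> s / R \<longrightarrow> g z \<noteq> 0 \<longrightarrow>
           cmod (deriv g z / g z) \<le> (\<Sum>a\<leftarrow>as. 1 / cmod (z - a)) + C * (1 + ln K))"
    by (rule log_deriv_bound_unit[OF sR]) blast
  define C' where "C' = max C (C / R)"
  show ?thesis
  proof (rule that[of C'])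
    show "C' > 0" using C(1) by (simp add: C'_def)
    fix U g K z1
    assume U: "open U" "cball 0 R \<subseteq> U" and g: "g holomorphic_on U" "\<And>z. cmod z \<le> R \<Longrightarrow> cmod (g z) \<le> K"
      and z1: "cmod z1 \<le> s" "1 \<le> cmod (g z1)"
    define r where "r = complex_of_real R"
    have r: "r \<noteq> 0" "cmod r = R" using R by (auto simp: r_def)
    define V where "V = (\<lambda>z. r * z) -` U"
    define k where "k = (\<lambda>z. g (r * z))"
    have V: "open V" unfolding V_def by (intro open_vimage U) (auto intro!: continuous_intros)
    have k: "k holomorphic_on V" unfolding k_def V_def
      using holomorphic_on_compose_gen[of "\<lambda>z. r * z" "(\<lambda>z. r * z) -` U" g U] g(1)
      by (force simp: o_def intro!: holomorphic_intros)
    have "cball 0 1 \<subseteq> V"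
    proof
      fix z :: complex assume "z \<in> cball 0 1"
      then have "cmod (r * z) \<le> R * 1" unfolding norm_mult using r R by (intro mult_mono) auto
      then show "z \<in> V" using U(2) by (auto simp: V_def)
    qed
    moreover have "cmod (k z) \<le> K" if "cmod z \<le> 1" for z
      unfolding k_def using that R r by (intro g(2)) (simp add: norm_mult)
    moreover have "cmod (z1 / r) \<le> s / R" using z1 R r by (simp add: norm_divide divide_right_mono)
    moreover have "1 \<le> cmod (k (z1 / r))" using z1 r by (simp add: k_def)
    ultimately obtain as where as: "real (length as) \<le> C * (1 + ln K)"
        "\<And>z. cmod z \<le> s / R \<Longrightarrow> k z \<noteq> 0 \<Longrightarrow>
           cmod (deriv k z / k z) \<le> (\<Sum>a\<leftarrow>as. 1 / cmod (z - a)) + C * (1 + ln K)"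
      using C(2)[OF V _ k, of K "z1 / r"] by blast
    have K: "K \<ge> 1" using g(2)[of z1] z1 s by simp
    have KC: "x * (1 + ln K) \<le> C' * (1 + ln K)" if "x = C \<or> x = C / R" for x
      using K that by (intro mult_right_mono) (auto simp: C'_def)
    have "cmod (deriv g z / g z) \<le> (\<Sum>a\<leftarrow>map (\<lambda>a. r * a) as. 1 / cmod (z - a)) + C' * (1 + ln K)"
      if z: "cmod z \<le> s" "g z \<noteq> 0" for z
    proof -
      have zU: "z \<in> U" using U(2) z s by auto
      have gd: "(g has_field_derivative deriv g z) (at (r * (z / r)))"
        using holomorphic_derivI[OF g(1) U(1) zU] r by simp
      have "(k has_field_derivative deriv g z * r) (at (z / r))"
        unfolding k_def by (rule DERIV_chain2[where f = g and g = "\<lambda>z. r * z", OF gd])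
          (auto intro!: derivative_eq_intros)
      then have kd: "deriv k (z / r) = deriv g z * r" by (rule DERIV_imp_deriv)
      have kz: "k (z / r) = g z" using r by (simp add: k_def)
      have "cmod (z / r) \<le> s / R" using z R r by (simp add: norm_divide divide_right_mono)
      then have "cmod (deriv g z * r / g z) \<le> (\<Sum>a\<leftarrow>as. 1 / cmod (z / r - a)) + C * (1 + ln K)"
        using as(2)[of "z / r"] z unfolding kd kz by blast
      then have "cmod (deriv g z / g z) * R \<le> (\<Sum>a\<leftarrow>as. 1 / cmod (z / r - a)) + C * (1 + ln K)"
        using r by (simp add: norm_mult norm_divide)
      moreover have eq: "1 / cmod (z / r - a) = R * (1 / cmod (z - r * a))" for a
      proof -
        have "z / r - a = (z - r * a) / r" using r by (simp add: field_simps)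
        then show ?thesis using r by (simp add: norm_divide)
      qed
      ultimately have "cmod (deriv g z / g z) * R \<le> R * (\<Sum>a\<leftarrow>as. 1 / cmod (z - r * a)) + C * (1 + ln K)"
        unfolding eq sum_list_const_mult by blast
      then have "cmod (deriv g z / g z) \<le> (\<Sum>a\<leftarrow>as. 1 / cmod (z - r * a)) + C / R * (1 + ln K)"
        using R by (simp add: field_simps)
      also have "C / R * (1 + ln K) \<le> C' * (1 + ln K)" using KC by blast
      finally show ?thesis by (simp add: o_def)
    qed
    then show "\<exists>as. real (length as) \<le> C' * (1 + ln K) \<and>
        (\<forall>z. cmod z \<le> s \<longrightarrow> g z \<noteq> 0 \<longrightarrow>
           cmod (deriv g z / g z) \<le> (\<Sum>a\<leftarrow>as. 1 / cmod (z - a)) + C' * (1 + ln K))"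
      using as(1) KC[of C] by (intro exI[of _ "map (\<lambda>a. r * a) as"]) auto
  qed
qed

text \<open>Dyadic annuli: \<open>1 / \<bar>z - a\<bar>\<close> is at most \<open>2\<^sup>k\<^sup>+\<^sup>1\<close> where \<open>\<bar>z - a\<bar>\<close> lies between \<open>2\<^sup>-\<^sup>k\<^sup>-\<^sup>1\<close> and \<open>2\<^sup>-\<^sup>k\<close>, on a set of area at
most \<open>\<pi> 4\<^sup>-\<^sup>k\<close>; farther than 1 from \<open>a\<close> the integrand is at most 1.\<close>

lemma nn_integral_inverse_dist:
  assumes "r > 0"
  shows "(\<integral>\<^sup>+z\<in>ball c r. ennreal (1 / cmod (z - a)) \<partial>lborel) \<le> ennreal (pi * (r\<^sup>2 + 4))"
proof -
  define f where "f = (\<lambda>(k::nat) z. ennreal (2 ^ (k + 1)) * indicator (cball a ((1/2) ^ k)) z)"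
  have fm: "f k \<in> borel_measurable lborel" for k unfolding f_def by (intro borel_measurable_times_ennreal borel_measurable_const borel_measurable_indicator) auto
  have pt: "ennreal (1 / cmod (z - a)) * indicator (ball c r) z \<le> indicator (ball c r) z + suminf (\<lambda>k. f k z)" for z
  proof (cases "z = a \<or> cmod (z - a) > 1")
    case True
    then have "1 / cmod (z - a) \<le> 1" by (auto simp: divide_le_eq_1)
    then have "ennreal (1 / cmod (z - a)) * indicator (ball c r) z \<le> indicator (ball c r) z"
      by (auto simp: indicator_def ennreal_le_1)
    then show ?thesis by (simp add: add_increasing2)
  next
    case False
    define x where "x = cmod (z - a)"
    have x: "0 < x" "x \<le> 1" using False by (auto simp: x_def)
    have "\<exists>n. (1 / 2 :: real) ^ n < x" using x real_arch_pow_inv[of x "1/2"] by auto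
    then obtain n where n: "(1/2) ^ n < x" "\<And>m. m < n \<Longrightarrow> \<not> (1/2) ^ m < x"
      using exists_least_iff[of "\<lambda>n. (1 / 2 :: real) ^ n < x"] by auto
    have "n \<noteq> 0" using n(1) x by (cases n) auto
    then obtain k where k: "n = Suc k" by (cases n) auto
    have "x \<le> (1/2) ^ k" using n(2)[of k] k by simp
    then have "z \<in> cball a ((1/2) ^ k)" by (simp add: x_def dist_norm norm_minus_commute)
    then have "f k z = ennreal (2 ^ (k + 1))" by (simp add: f_def)
    moreover have "1 / x \<le> 2 ^ (k + 1)" using n(1) x k by (simp add: power_one_over field_simps)
    ultimately have "ennreal (1 / x) \<le> f k z" by (simp add: ennreal_leI)
    also have "\<dots> = (\<Sum>k\<in>{k}. f k z)" by simp
    also have "\<dots> \<le> suminf (\<lambda>k. f k z)" by (rule sum_le_suminf) auto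
    finally have "ennreal (1 / cmod (z - a)) * indicator (ball c r) z \<le> suminf (\<lambda>k. f k z)"
      unfolding x_def by (auto simp: indicator_def)
    then show ?thesis by (simp add: add_increasing)
  qed
  have "(\<integral>\<^sup>+z\<in>ball c r. ennreal (1 / cmod (z - a)) \<partial>lborel)
      \<le> (\<integral>\<^sup>+z. indicator (ball c r) z + suminf (\<lambda>k. f k z) \<partial>lborel)"
    by (intro nn_integral_mono pt)
  also have "\<dots> = emeasure lborel (ball c r) + (\<integral>\<^sup>+z. suminf (\<lambda>k. f k z) \<partial>lborel)"
    by (subst nn_integral_add) (use fm in \<open>auto intro!: borel_measurable_suminf borel_measurable_indicator borel_open\<close>)
  also have "(\<integral>\<^sup>+z. suminf (\<lambda>k. f k z) \<partial>lborel) = suminf (\<lambda>k. \<integral>\<^sup>+z. f k z \<partial>lborel)"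
    by (intro nn_integral_suminf fm)
  also have "\<dots> = suminf (\<lambda>k. ennreal (2 * pi * (1/2) ^ k))"
  proof (intro arg_cong[where f = suminf] ext)
    fix k :: nat
    have "(\<integral>\<^sup>+z. f k z \<partial>lborel) = ennreal (2 ^ (k + 1)) * ennreal (pi * ((1/2) ^ k)\<^sup>2)"
      unfolding f_def by (subst nn_integral_cmult) (auto simp: emeasure_cball unit_ball_vol_2 intro!: borel_measurable_indicator borel_closed)
    also have "\<dots> = ennreal (2 ^ (k + 1) * (pi * ((1/2) ^ k)\<^sup>2))" by (simp flip: ennreal_mult)
    also have "2 ^ (k + 1) * (pi * ((1/2) ^ k)\<^sup>2) = 2 * pi * (1/2) ^ k"
      by (simp add: power2_eq_square field_simps)
    finally show "(\<integral>\<^sup>+z. f k z \<partial>lborel) = ennreal (2 * pi * (1/2) ^ k)" .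
  qed
  also have "\<dots> = ennreal (suminf (\<lambda>k::nat. 2 * pi * (1/2) ^ k))"
    by (rule suminf_ennreal2) (auto intro!: summable_mult summable_geometric)
  also have "suminf (\<lambda>k::nat. 2 * pi * (1/2) ^ k) = 4 * pi"
    by (subst suminf_mult) (auto simp: suminf_geometric summable_geometric)
  also have "emeasure lborel (ball c r) = ennreal (pi * r\<^sup>2)"
    using assms by (simp add: emeasure_ball unit_ball_vol_2)
  also have "ennreal (pi * r\<^sup>2) + ennreal (4 * pi) = ennreal (pi * (r\<^sup>2 + 4))"
    by (subst ennreal_plus[symmetric]) (auto simp: algebra_simps)
  finally show ?thesis .
qed

section \<open>Growth of a solution controls the potential\<close>

lemma nn_integral_rotate_ball:
  assumes e: "cmod e = 1" and F: "F \<in> borel_measurable borel"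
  shows "(\<integral>\<^sup>+w\<in>ball 0 d. F (z + e * w) \<partial>lborel) = (\<integral>\<^sup>+w\<in>ball z d. F w \<partial>lborel)"
proof -
  have e0: "e \<noteq> 0" using e by auto
  have im: "(\<lambda>w. z + e * w) ` ball 0 d = ball z d"
  proof (intro equalityI subsetI)
    fix v assume v: "v \<in> ball z d"
    then have "(v - z) / e \<in> ball 0 d" using e by (simp add: norm_divide dist_norm norm_minus_commute)
    moreover have "v = z + e * ((v - z) / e)" using e0 by simp
    ultimately show "v \<in> (\<lambda>w. z + e * w) ` ball 0 d" by blast
  qed (use e in \<open>auto simp: dist_norm norm_mult\<close>)
  have d: "deriv (\<lambda>w. z + e * w) w = e" for w
    by (rule DERIV_imp_deriv) (auto intro!: derivative_eq_intros)
  have "(\<integral>\<^sup>+w\<in>(\<lambda>w. z + e * w) ` ball 0 d. F w \<partial>lborel)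
      = (\<integral>\<^sup>+w\<in>ball 0 d. F (z + e * w) * ennreal ((cmod (deriv (\<lambda>w. z + e * w) w))\<^sup>2) \<partial>lborel)"
    by (rule nn_integral_image_holomorphic[where U = UNIV])
       (use F e0 in \<open>auto intro!: holomorphic_intros inj_onI\<close>)
  then show ?thesis unfolding im d e by simp
qed

lemma norm_le_circle_mean:
  assumes U: "open U" "cball 0 1 \<subseteq> U" and k: "k holomorphic_on U"
  shows "ennreal (cmod (k 0)) \<le> (\<integral>\<^sup>+t\<in>{0..1}. ennreal (cmod (k (exp (of_real (2 * pi * t) * \<i>)))) \<partial>lborel)"
proof -
  define f where "f = (\<lambda>t. k (exp (of_real (2 * pi * t) * \<i>)))"
  have hk: "k holomorphic_on ball 0 1" "continuous_on (cball 0 1) k"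
    using k U(2) ball_subset_cball holomorphic_on_subset holomorphic_on_imp_continuous_on
      continuous_on_subset by (meson order_trans)+
  have ci: "((\<lambda>u. k u / (u - 0)) has_contour_integral (2 * of_real pi * \<i> * k 0)) (circlepath 0 1)"
    by (rule Cauchy_integral_circlepath[OF hk(2,1)]) simp
  have "((\<lambda>t. 2 * of_real pi * \<i> * f t) has_integral 2 * of_real pi * \<i> * k 0) {0..1}"
  proof (rule has_integral_eq[OF _ ci[unfolded has_contour_integral_def]])
    fix t :: real assume t: "t \<in> {0..1}"
    show "k (circlepath 0 1 t) / (circlepath 0 1 t - 0) * vector_derivative (circlepath 0 1) (at t within {0..1})
       = 2 * of_real pi * \<i> * f t"
    proof -
      have c: "circlepath 0 1 t = exp (of_real (2 * pi * t) * \<i>)" by (simp add: circlepath mult_ac)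
      have "vector_derivative (circlepath 0 1) (at t within {0..1}) = 2 * of_real pi * \<i> * exp (of_real (2 * pi * t) * \<i>)"
        using t by (subst vector_derivative_circlepath01) (auto simp: mult_ac)
      then show ?thesis unfolding f_def c by simp
    qed
  qed
  from has_integral_mult_right[OF this, of "1 / (2 * of_real pi * \<i>)"]
  have fi: "(f has_integral k 0) {0..1}" by (simp add: field_simps)
  have cf: "continuous_on {0..1} f" unfolding f_def
    by (intro continuous_on_compose2[OF hk(2)] continuous_intros) auto
  have si: "set_integrable lborel {0..1} f" by (rule borel_integrable_atLeastAtMost'[OF cf])
  have "k 0 = (LINT t:{0..1}|lborel. f t)"
    using set_borel_integral_eq_integral(2)[OF si] fi by (simp add: integral_unique)
  also have "ennreal (cmod \<dots>) \<le> (\<integral>\<^sup>+t. ennreal (cmod (indicator {0..1} t *\<^sub>R f t)) \<partial>lborel)"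
    unfolding set_lebesgue_integral_def
    by (rule integral_norm_bound_ennreal) (use si in \<open>simp add: set_integrable_def\<close>)
  also have "\<dots> = (\<integral>\<^sup>+t\<in>{0..1}. ennreal (cmod (f t)) \<partial>lborel)"
    by (intro nn_integral_cong) (auto simp: indicator_def)
  finally show ?thesis by (simp add: f_def)
qed

text \<open>The integral over the disc is invariant under rotations about \<open>z\<close>. Averaging over all of them and exchanging the integrals replaces the integrand at
\<open>w\<close> by its mean over the circle through \<open>w\<close>, which is at least \<open>\<bar>q z\<bar>\<close>.\<close>

lemma area_mean_value:
  assumes U: "open U" "cball z d \<subseteq> U" and q: "q holomorphic_on U" and d: "d > 0"
  shows "ennreal (pi * d\<^sup>2 * cmod (q z)) \<le> (\<integral>\<^sup>+w\<in>ball z d. ennreal (cmod (q w)) \<partial>lborel)"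
proof -
  define e where "e = (\<lambda>t. exp (of_real (2 * pi * t) * \<i>))"
  have e: "cmod (e t) = 1" for t by (simp add: e_def)
  define Q where "Q = (\<lambda>w. ennreal (cmod (if w \<in> U then q w else 0)))"
  have Q: "Q \<in> borel_measurable borel"
  proof -
    have "(\<lambda>w. if w \<in> U then q w else 0) \<in> borel_measurable borel"
      using U(1) q by (intro borel_measurable_continuous_on_if) (auto intro: holomorphic_on_imp_continuous_on)
    then show ?thesis unfolding Q_def by measurable
  qed
  have e_m: "e \<in> borel_measurable borel"
    unfolding e_def by (intro borel_measurable_continuous_onI continuous_intros)
  define I where "I = (\<integral>\<^sup>+w\<in>ball z d. Q w \<partial>lborel)"
  define G where "G = (\<lambda>(t, w). indicator {0..1::real} t * (indicator (ball 0 d) w * Q (z + e t * w)))"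
  have G: "G \<in> borel_measurable (lborel \<Otimes>\<^sub>M lborel)"
  proof -
    have "(\<lambda>x. z + e (fst x) * snd x) \<in> borel_measurable (lborel \<Otimes>\<^sub>M lborel)"
      using e_m by measurable
    then have "(\<lambda>x. Q (z + e (fst x) * snd x)) \<in> borel_measurable (lborel \<Otimes>\<^sub>M lborel)"
      using Q by (rule measurable_compose)
    moreover have "(\<lambda>x. indicator (ball 0 d) (snd x) :: ennreal) \<in> borel_measurable (lborel \<Otimes>\<^sub>M (lborel :: complex measure))"
      "(\<lambda>x. indicator {0..1} (fst x) :: ennreal) \<in> borel_measurable ((lborel :: real measure) \<Otimes>\<^sub>M (lborel :: complex measure))"
      by (intro measurable_compose[OF measurable_snd] measurable_compose[OF measurable_fst] borel_measurable_indicator; simp)+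
    ultimately show ?thesis unfolding G_def case_prod_beta by (intro borel_measurable_times_ennreal)
  qed
  have "(\<integral>\<^sup>+w. (\<integral>\<^sup>+t. G (t, w) \<partial>lborel) \<partial>lborel) = (\<integral>\<^sup>+t. (\<integral>\<^sup>+w. G (t, w) \<partial>lborel) \<partial>lborel)"
    using lborel_pair.Fubini'[of "\<lambda>t w. G (t, w)"] G by simp
  also have "\<dots> = (\<integral>\<^sup>+t. indicator {0..1::real} t * I \<partial>lborel)"
  proof (intro nn_integral_cong)
    fix t :: real
    have "(\<lambda>w. Q (z + e t * w)) \<in> borel_measurable lborel" using Q by measurable
    then have "(\<integral>\<^sup>+w. G (t, w) \<partial>lborel) = indicator {0..1} t * (\<integral>\<^sup>+w. indicator (ball 0 d) w * Q (z + e t * w) \<partial>lborel)"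
      unfolding G_def prod.case
      by (subst nn_integral_cmult) (auto intro!: borel_measurable_times_ennreal borel_measurable_indicator)
    also have "(\<integral>\<^sup>+w. indicator (ball 0 d) w * Q (z + e t * w) \<partial>lborel) = I"
      using nn_integral_rotate_ball[OF e[of t] Q, of z d] unfolding I_def by (simp add: mult.commute)
    finally show "(\<integral>\<^sup>+w. G (t, w) \<partial>lborel) = indicator {0..1} t * I" .
  qed
  also have "\<dots> = I" by (subst nn_integral_multc) auto
  finally have F: "(\<integral>\<^sup>+w. (\<integral>\<^sup>+t. G (t, w) \<partial>lborel) \<partial>lborel) = I" .
  have pt: "ennreal (cmod (q z)) * indicator (ball 0 d) w \<le> (\<integral>\<^sup>+t. G (t, w) \<partial>lborel)" for w
  proof (cases "w \<in> ball 0 d")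
    case True
    define k where "k = (\<lambda>v. q (z + v * w))"
    define V where "V = (\<lambda>v. z + v * w) -` U"
    have V: "open V" unfolding V_def by (intro open_vimage U continuous_intros)
    have "z + v * w \<in> cball z d" if "cmod v \<le> 1" for v
    proof -
      have "cmod (v * w) \<le> 1 * d" unfolding norm_mult using that True by (intro mult_mono) auto
      then show ?thesis by (simp add: dist_norm)
    qed
    then have zU: "z + v * w \<in> U" if "cmod v \<le> 1" for v using U(2) that by blast
    have V1: "cball 0 1 \<subseteq> V" using zU by (auto simp: V_def)
    have k: "k holomorphic_on V" unfolding k_def V_def
      using holomorphic_on_compose_gen[of "\<lambda>v. z + v * w" "(\<lambda>v. z + v * w) -` U" q U] q
      by (force simp: o_def intro!: holomorphic_intros)
    have "ennreal (cmod (q z)) = ennreal (cmod (k 0))" by (simp add: k_def)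
    also have "\<dots> \<le> (\<integral>\<^sup>+t\<in>{0..1}. ennreal (cmod (k (e t))) \<partial>lborel)"
      unfolding e_def by (rule norm_le_circle_mean[OF V V1 k])
    also have "\<dots> = (\<integral>\<^sup>+t. G (t, w) \<partial>lborel)"
      using True zU[of "e _"] e by (intro nn_integral_cong) (auto simp: G_def k_def Q_def mult.commute)
    finally show ?thesis using True by simp
  qed auto
  have "ennreal (pi * d\<^sup>2 * cmod (q z)) = ennreal (cmod (q z)) * emeasure lborel (ball (0::complex) d)"
    using d by (simp add: emeasure_ball unit_ball_vol_2 ennreal_mult[symmetric] mult.commute)
  also have "\<dots> = (\<integral>\<^sup>+(w::complex). ennreal (cmod (q z)) * indicator (ball 0 d) w \<partial>lborel)"
    by (subst nn_integral_cmult) (auto intro!: borel_measurable_indicator)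
  also have "\<dots> \<le> (\<integral>\<^sup>+w. (\<integral>\<^sup>+t. G (t, w) \<partial>lborel) \<partial>lborel)" by (intro nn_integral_mono pt)
  also have "\<dots> = I" by (rule F)
  also have "\<dots> = (\<integral>\<^sup>+w\<in>ball z d. ennreal (cmod (q w)) \<partial>lborel)"
  proof -
    have "ball z d \<subseteq> U" using U(2) ball_subset_cball by blast
    then show ?thesis unfolding I_def by (intro nn_integral_cong) (auto simp: Q_def indicator_def)
  qed
  finally show ?thesis .
qed

text \<open>A mean value inequality with exponent 1/2. Let \<open>a\<close> maximize \<open>(R - \<bar>z\<bar>)\<^sup>4 \<bar>q z\<bar>\<close>. On the disc about \<open>a\<close> of half its distance to the
boundary \<open>\<bar>q\<bar> \<le> 16 \<bar>q a\<bar>\<close>, so there \<open>\<bar>q\<bar> \<le> 4 \<surd>\<bar>q a\<bar> \<surd>\<bar>q\<bar>\<close>; the mean value inequality for \<open>q\<close> then bounds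
\<open>\<surd>\<bar>q a\<bar>\<close> by the integral of \<open>\<surd>\<bar>q\<bar>\<close>. What this bounds is \<open>\<bar>q a\<bar>\<close> times the fourth power of the distance, whence the
exponent of the weight.\<close>

lemma sup_le_sqrt_mean:
  assumes U: "open U" "cball 0 R \<subseteq> U" and q: "q holomorphic_on U" and R: "s < R" "0 \<le> s" and I: "I \<ge> 0"
    and int: "(\<integral>\<^sup>+w\<in>ball 0 R. ennreal (sqrt (cmod (q w))) \<partial>lborel) \<le> ennreal I" and z: "cmod z \<le> s"
  shows "cmod (q z) \<le> 256 * I\<^sup>2 / (pi\<^sup>2 * (R - s) ^ 4)"
proof -
  have R0: "R > 0" using R by simp
  define \<Phi> where "\<Phi> = (\<lambda>z. (R - cmod z) ^ 4 * cmod (q z))"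
  have qc: "continuous_on (cball 0 R) q"
    using q U(2) continuous_on_subset holomorphic_on_imp_continuous_on by blast
  have "continuous_on (cball 0 R) \<Phi>" unfolding \<Phi>_def by (intro continuous_intros qc)
  then obtain a where a: "a \<in> cball 0 R" "\<And>w. w \<in> cball 0 R \<Longrightarrow> \<Phi> w \<le> \<Phi> a"
    using continuous_attains_sup[of "cball 0 R" \<Phi>] R0 by (metis compact_cball centre_in_cball empty_iff less_imp_le)
  have "\<Phi> a \<le> 256 * I\<^sup>2 / pi\<^sup>2"
  proof (cases "cmod a = R \<or> q a = 0")
    case True
    then have "\<Phi> a = 0" by (auto simp: \<Phi>_def)
    then show ?thesis by simp
  next
    case False
    then have aR: "cmod a < R" and qa: "cmod (q a) > 0" using a(1) by auto
    define d where "d = (R - cmod a) / 2"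
    have d: "d > 0" using aR by (simp add: d_def)
    have far: "d \<le> R - cmod w" if "w \<in> cball a d" for w
    proof -
      have "cmod w \<le> cmod a + cmod (w - a)" by (metis add.commute diff_add_cancel norm_triangle_ineq)
      moreover have "cmod (w - a) \<le> d" using that by (simp add: dist_norm norm_minus_commute)
      ultimately show ?thesis by (simp add: d_def)
    qed
    have sub: "cball a d \<subseteq> cball 0 R" using far d by fastforce
    have sub': "ball a d \<subseteq> ball 0 R"
    proof
      fix w assume "w \<in> ball a d"
      then have "d \<le> R - cmod w" using far[of w] by auto
      then show "w \<in> ball 0 R" using d by simp
    qed
    have le: "cmod (q w) \<le> 16 * cmod (q a)" if w: "w \<in> cball a d" for w
    proof -
      have "d ^ 4 * cmod (q w) \<le> \<Phi> w" unfolding \<Phi>_def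
        using far[OF w] d by (intro mult_right_mono power_mono) auto
      also have "\<dots> \<le> \<Phi> a" using a(2) sub w by blast
      also have "\<dots> = d ^ 4 * (16 * cmod (q a))" by (simp add: \<Phi>_def d_def power_divide)
      finally show ?thesis using d by simp
    qed
    have "ennreal (pi * d\<^sup>2 * cmod (q a)) \<le> (\<integral>\<^sup>+w\<in>ball a d. ennreal (cmod (q w)) \<partial>lborel)"
      by (rule area_mean_value[OF U(1) _ q d]) (use sub U(2) in blast)
    also have "\<dots> \<le> (\<integral>\<^sup>+w. ennreal (4 * sqrt (cmod (q a))) * (ennreal (sqrt (cmod (q w))) * indicator (ball 0 R) w) \<partial>lborel)"
    proof (intro nn_integral_mono)
      fix w
      show "ennreal (cmod (q w)) * indicator (ball a d) w
         \<le> ennreal (4 * sqrt (cmod (q a))) * (ennreal (sqrt (cmod (q w))) * indicator (ball 0 R) w)"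
      proof (cases "w \<in> ball a d")
        case True
        have "sqrt (cmod (q w)) \<le> sqrt (16 * cmod (q a))" using le[of w] True by (intro real_sqrt_le_mono) auto
        then have "sqrt (cmod (q w)) \<le> 4 * sqrt (cmod (q a))" by (simp add: real_sqrt_mult)
        then have "sqrt (cmod (q w)) * sqrt (cmod (q w)) \<le> 4 * sqrt (cmod (q a)) * sqrt (cmod (q w))"
          by (intro mult_right_mono) auto
        then have "ennreal (cmod (q w)) \<le> ennreal (4 * sqrt (cmod (q a))) * ennreal (sqrt (cmod (q w)))"
          by (simp add: ennreal_mult[symmetric] ennreal_leI)
        then show ?thesis using True sub' by auto
      qed auto
    qed
    also have "\<dots> = ennreal (4 * sqrt (cmod (q a))) * (\<integral>\<^sup>+w\<in>ball 0 R. ennreal (sqrt (cmod (q w))) \<partial>lborel)"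
    proof (rule nn_integral_cmult)
      have "continuous_on (ball 0 R) (\<lambda>w. sqrt (cmod (q w)))"
        using continuous_on_subset[OF qc ball_subset_cball] by (intro continuous_intros)
      then have "(\<lambda>w. indicator (ball 0 R) w *\<^sub>R sqrt (cmod (q w))) \<in> borel_measurable borel"
        by (intro borel_measurable_continuous_on_indicator) auto
      then have "(\<lambda>w. ennreal (indicator (ball 0 R) w *\<^sub>R sqrt (cmod (q w)))) \<in> borel_measurable borel"
        by measurable
      moreover have "ennreal (indicator (ball 0 R) w *\<^sub>R sqrt (cmod (q w))) = ennreal (sqrt (cmod (q w))) * indicator (ball 0 R) w" for w
        by (auto simp: indicator_def)
      ultimately have "(\<lambda>w. ennreal (sqrt (cmod (q w))) * indicator (ball 0 R) w) \<in> borel_measurable borel" by (simp only:)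
      then show "(\<lambda>w. ennreal (sqrt (cmod (q w))) * indicator (ball 0 R) w) \<in> borel_measurable lborel" by simp
    qed
    also have "\<dots> \<le> ennreal (4 * sqrt (cmod (q a))) * ennreal I" by (intro mult_left_mono int) auto
    also have "\<dots> = ennreal (4 * sqrt (cmod (q a)) * I)" using I by (simp add: ennreal_mult[symmetric])
    finally have "pi * d\<^sup>2 * cmod (q a) \<le> 4 * sqrt (cmod (q a)) * I"
      using I by (subst (asm) ennreal_le_iff) auto
    moreover have "sqrt (cmod (q a)) * (pi * d\<^sup>2 * sqrt (cmod (q a))) = pi * d\<^sup>2 * cmod (q a)"
    proof -
      have "sqrt (cmod (q a)) * (pi * d\<^sup>2 * sqrt (cmod (q a))) = pi * d\<^sup>2 * (sqrt (cmod (q a)) * sqrt (cmod (q a)))"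
        by (simp only: mult_ac)
      then show ?thesis by simp
    qed
    ultimately have "sqrt (cmod (q a)) * (pi * d\<^sup>2 * sqrt (cmod (q a))) \<le> sqrt (cmod (q a)) * (4 * I)"
      by (simp only: mult_ac)
    then have "pi * d\<^sup>2 * sqrt (cmod (q a)) \<le> 4 * I" using qa by (simp only: mult_le_cancel_left_pos real_sqrt_gt_zero)
    then have "(pi * d\<^sup>2 * sqrt (cmod (q a)))\<^sup>2 \<le> (4 * I)\<^sup>2" using d by (intro power_mono) auto
    then have "pi\<^sup>2 * (d ^ 4 * cmod (q a)) \<le> 16 * I\<^sup>2"
      by (simp add: power_mult_distrib flip: power_mult)
    moreover have "\<Phi> a = 16 * (d ^ 4 * cmod (q a))" by (simp add: \<Phi>_def d_def power_divide)
    ultimately show ?thesis by (simp add: field_simps)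
  qed
  moreover have "(R - s) ^ 4 * cmod (q z) \<le> \<Phi> z" unfolding \<Phi>_def
    using z R by (intro mult_right_mono power_mono) auto
  moreover have "\<Phi> z \<le> \<Phi> a" using a(2) z R by simp
  ultimately have "(R - s) ^ 4 * cmod (q z) \<le> 256 * I\<^sup>2 / pi\<^sup>2" by linarith
  then show ?thesis using R by (simp add: field_simps)
qed


lemma nn_integral_list_inverse_dist:
  assumes "r > 0"
  shows "(\<integral>\<^sup>+z\<in>ball c r. ennreal (\<Sum>a\<leftarrow>as. 1 / cmod (z - a)) \<partial>lborel) \<le> ennreal (real (length as) * (pi * (r\<^sup>2 + 4)))"
proof (induction as)
  case (Cons a as)
  have m: "(\<lambda>z. ennreal (1 / cmod (z - b)) * indicator (ball c r) z) \<in> borel_measurable lborel" for b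
    by (intro borel_measurable_times_ennreal borel_measurable_indicator) auto
  have m2: "(\<lambda>z. ennreal (\<Sum>a\<leftarrow>bs. 1 / cmod (z - a)) * indicator (ball c r) z) \<in> borel_measurable lborel" for bs
  proof (intro borel_measurable_times_ennreal borel_measurable_indicator)
    have "(\<lambda>z. \<Sum>a\<leftarrow>bs. 1 / cmod (z - a)) \<in> borel_measurable borel"
      by (induction bs) auto
    then show "(\<lambda>z. ennreal (\<Sum>a\<leftarrow>bs. 1 / cmod (z - a))) \<in> borel_measurable lborel" by measurable
  qed auto
  have nn: "0 \<le> (\<Sum>a\<leftarrow>bs. 1 / cmod (z - a))" for bs z by (intro sum_list_nonneg) auto
  have "(\<integral>\<^sup>+z\<in>ball c r. ennreal (\<Sum>a\<leftarrow>a # as. 1 / cmod (z - a)) \<partial>lborel)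
     = (\<integral>\<^sup>+z. ennreal (1 / cmod (z - a)) * indicator (ball c r) z + ennreal (\<Sum>a\<leftarrow>as. 1 / cmod (z - a)) * indicator (ball c r) z \<partial>lborel)"
    using nn by (intro nn_integral_cong) (simp add: ennreal_plus[symmetric] distrib_right[symmetric] del: ennreal_plus)
  also have "\<dots> = (\<integral>\<^sup>+z\<in>ball c r. ennreal (1 / cmod (z - a)) \<partial>lborel) + (\<integral>\<^sup>+z\<in>ball c r. ennreal (\<Sum>a\<leftarrow>as. 1 / cmod (z - a)) \<partial>lborel)"
    by (rule nn_integral_add[OF m m2])
  also have "\<dots> \<le> ennreal (pi * (r\<^sup>2 + 4)) + ennreal (real (length as) * (pi * (r\<^sup>2 + 4)))"
    by (intro add_mono Cons.IH nn_integral_inverse_dist assms)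
  also have "\<dots> = ennreal (pi * (r\<^sup>2 + 4) + real (length as) * (pi * (r\<^sup>2 + 4)))"
    by (rule ennreal_plus[symmetric]) auto
  also have "pi * (r\<^sup>2 + 4) + real (length as) * (pi * (r\<^sup>2 + 4)) = real (length (a # as)) * (pi * (r\<^sup>2 + 4))"
    by (simp add: algebra_simps)
  finally show ?case .
qed simp

lemma deriv_le_sup:
  assumes U: "open U" and g: "g holomorphic_on U" and d: "d > 0" "cball z d \<subseteq> U"
    and K: "\<And>w. w \<in> cball z d \<Longrightarrow> cmod (g w) \<le> K"
  shows "cmod (deriv g z) \<le> K / d"
proof -
  have "cmod ((deriv ^^ 1) g z) \<le> fact 1 * K / d ^ 1"
  proof (rule Cauchy_inequality)
    show "g holomorphic_on ball z d" using g d(2) ball_subset_cball holomorphic_on_subset by (meson order_trans)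
    show "continuous_on (cball z d) g" using g d(2) holomorphic_on_imp_continuous_on continuous_on_subset by blast
    show "cmod (g x) \<le> K" if "cmod (z - x) = d" for x using that by (intro K) (simp add: dist_norm)
  qed (rule d)
  then show ?thesis by simp
qed

lemma cball_shift_subset:
  fixes z :: complex
  assumes "cmod z \<le> s" "s + d \<le> R"
  shows "cball z d \<subseteq> cball 0 R"
proof
  fix w assume "w \<in> cball z d"
  then have "cmod (w - z) \<le> d" by (simp add: dist_norm norm_minus_commute)
  then show "w \<in> cball 0 R" using norm_triangle_ineq[of z "w - z"] assms by simp
qed

text \<open>A converse to Gronwall's inequality. Dividing the equation by \<open>2 Y\<^sup>2\<close> gives \<open>q = (Y'/Y)\<^sup>2 / 2 - (Y''/Y') (Y'/Y)\<close>, so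
\<open>\<surd>\<bar>q\<bar> \<le> 2 \<bar>Y'/Y\<bar> + \<bar>Y''/Y'\<bar>\<close>, and both logarithmic derivatives have integral \<open>O(1 + ln K)\<close>. From the integral of \<open>\<surd>\<bar>q\<bar>\<close> one
passes to the supremum of \<open>\<bar>q\<bar>\<close>. The bound for \<open>Y''/Y'\<close> needs \<open>Y'\<close> to be at least \<open>\<eta>\<close> somewhere; otherwise \<open>Y\<close> is nearly
constant and the equation bounds \<open>q\<close> directly.\<close>

theorem potential_le_growth:
  fixes s R :: real
  assumes s: "0 < s" "s < R"
  obtains C where "C > 0" "\<And>U Y q K z1. \<lbrakk>open U; cball 0 R \<subseteq> U; Y holomorphic_on U; q holomorphic_on U;
      \<And>z. z \<in> U \<Longrightarrow> (deriv Y z)\<^sup>2 - 2 * Y z * deriv (deriv Y) z = 2 * q z * (Y z)\<^sup>2;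
      \<And>z. cmod z \<le> R \<Longrightarrow> cmod (Y z) \<le> K; cmod z1 \<le> s; 1 \<le> cmod (Y z1)\<rbrakk> \<Longrightarrow>
      \<forall>z. cmod z \<le> s \<longrightarrow> cmod (q z) \<le> C * (1 + ln K)\<^sup>2"
proof -
  define \<delta> where "\<delta> = (R - s) / 3"
  define s1 where "s1 = s + \<delta>"
  define s2 where "s2 = s + 2 * \<delta>"
  have \<delta>: "\<delta> > 0" "s + \<delta> = s1" "s1 + \<delta> = s2" "s2 + \<delta> = R" using s by (auto simp: \<delta>_def s1_def s2_def field_simps)
  have s1: "0 < s1" "s < s1" "s1 < s2" "s2 < R" "s1 < R" using s \<delta> by auto
  \<comment> \<open>A derivative of modulus at most \<open>\<eta>\<close> changes \<open>Y\<close> by at most 1/2 across the disc of radius \<open>s1\<close>.\<close>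
  define \<eta> where "\<eta> = 1 / (4 * s1)"
  have \<eta>: "\<eta> > 0" using s1 by (simp add: \<eta>_def)
  obtain Ca where Ca: "Ca > 0" "\<And>U g K z1. \<lbrakk>open U; cball 0 R \<subseteq> U; g holomorphic_on U; \<And>z. cmod z \<le> R \<Longrightarrow> cmod (g z) \<le> K;
      cmod z1 \<le> s1; 1 \<le> cmod (g z1)\<rbrakk> \<Longrightarrow> \<exists>as. real (length as) \<le> Ca * (1 + ln K) \<and>
        (\<forall>z. cmod z \<le> s1 \<longrightarrow> g z \<noteq> 0 \<longrightarrow>
           cmod (deriv g z / g z) \<le> (\<Sum>a\<leftarrow>as. 1 / cmod (z - a)) + Ca * (1 + ln K))"
    by (rule log_deriv_bound[OF s1(1,5)]) blast
  obtain Cb where Cb: "Cb > 0" "\<And>U g K z1. \<lbrakk>open U; cball 0 s2 \<subseteq> U; g holomorphic_on U; \<And>z. cmod z \<le> s2 \<Longrightarrow> cmod (g z) \<le> K;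
      cmod z1 \<le> s1; 1 \<le> cmod (g z1)\<rbrakk> \<Longrightarrow> \<exists>as. real (length as) \<le> Cb * (1 + ln K) \<and>
        (\<forall>z. cmod z \<le> s1 \<longrightarrow> g z \<noteq> 0 \<longrightarrow>
           cmod (deriv g z / g z) \<le> (\<Sum>a\<leftarrow>as. 1 / cmod (z - a)) + Cb * (1 + ln K))"
    by (rule log_deriv_bound[OF s1(1,3)]) blast
  define m where "m = 1 + \<bar>ln (\<delta> * \<eta>)\<bar>"
  define D where "D = 2 * Ca + Cb * m"
  have D: "D > 0" using Ca(1) Cb(1) by (auto simp: D_def m_def intro!: add_pos_pos)
  define E where "E = D * (pi * (s1\<^sup>2 + 4)) + D * (pi * s1\<^sup>2)"
  define C1 where "C1 = 2 * \<eta>\<^sup>2 + 2 * \<eta> / \<delta>"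
  define C2 where "C2 = 256 * E\<^sup>2 / (pi\<^sup>2 * (s1 - s) ^ 4)"
  show ?thesis
  proof (rule that[of "C1 + C2"])
    have "C1 > 0" using \<eta> \<delta> by (auto simp: C1_def intro!: add_pos_pos)
    moreover have C20: "C2 \<ge> 0" using s1 by (simp add: C2_def)
    ultimately show "C1 + C2 > 0" by simp
    fix U Y q K z1
    assume U: "open U" "cball 0 R \<subseteq> U" and Y: "Y holomorphic_on U" and q: "q holomorphic_on U"
      and ode: "\<And>z. z \<in> U \<Longrightarrow> (deriv Y z)\<^sup>2 - 2 * Y z * deriv (deriv Y) z = 2 * q z * (Y z)\<^sup>2"
      and K: "\<And>z. cmod z \<le> R \<Longrightarrow> cmod (Y z) \<le> K" and z1: "cmod z1 \<le> s" "1 \<le> cmod (Y z1)"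
    have K1: "K \<ge> 1" using K[of z1] z1 s by simp
    have L: "1 + ln K \<ge> 1" using K1 by simp
    have dY: "deriv Y holomorphic_on U" using Y U by (intro holomorphic_deriv)
    have inU: "z \<in> U" if "cmod z \<le> R" for z using U(2) that by auto
    show "\<forall>z. cmod z \<le> s \<longrightarrow> cmod (q z) \<le> (C1 + C2) * (1 + ln K)\<^sup>2"
    proof (cases "\<forall>z\<in>cball 0 s1. cmod (deriv Y z) \<le> \<eta>")
      case True
      have half: "cmod (Y z) \<ge> 1 / 2" if z: "cmod z \<le> s1" for z
      proof -
        have "cmod (Y z - Y z1) \<le> \<eta> * cmod (z - z1)"
        proof (rule field_differentiable_bound[of "cball 0 s1"])
          show "(Y has_field_derivative deriv Y w) (at w within cball 0 s1)" if "w \<in> cball 0 s1" for w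
            using holomorphic_derivI[OF Y U(1) inU[of w]] that s1 by (auto intro: has_field_derivative_at_within)
        qed (use True z z1 s1 in auto)
        also have "\<dots> \<le> \<eta> * (2 * s1)"
          using norm_triangle_ineq4[of z z1] z z1 s1 \<eta> by (intro mult_left_mono) auto
        also have "\<dots> = 1 / 2" using s1 by (simp add: \<eta>_def)
        finally have "cmod (Y z1) - cmod (Y z) \<le> 1 / 2"
          by (metis norm_minus_commute norm_triangle_ineq2 order_trans)
        then show ?thesis using z1 by simp
      qed
      show ?thesis
      proof (intro allI impI)
        fix z assume z: "cmod z \<le> s"
        have sub: "cball z \<delta> \<subseteq> cball 0 s1" using cball_shift_subset[of z s \<delta> s1] z \<delta> by simp
        have "cmod (deriv (deriv Y) z) \<le> \<eta> / \<delta>"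
          by (rule deriv_le_sup[OF U(1) dY \<delta>(1)]) (use sub True inU s1 in \<open>force+\<close>)
        moreover have Yz: "cmod (Y z) \<ge> 1 / 2" using half z s1 by simp
        moreover have Y0: "Y z \<noteq> 0" using Yz by auto
        ultimately have t2: "cmod (deriv (deriv Y) z / Y z) \<le> (\<eta> / \<delta>) / (1 / 2)"
          unfolding norm_divide using \<eta> \<delta> by (intro frac_le) auto
        have "cmod (deriv Y z / Y z) \<le> \<eta> / (1 / 2)"
          unfolding norm_divide using True z s1 Yz \<eta> by (intro frac_le) auto
        then have "(cmod (deriv Y z / Y z))\<^sup>2 \<le> (\<eta> / (1 / 2))\<^sup>2" by (intro power_mono) auto
        then have t1: "cmod ((deriv Y z / Y z)\<^sup>2 / 2) \<le> 2 * \<eta>\<^sup>2"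
          by (simp add: norm_divide norm_power power_mult_distrib)
        have "q z = (deriv Y z / Y z)\<^sup>2 / 2 - deriv (deriv Y) z / Y z"
          using ode[of z] inU[of z] z s1 s Y0 by (simp add: power2_eq_square field_simps)
        then have "cmod (q z) \<le> C1"
          using norm_triangle_ineq4[of "(deriv Y z / Y z)\<^sup>2 / 2" "deriv (deriv Y) z / Y z"] t1 t2
          by (simp add: C1_def)
        also have "C1 \<le> (C1 + C2) * 1" using C20 by simp
        also have "\<dots> \<le> (C1 + C2) * (1 + ln K)\<^sup>2"
          using L \<open>C1 > 0\<close> C20 by (intro mult_left_mono) (auto simp: one_le_power)
        finally show "cmod (q z) \<le> (C1 + C2) * (1 + ln K)\<^sup>2" .
      qed
    next
      case False
      then obtain z2 where z2: "cmod z2 \<le> s1" "cmod (deriv Y z2) > \<eta>" by auto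
      obtain as where as: "real (length as) \<le> Ca * (1 + ln K)"
        "\<And>z. cmod z \<le> s1 \<Longrightarrow> Y z \<noteq> 0 \<Longrightarrow> cmod (deriv Y z / Y z) \<le> (\<Sum>a\<leftarrow>as. 1 / cmod (z - a)) + Ca * (1 + ln K)"
        using Ca(2)[OF U Y K _ z1(2)] z1(1) s1 by force
      define g where "g = (\<lambda>z. deriv Y z / of_real \<eta>)"
      have g: "g holomorphic_on U" unfolding g_def using \<eta> by (intro holomorphic_intros dY) auto
      define K2 where "K2 = K / (\<delta> * \<eta>)"
      have gK: "cmod (g z) \<le> K2" if z: "cmod z \<le> s2" for z
      proof -
        have sub: "cball z \<delta> \<subseteq> cball 0 R" using cball_shift_subset[of z s2 \<delta> R] z \<delta> by simp
        have "cmod (deriv Y z) \<le> K / \<delta>"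
          by (rule deriv_le_sup[OF U(1) Y \<delta>(1)]) (use sub U(2) K in \<open>force+\<close>)
        then show ?thesis using \<eta> by (simp add: g_def norm_divide K2_def divide_right_mono flip: divide_divide_eq_left)
      qed
      have sub2: "cball 0 s2 \<subseteq> U" using U(2) s1 by auto
      have "1 \<le> cmod (g z2)" using z2 \<eta> by (simp add: g_def norm_divide)
      from Cb(2)[OF U(1) sub2 g gK z2(1) this]
      obtain bs where bs: "real (length bs) \<le> Cb * (1 + ln K2)"
        "\<And>z. cmod z \<le> s1 \<Longrightarrow> g z \<noteq> 0 \<Longrightarrow> cmod (deriv g z / g z) \<le> (\<Sum>a\<leftarrow>bs. 1 / cmod (z - a)) + Cb * (1 + ln K2)"
        by blast
      have lnK2: "1 + ln K2 \<le> m * (1 + ln K)"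
      proof -
        have "ln K2 = ln K - ln (\<delta> * \<eta>)" unfolding K2_def using K1 \<delta>(1) \<eta> by (simp add: ln_div)
        then have "1 + ln K2 \<le> (1 + ln K) + \<bar>ln (\<delta> * \<eta>)\<bar> * 1" by simp
        also have "\<dots> \<le> (1 + ln K) + \<bar>ln (\<delta> * \<eta>)\<bar> * (1 + ln K)" using L by (intro add_left_mono mult_left_mono) auto
        finally show ?thesis by (simp add: m_def algebra_simps)
      qed
      have CbK: "Cb * (1 + ln K2) \<le> Cb * (m * (1 + ln K))" using lnK2 Cb(1) by simp
      define cs where "cs = as @ as @ bs"
      have len: "real (length cs) \<le> D * (1 + ln K)"
        using as(1) bs(1) CbK by (simp add: cs_def D_def algebra_simps)
      have pt: "sqrt (cmod (q z)) \<le> (\<Sum>a\<leftarrow>cs. 1 / cmod (z - a)) + D * (1 + ln K)"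
        if z: "cmod z \<le> s1" "Y z \<noteq> 0" "deriv Y z \<noteq> 0" for z
      proof -
        define b where "b = cmod (deriv Y z / Y z)"
        define e where "e = cmod (deriv (deriv Y) z / deriv Y z)"
        have be: "0 \<le> b" "0 \<le> e" by (auto simp: b_def e_def)
        have zU: "z \<in> U" using inU z s1 by simp
        have "deriv g z = deriv (deriv Y) z / of_real \<eta>"
          unfolding g_def by (rule DERIV_imp_deriv) (auto intro!: DERIV_cdivide holomorphic_derivI[OF dY U(1) zU])
        then have "deriv g z / g z = deriv (deriv Y) z / deriv Y z" using \<eta> by (simp add: g_def)
        then have e: "e \<le> (\<Sum>a\<leftarrow>bs. 1 / cmod (z - a)) + Cb * (m * (1 + ln K))"
          using bs(2)[of z] z \<eta> CbK by (simp add: g_def e_def)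
        have b: "b \<le> (\<Sum>a\<leftarrow>as. 1 / cmod (z - a)) + Ca * (1 + ln K)" using as(2) z by (simp add: b_def)
        have "q z = (deriv Y z / Y z)\<^sup>2 / 2 - (deriv (deriv Y) z / deriv Y z) * (deriv Y z / Y z)"
          using ode[OF zU] z by (simp add: power2_eq_square field_simps)
        then have "cmod (q z) \<le> b\<^sup>2 / 2 + e * b"
          using norm_triangle_ineq4[of "(deriv Y z / Y z)\<^sup>2 / 2" "(deriv (deriv Y) z / deriv Y z) * (deriv Y z / Y z)"]
          unfolding norm_mult[of "deriv (deriv Y) z / deriv Y z"] by (simp add: b_def e_def norm_power norm_divide)
        also have "\<dots> \<le> (2 * b + e)\<^sup>2"
        proof -
          have "(2 * b + e)\<^sup>2 - (b\<^sup>2 / 2 + e * b) = 7 / 2 * (b * b) + 3 * (e * b) + e * e"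
            by (simp add: power2_eq_square algebra_simps)
          also have "\<dots> \<ge> 0" using be by (intro add_nonneg_nonneg mult_nonneg_nonneg) auto
          finally show ?thesis by simp
        qed
        finally have "sqrt (cmod (q z)) \<le> 2 * b + e" using be by (simp add: real_le_lsqrt)
        also have "\<dots> \<le> (\<Sum>a\<leftarrow>cs. 1 / cmod (z - a)) + D * (1 + ln K)"
          using b e by (simp add: cs_def D_def algebra_simps)
        finally show ?thesis .
      qed
      have null: "{z \<in> cball 0 s1. Y z = 0} \<in> null_sets lborel" "{z \<in> cball 0 s1. deriv Y z = 0} \<in> null_sets lborel"
      proof -
        have bU: "ball 0 R \<subseteq> U" using U(2) by auto
        have hY: "Y holomorphic_on ball 0 R" "deriv Y holomorphic_on ball 0 R"
          using Y dY bU holomorphic_on_subset by blast+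
        have dnz: "\<exists>z\<in>ball 0 R. deriv Y z \<noteq> 0" using z2 \<eta> s1 by (intro bexI[of _ z2]) auto
        have zr: "countable {z \<in> cball 0 s1. h z = 0}" if "h holomorphic_on ball 0 R" "\<not> (\<forall>z\<in>ball 0 R. h z = 0)" for h :: "complex \<Rightarrow> complex"
        proof (cases "h constant_on ball 0 R")
          case True
          then have "{z \<in> cball 0 s1. h z = 0} = {}" using that(2) s1 by (force simp: constant_on_def)
          then show ?thesis by (simp only: countable_empty)
        next
          case False
          show ?thesis 
            by (rule countable_finite, rule holomorphic_compact_finite_zeros[OF that(1) _ _ _ _ False])
               (use s1 in auto)
        qed
        have Y1: "Y z1 \<noteq> 0" using z1(2) by auto
        have "countable {z \<in> cball 0 s1. Y z = 0}"
        proof (rule zr[OF hY(1)])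
          show "\<not> (\<forall>z\<in>ball 0 R. Y z = 0)" using Y1 z1(1) s by force
        qed
        moreover have "countable {z \<in> cball 0 s1. deriv Y z = 0}" using zr[OF hY(2)] dnz by blast
        ultimately show "{z \<in> cball 0 s1. Y z = 0} \<in> null_sets lborel" "{z \<in> cball 0 s1. deriv Y z = 0} \<in> null_sets lborel"
          using countable_imp_null_set_lborel by blast+
      qed
      have nn: "0 \<le> (\<Sum>a\<leftarrow>cs. 1 / cmod (z - a))" for z by (intro sum_list_nonneg) auto
      have "(\<integral>\<^sup>+z\<in>ball 0 s1. ennreal (sqrt (cmod (q z))) \<partial>lborel)
         \<le> (\<integral>\<^sup>+z. ennreal (\<Sum>a\<leftarrow>cs. 1 / cmod (z - a)) * indicator (ball 0 s1) z + ennreal (D * (1 + ln K)) * indicator (ball 0 s1) z \<partial>lborel)"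
      proof (rule nn_integral_mono_AE)
        have "AE z in lborel. z \<notin> {z \<in> cball 0 s1. Y z = 0} \<and> z \<notin> {z \<in> cball 0 s1. deriv Y z = 0}"
          using AE_not_in[OF null(1)] AE_not_in[OF null(2)] by eventually_elim auto
        then show "AE z in lborel. ennreal (sqrt (cmod (q z))) * indicator (ball 0 s1) z
            \<le> ennreal (\<Sum>a\<leftarrow>cs. 1 / cmod (z - a)) * indicator (ball 0 s1) z + ennreal (D * (1 + ln K)) * indicator (ball 0 s1) z"
        proof eventually_elim
          case (elim z)
          show ?case
          proof (cases "z \<in> ball 0 s1")
            case True
            then have "Y z \<noteq> 0" "deriv Y z \<noteq> 0" using elim s1 by auto
            then have "ennreal (sqrt (cmod (q z))) \<le> ennreal ((\<Sum>a\<leftarrow>cs. 1 / cmod (z - a)) + D * (1 + ln K))"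
              using pt[of z] True by (intro ennreal_leI) auto
            also have "\<dots> = ennreal (\<Sum>a\<leftarrow>cs. 1 / cmod (z - a)) + ennreal (D * (1 + ln K))"
              using nn D L by (intro ennreal_plus) auto
            finally show ?thesis using True by simp
          qed simp
        qed
      qed
      also have "\<dots> = (\<integral>\<^sup>+z\<in>ball 0 s1. ennreal (\<Sum>a\<leftarrow>cs. 1 / cmod (z - a)) \<partial>lborel) + (\<integral>\<^sup>+z. ennreal (D * (1 + ln K)) * indicator (ball 0 s1) (z::complex) \<partial>lborel)"
      proof (rule nn_integral_add)
        have "(\<lambda>z. \<Sum>a\<leftarrow>bs. 1 / cmod (z - a)) \<in> borel_measurable borel" for bs
          by (induction bs) auto
        then have "(\<lambda>z. ennreal (\<Sum>a\<leftarrow>cs. 1 / cmod (z - a))) \<in> borel_measurable lborel" by measurable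
        then show "(\<lambda>z. ennreal (\<Sum>a\<leftarrow>cs. 1 / cmod (z - a)) * indicator (ball 0 s1) z) \<in> borel_measurable lborel"
          by (intro borel_measurable_times_ennreal borel_measurable_indicator) auto
      qed (auto intro!: borel_measurable_times_ennreal borel_measurable_indicator)
      also have "\<dots> \<le> ennreal (real (length cs) * (pi * (s1\<^sup>2 + 4))) + ennreal (D * (1 + ln K)) * ennreal (pi * s1\<^sup>2)"
      proof (rule add_mono[OF nn_integral_list_inverse_dist[OF s1(1)]])
        have "(\<integral>\<^sup>+z. ennreal (D * (1 + ln K)) * indicator (ball 0 s1) (z::complex) \<partial>lborel) = ennreal (D * (1 + ln K)) * emeasure lborel (ball (0::complex) s1)"
          by (subst nn_integral_cmult) (auto intro!: borel_measurable_indicator)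
        also have "emeasure lborel (ball (0::complex) s1) = ennreal (pi * s1\<^sup>2)"
          using s1 by (simp add: emeasure_ball unit_ball_vol_2)
        finally show "(\<integral>\<^sup>+z. ennreal (D * (1 + ln K)) * indicator (ball 0 s1) (z::complex) \<partial>lborel) \<le> ennreal (D * (1 + ln K)) * ennreal (pi * s1\<^sup>2)"
          by simp
      qed
      also have "\<dots> = ennreal (real (length cs) * (pi * (s1\<^sup>2 + 4)) + D * (1 + ln K) * (pi * s1\<^sup>2))"
        using D L by (simp add: ennreal_mult[symmetric] ennreal_plus[symmetric] del: ennreal_plus)
      also have "\<dots> \<le> ennreal (E * (1 + ln K))"
      proof (rule ennreal_leI)
        have "real (length cs) * (pi * (s1\<^sup>2 + 4)) \<le> D * (1 + ln K) * (pi * (s1\<^sup>2 + 4))"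
          using len by (intro mult_right_mono) auto
        then show "real (length cs) * (pi * (s1\<^sup>2 + 4)) + D * (1 + ln K) * (pi * s1\<^sup>2) \<le> E * (1 + ln K)"
          by (simp add: E_def algebra_simps)
      qed
      finally have int: "(\<integral>\<^sup>+z\<in>ball 0 s1. ennreal (sqrt (cmod (q z))) \<partial>lborel) \<le> ennreal (E * (1 + ln K))" .
      have E: "E \<ge> 0" using D by (simp add: E_def)
      show ?thesis
      proof (intro allI impI)
        fix z assume z: "cmod z \<le> s"
        have "cmod (q z) \<le> 256 * (E * (1 + ln K))\<^sup>2 / (pi\<^sup>2 * (s1 - s) ^ 4)"
        proof (rule sup_le_sqrt_mean[OF U(1) _ q s1(2) _ _ int z])
          show "cball 0 s1 \<subseteq> U" using U(2) s1 by auto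
        qed (use s E L in auto)
        also have "\<dots> = C2 * (1 + ln K)\<^sup>2" by (simp add: C2_def power_mult_distrib)
        also have "\<dots> \<le> (C1 + C2) * (1 + ln K)\<^sup>2" using \<open>C1 > 0\<close> by (intro mult_right_mono) auto
        finally show "cmod (q z) \<le> (C1 + C2) * (1 + ln K)\<^sup>2" .
      qed
    qed
  qed
qed

section \<open>Quadratic forms of a developing map\<close>

text \<open>The quadratic form \<open>(a u + b v)\<^sup>2\<close>, where \<open>f = u / v\<close> and \<open>v\<^sup>2 = 1 / f'\<close>, written without the choice of a square root. At a pole the same
function is expressed through \<open>h = 1 / f\<close>: there \<open>(a f + b)\<^sup>2 / f' = - (a + b h)\<^sup>2 / h'\<close>, and \<open>h = 0\<close>.\<close>

definition developing_form :: "(complex \<Rightarrow> sphere) \<Rightarrow> complex \<Rightarrow> complex \<Rightarrow> complex \<Rightarrow> complex" where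
  "developing_form f a b z = (case f z of
     Some g \<Rightarrow> (a * g + b)\<^sup>2 / deriv (\<lambda>w. the (f w)) z
   | None \<Rightarrow> - (a\<^sup>2) / deriv (\<lambda>w. the (sphere_inv (f w))) z)"

lemma open_upper_half_plane: "open upper_half_plane"
  unfolding upper_half_plane_def by (rule open_halfspace_Im_gt)

lemma convex_upper_half_plane: "convex upper_half_plane"
  unfolding upper_half_plane_def by (rule convex_halfspace_Im_gt)

text \<open>The classical correspondence between the Schwarzian and the linear equation: \<open>s = 1 / \<surd>g'\<close> and \<open>g s\<close> are two solutions of
\<open>y'' = - (q/2) y\<close> with quotient \<open>g\<close>.\<close>

lemma schwarzian_solutions:
  assumes B: "open B" "convex B" and g: "g holomorphic_on B" "inj_on g B"
    and q: "\<And>w. w \<in> B \<Longrightarrow> schwarzian g w = q w"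
  obtains s s' where "\<And>w. w \<in> B \<Longrightarrow> (s w)\<^sup>2 = 1 / deriv g w"
    "\<And>w. w \<in> B \<Longrightarrow> (s has_field_derivative s' w) (at w)"
    "\<And>w. w \<in> B \<Longrightarrow> (s' has_field_derivative - q w / 2 * s w) (at w)"
    "\<And>w. w \<in> B \<Longrightarrow> ((\<lambda>w. deriv g w * s w + g w * s' w) has_field_derivative - q w / 2 * (g w * s w)) (at w)"
    "\<And>w. w \<in> B \<Longrightarrow> deriv g w \<noteq> 0"
proof -
  have dg: "deriv g holomorphic_on B" "deriv (deriv g) holomorphic_on B"
    using g(1) B(1) by (auto intro!: holomorphic_deriv)
  have nz: "deriv g w \<noteq> 0" if "w \<in> B" for w
    using holomorphic_injective_imp_regular[OF g(1) B(1) g(2) that] .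
  have "(\<lambda>w. 1 / deriv g w) holomorphic_on B" using nz by (intro holomorphic_intros dg) auto
  then obtain s where s: "s holomorphic_on B" "\<And>w. w \<in> B \<Longrightarrow> 1 / deriv g w = (s w)\<^sup>2"
    using contractible_imp_holomorphic_sqrt[of "\<lambda>w. 1 / deriv g w" B] nz convex_imp_contractible[OF B(2)]
    by (metis divide_eq_0_iff one_neq_zero)
  define P where "P = (\<lambda>w. deriv (deriv g) w / deriv g w)"
  define s' where "s' = (\<lambda>w. - s w * P w / 2)"
  have P: "P holomorphic_on B" unfolding P_def using nz by (intro holomorphic_intros dg) auto
  have gd: "(g has_field_derivative deriv g w) (at w)"
    and g2d: "(deriv g has_field_derivative deriv (deriv g) w) (at w)"
    and Pd: "(P has_field_derivative deriv P w) (at w)"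
    and sd0: "(s has_field_derivative deriv s w) (at w)" if "w \<in> B" for w
    using g(1) dg P s(1) B(1) that by (auto intro: holomorphic_derivI)
  have sn: "s w \<noteq> 0" if "w \<in> B" for w using s(2)[OF that] nz[OF that] by auto
  have sd: "(s has_field_derivative s' w) (at w)" if w: "w \<in> B" for w
  proof -
    have "((\<lambda>w. (s w)\<^sup>2 * deriv g w) has_field_derivative 2 * s w * deriv s w * deriv g w + (s w)\<^sup>2 * deriv (deriv g) w) (at w)"
      by (auto intro!: derivative_eq_intros sd0 g2d w)
    moreover have "((\<lambda>w. (s w)\<^sup>2 * deriv g w) has_field_derivative 0) (at w)"
    proof (rule has_field_derivative_transform_within_open[OF DERIV_const[of 1] B(1) w])
      show "1 = (s v)\<^sup>2 * deriv g v" if "v \<in> B" for v using s(2)[OF that] nz[OF that] by (simp add: field_simps)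
    qed
    ultimately have "2 * s w * deriv s w * deriv g w + (s w)\<^sup>2 * deriv (deriv g) w = 0" by (rule DERIV_unique)
    then have "s w * (2 * deriv s w * deriv g w + s w * deriv (deriv g) w) = 0"
      by (simp add: power2_eq_square algebra_simps)
    then have "2 * deriv s w * deriv g w = - s w * deriv (deriv g) w" using sn[OF w] by (simp add: eq_neg_iff_add_eq_0)
    then have "deriv s w = s' w" using nz[OF w] by (simp add: s'_def P_def field_simps)
    then show ?thesis using sd0[OF w] by simp
  qed
  have s2d: "(s' has_field_derivative - q w / 2 * s w) (at w)" if w: "w \<in> B" for w
  proof -
    have "(s' has_field_derivative - (s' w * P w + s w * deriv P w) / 2) (at w)"
      unfolding s'_def[abs_def] by (auto intro!: derivative_eq_intros sd[unfolded s'_def[abs_def]] Pd w simp: field_simps)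
    moreover have qe: "q w = deriv P w - (P w)\<^sup>2 / 2" using q[OF w] by (simp add: schwarzian_def P_def)
    have "- (s' w * P w + s w * deriv P w) / 2 = - q w / 2 * s w"
      unfolding qe by (simp add: s'_def power2_eq_square field_simps)
    ultimately show ?thesis by simp
  qed
  have ud: "((\<lambda>w. deriv g w * s w + g w * s' w) has_field_derivative - q w / 2 * (g w * s w)) (at w)" if w: "w \<in> B" for w
  proof -
    have "((\<lambda>w. deriv g w * s w + g w * s' w) has_field_derivative
        (deriv (deriv g) w * s w + 2 * deriv g w * s' w) + g w * (- q w / 2 * s w)) (at w)"
      by (auto intro!: derivative_eq_intros gd g2d sd s2d w simp: algebra_simps)
    moreover have "deriv (deriv g) w * s w + 2 * deriv g w * s' w = 0"
      using nz[OF w] by (simp add: s'_def P_def)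
    ultimately show ?thesis by (simp add: mult_ac)
  qed
  show ?thesis using that[of s s'] s(2) sd s2d ud nz by simp
qed

text \<open>On \<open>B\<close> the pair \<open>(u, v)\<close> is a lift of \<open>f\<close> to \<open>\<complex>\<^sup>2\<close> by solutions of the linear equation. The Wronskian is normalized to the
value that it has for \<open>v = 1 / \<surd>f'\<close>, \<open>u = f v\<close>, which fixes the lift up to sign.\<close>

definition developing_lift :: "(complex \<Rightarrow> complex) \<Rightarrow> (complex \<Rightarrow> sphere) \<Rightarrow> complex set \<Rightarrow>
    (complex \<Rightarrow> complex) \<Rightarrow> (complex \<Rightarrow> complex) \<Rightarrow> (complex \<Rightarrow> complex) \<Rightarrow> (complex \<Rightarrow> complex) \<Rightarrow> bool" where
  "developing_lift q f B u v u' v' \<longleftrightarrow> open B \<and> B \<subseteq> upper_half_plane \<and> (\<forall>w\<in>B.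
     (u has_field_derivative u' w) (at w) \<and> (v has_field_derivative v' w) (at w) \<and>
     (u' has_field_derivative - q w / 2 * u w) (at w) \<and> (v' has_field_derivative - q w / 2 * v w) (at w) \<and>
     u w * v' w - v w * u' w = -1 \<and>
     f w = (if v w = 0 then None else Some (u w / v w)) \<and>
     (\<forall>a b. developing_form f a b w = (a * u w + b * v w)\<^sup>2))"

text \<open>Where \<open>f\<close> has a pole, start from \<open>g = 1 / f\<close> instead and exchange the two solutions; the factor \<open>\<i>\<close> then restores the sign of the
Wronskian.\<close>

lemma developing_lift_exists:
  assumes f: "developing_map q f" and \<tau>: "\<tau> \<in> upper_half_plane"
  obtains B u v u' v' where "\<tau> \<in> B" "developing_lift q f B u v u' v'"
proof -
  define Q where "Q = (\<lambda>U g. open U \<and> \<tau> \<in> U \<and> U \<subseteq> upper_half_plane \<and>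
        g holomorphic_on U \<and> inj_on g U \<and>
        ((\<forall>w\<in>U. f w = Some (g w)) \<or> (\<forall>w\<in>U. sphere_inv (f w) = Some (g w))) \<and>
        (\<forall>w\<in>U. schwarzian g w = q w))"
  have "\<exists>U g. Q U g" unfolding Q_def by (rule bspec[OF f[unfolded developing_map_def] \<tau>])
  then obtain U g where Qg: "Q U g" by blast
  have U: "open U" "\<tau> \<in> U" "U \<subseteq> upper_half_plane" and g: "g holomorphic_on U" "inj_on g U"
    and kind: "(\<forall>w\<in>U. f w = Some (g w)) \<or> (\<forall>w\<in>U. sphere_inv (f w) = Some (g w))"
    and q: "\<forall>w\<in>U. schwarzian g w = q w"
    using Qg unfolding Q_def by simp_all
  obtain e where e: "e > 0" "ball \<tau> e \<subseteq> U" using U openE by blast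
  define B where "B = ball \<tau> e"
  have B: "open B" "convex B" "\<tau> \<in> B" "B \<subseteq> U" using e by (auto simp: B_def)
  have gB: "g holomorphic_on B" "inj_on g B" using g B(4) holomorphic_on_subset inj_on_subset by blast+
  obtain s s' where s: "\<And>w. w \<in> B \<Longrightarrow> (s w)\<^sup>2 = 1 / deriv g w"
    "\<And>w. w \<in> B \<Longrightarrow> (s has_field_derivative s' w) (at w)"
    "\<And>w. w \<in> B \<Longrightarrow> (s' has_field_derivative - q w / 2 * s w) (at w)"
    "\<And>w. w \<in> B \<Longrightarrow> ((\<lambda>w. deriv g w * s w + g w * s' w) has_field_derivative - q w / 2 * (g w * s w)) (at w)"
    "\<And>w. w \<in> B \<Longrightarrow> deriv g w \<noteq> 0"
  proof (rule schwarzian_solutions[OF B(1,2) gB, of q])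
    show "schwarzian g w = q w" if "w \<in> B" for w using q B(4) that by blast
    show thesis if
      "\<And>w. w \<in> B \<Longrightarrow> (s w)\<^sup>2 = 1 / deriv g w"
      "\<And>w. w \<in> B \<Longrightarrow> (s has_field_derivative s' w) (at w)"
      "\<And>w. w \<in> B \<Longrightarrow> (s' has_field_derivative - q w / 2 * s w) (at w)"
      "\<And>w. w \<in> B \<Longrightarrow> ((\<lambda>w. deriv g w * s w + g w * s' w) has_field_derivative - q w / 2 * (g w * s w)) (at w)"
      "\<And>w. w \<in> B \<Longrightarrow> deriv g w \<noteq> 0"
      "\<And>s s'. (\<And>w. w \<in> B \<Longrightarrow> (s w)\<^sup>2 = 1 / deriv g w) \<Longrightarrow>
      (\<And>w. w \<in> B \<Longrightarrow> (s has_field_derivative s' w) (at w)) \<Longrightarrow>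
      (\<And>w. w \<in> B \<Longrightarrow> (s' has_field_derivative - q w / 2 * s w) (at w)) \<Longrightarrow>
      (\<And>w. w \<in> B \<Longrightarrow> ((\<lambda>w. deriv g w * s w + g w * s' w) has_field_derivative - q w / 2 * (g w * s w)) (at w)) \<Longrightarrow>
      (\<And>w. w \<in> B \<Longrightarrow> deriv g w \<noteq> 0) \<Longrightarrow> thesis" for s s' thesis
      using that(1-5) by (rule that(6))
  qed
  have gd: "(g has_field_derivative deriv g w) (at w)" if "w \<in> B" for w
    using holomorphic_derivI[OF gB(1) B(1) that] by simp
  have sn: "s w \<noteq> 0" if "w \<in> B" for w using s(1,5)[OF that] by auto
  have s2: "s w * s w * deriv g w = 1" if "w \<in> B" for w
    using s(1,5)[OF that] by (simp add: power2_eq_square field_simps)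
  have gsd: "((\<lambda>w. g w * s w) has_field_derivative deriv g w * s w + g w * s' w) (at w)" if "w \<in> B" for w
    by (auto intro!: derivative_eq_intros gd s that)
  have wr: "s w * (deriv g w * s w + g w * s' w) - g w * s w * s' w = 1" if "w \<in> B" for w
    using s2[OF that] by (simp add: algebra_simps)
  from kind show ?thesis
  proof
    assume k: "\<forall>w\<in>U. f w = Some (g w)"
    have "developing_lift q f B (\<lambda>w. g w * s w) s (\<lambda>w. deriv g w * s w + g w * s' w) s'"
      unfolding developing_lift_def
    proof (intro conjI ballI allI)
      fix w a b assume w: "w \<in> B"
      have "deriv (\<lambda>w. the (f w)) w = deriv g w"
      proof (rule complex_derivative_transform_within_open[of _ B])
        show "(\<lambda>w. the (f w)) holomorphic_on B" using gB(1) k B(4) by (auto cong: holomorphic_cong simp: subset_iff)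
      qed (use gB(1) B w k in auto)
      then have "developing_form f a b w = (a * g w + b)\<^sup>2 * (s w)\<^sup>2"
        using k w B(4) s(1)[OF w] by (auto simp: developing_form_def)
      then show "developing_form f a b w = (a * (g w * s w) + b * s w)\<^sup>2" by (simp add: power2_eq_square algebra_simps)
      show "f w = (if s w = 0 then None else Some (g w * s w / s w))" using sn[OF w] k w B(4) by auto
      show "g w * s w * s' w - s w * (deriv g w * s w + g w * s' w) = - 1"
        using wr[OF w] by (simp add: algebra_simps)
    qed (use B U gsd s in auto)
    then show ?thesis by (rule that[OF B(3)])
  next
    assume k: "\<forall>w\<in>U. sphere_inv (f w) = Some (g w)"
    have fk: "f w = (if g w = 0 then None else Some (1 / g w))" if "w \<in> U" for w
      using k[rule_format, OF that] by (cases "f w") (auto split: if_splits simp: field_simps)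
    have "developing_lift q f B (\<lambda>w. \<i> * s w) (\<lambda>w. \<i> * (g w * s w)) (\<lambda>w. \<i> * s' w) (\<lambda>w. \<i> * (deriv g w * s w + g w * s' w))"
      unfolding developing_lift_def
    proof (intro conjI ballI allI)
      fix w a b assume w: "w \<in> B"
      have sq: "(a * (\<i> * s w) + b * (\<i> * (g w * s w)))\<^sup>2 = - (a + b * g w)\<^sup>2 * (s w)\<^sup>2"
        by (simp add: power2_eq_square algebra_simps)
      have "developing_form f a b w = - (a + b * g w)\<^sup>2 * (s w)\<^sup>2"
      proof (cases "g w = 0")
        case True
        have "deriv (\<lambda>w. the (sphere_inv (f w))) w = deriv g w"
        proof (rule complex_derivative_transform_within_open[of _ B])
          show "(\<lambda>w. the (sphere_inv (f w))) holomorphic_on B"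
            using gB(1) k B(4) by (auto cong: holomorphic_cong simp: subset_iff)
        qed (use gB(1) B w k in auto)
        moreover have "f w = None" using fk True w B(4) by auto
        ultimately show ?thesis using True s(1)[OF w] by (simp add: developing_form_def)
      next
        case False
        define V where "V = {v \<in> B. g v \<noteq> 0}"
        have V: "open V" "w \<in> V"
        proof -
          have "open (B \<inter> g -` (- {0}))" using B(1) gB(1)
            by (intro continuous_open_preimage holomorphic_on_imp_continuous_on) auto
          moreover have "V = B \<inter> g -` (- {0})" by (auto simp: V_def)
          ultimately show "open V" by simp
          show "w \<in> V" using False w by (simp add: V_def)
        qed
        have "((\<lambda>w. the (f w)) has_field_derivative - deriv g w / (g w)\<^sup>2) (at w)"
        proof (rule has_field_derivative_transform_within_open[OF _ V])
          show "((\<lambda>w. 1 / g w) has_field_derivative - deriv g w / (g w)\<^sup>2) (at w)"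
            using False by (auto intro!: derivative_eq_intros gd w simp: power2_eq_square)
          show "1 / g v = the (f v)" if "v \<in> V" for v using that fk[of v] B(4) by (auto simp: V_def)
        qed
        then have "deriv (\<lambda>w. the (f w)) w = - deriv g w / (g w)\<^sup>2" by (rule DERIV_imp_deriv)
        moreover have "f w = Some (1 / g w)" using fk[of w] False w B(4) by auto
        ultimately have "developing_form f a b w = (a * (1 / g w) + b)\<^sup>2 / (- deriv g w / (g w)\<^sup>2)"
          by (simp add: developing_form_def)
        also have "\<dots> = - (a + b * g w)\<^sup>2 * (s w)\<^sup>2"
          using False s(5)[OF w] unfolding s(1)[OF w] by (simp add: power2_eq_square field_simps)
        finally show ?thesis .
      qed
      then show "developing_form f a b w = (a * (\<i> * s w) + b * (\<i> * (g w * s w)))\<^sup>2" unfolding sq .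
      show "f w = (if \<i> * (g w * s w) = 0 then None else Some (\<i> * s w / (\<i> * (g w * s w))))"
        using sn[OF w] fk[of w] w B(4) by auto
      show "\<i> * s w * (\<i> * (deriv g w * s w + g w * s' w)) - \<i> * (g w * s w) * (\<i> * s' w) = - 1"
        using wr[OF w] by (simp add: algebra_simps)
      show "((\<lambda>w. \<i> * s w) has_field_derivative \<i> * s' w) (at w)"
        "((\<lambda>w. \<i> * (g w * s w)) has_field_derivative \<i> * (deriv g w * s w + g w * s' w)) (at w)"
        by (rule DERIV_cmult s(2) gsd w)+
      show "((\<lambda>w. \<i> * s' w) has_field_derivative - q w / 2 * (\<i> * s w)) (at w)"
        using DERIV_cmult[OF s(3)[OF w], of \<i>] by (simp add: mult_ac)
      show "((\<lambda>w. \<i> * (deriv g w * s w + g w * s' w)) has_field_derivative - q w / 2 * (\<i> * (g w * s w))) (at w)"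
        using DERIV_cmult[OF s(4)[OF w], of \<i>] by (simp add: mult_ac)
    qed (use B U in auto)
    then show ?thesis by (rule that[OF B(3)])
  qed
qed

text \<open>With \<open>y = a u + b v\<close> and \<open>Y = y\<^sup>2\<close>: \<open>Y' = 2 y y'\<close>, \<open>Y'' + q Y = 2 y'\<^sup>2\<close>, and the derivative of the latter is \<open>- q Y'\<close>.\<close>

lemma developing_lift_form_derivs:
  fixes a b :: complex
  assumes l: "developing_lift q f B u v u' v'" and w: "w \<in> B"
  defines "y \<equiv> \<lambda>w. a * u w + b * v w" and "y' \<equiv> \<lambda>w. a * u' w + b * v' w"
  shows "(developing_form f a b has_field_derivative 2 * y w * y' w) (at w)"
    and "deriv (developing_form f a b) w = 2 * y w * y' w"
    and "(deriv (developing_form f a b) has_field_derivative 2 * (y' w)\<^sup>2 - q w * developing_form f a b w) (at w)"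
    and "((\<lambda>w. deriv (deriv (developing_form f a b)) w + q w * developing_form f a b w)
           has_field_derivative - q w * deriv (developing_form f a b) w) (at w)"
    and "deriv (deriv (developing_form f a b)) w = 2 * (y' w)\<^sup>2 - q w * developing_form f a b w"
proof -
  have B: "open B" using l by (simp add: developing_lift_def)
  have yd: "(y has_field_derivative y' w) (at w)" if "w \<in> B" for w
    using l that unfolding y_def y'_def developing_lift_def by (auto intro!: derivative_eq_intros)
  have y'd: "(y' has_field_derivative - q w / 2 * y w) (at w)" if "w \<in> B" for w
  proof -
    have "(y' has_field_derivative a * (- q w / 2 * u w) + b * (- q w / 2 * v w)) (at w)"
      using l that unfolding y'_def developing_lift_def by (intro DERIV_add DERIV_cmult) auto
    then show ?thesis by (simp add: y_def algebra_simps)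
  qed
  have Y: "developing_form f a b w = (y w)\<^sup>2" if "w \<in> B" for w
    using l that by (simp add: developing_lift_def y_def)
  have d1: "(developing_form f a b has_field_derivative 2 * y w * y' w) (at w)" if w: "w \<in> B" for w
  proof (rule has_field_derivative_transform_within_open[OF _ B w])
    show "((\<lambda>w. (y w)\<^sup>2) has_field_derivative 2 * y w * y' w) (at w)"
      by (auto intro!: derivative_eq_intros yd w)
  qed (simp add: Y)
  then have e1: "deriv (developing_form f a b) w = 2 * y w * y' w" if "w \<in> B" for w using that DERIV_imp_deriv by blast
  have d2: "(deriv (developing_form f a b) has_field_derivative 2 * (y' w)\<^sup>2 - q w * developing_form f a b w) (at w)" if w: "w \<in> B" for w
  proof (rule has_field_derivative_transform_within_open[OF _ B w])
    have "((\<lambda>w. 2 * y w * y' w) has_field_derivative 2 * y' w * y' w + 2 * y w * (- q w / 2 * y w)) (at w)"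
      by (auto intro!: derivative_eq_intros yd y'd w)
    also have "2 * y' w * y' w + 2 * y w * (- q w / 2 * y w) = 2 * (y' w)\<^sup>2 - q w * developing_form f a b w"
      unfolding Y[OF w] by (simp add: power2_eq_square algebra_simps)
    finally show "((\<lambda>w. 2 * y w * y' w) has_field_derivative 2 * (y' w)\<^sup>2 - q w * developing_form f a b w) (at w)" .
  qed (simp add: e1)
  then have e2: "deriv (deriv (developing_form f a b)) w = 2 * (y' w)\<^sup>2 - q w * developing_form f a b w" if "w \<in> B" for w
    using that DERIV_imp_deriv by blast
  have d3: "((\<lambda>w. deriv (deriv (developing_form f a b)) w + q w * developing_form f a b w)
           has_field_derivative - q w * deriv (developing_form f a b) w) (at w)" if w: "w \<in> B" for w
  proof (rule has_field_derivative_transform_within_open[OF _ B w])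
    have "((\<lambda>w. 2 * (y' w)\<^sup>2) has_field_derivative 2 * (2 * y' w * (- q w / 2 * y w))) (at w)"
      by (auto intro!: derivative_eq_intros y'd w)
    also have "2 * (2 * y' w * (- q w / 2 * y w)) = - q w * deriv (developing_form f a b) w"
      unfolding e1[OF w] by (simp add: algebra_simps)
    finally show "((\<lambda>w. 2 * (y' w)\<^sup>2) has_field_derivative - q w * deriv (developing_form f a b) w) (at w)" .
  qed (simp add: e2)
  show "(developing_form f a b has_field_derivative 2 * y w * y' w) (at w)"
    "deriv (developing_form f a b) w = 2 * y w * y' w"
    "(deriv (developing_form f a b) has_field_derivative 2 * (y' w)\<^sup>2 - q w * developing_form f a b w) (at w)"
    "((\<lambda>w. deriv (deriv (developing_form f a b)) w + q w * developing_form f a b w)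
           has_field_derivative - q w * deriv (developing_form f a b) w) (at w)"
    "deriv (deriv (developing_form f a b)) w = 2 * (y' w)\<^sup>2 - q w * developing_form f a b w"
    using d1 e1 d2 e2 d3 w by auto
qed

context
  fixes q f assumes f: "developing_map q f"
begin

lemma developing_form_holomorphic: "developing_form f a b holomorphic_on upper_half_plane"
  unfolding holomorphic_on_open[OF open_upper_half_plane]
proof
  fix z assume "z \<in> upper_half_plane"
  then obtain B u v u' v' where l: "z \<in> B" "developing_lift q f B u v u' v'" using developing_lift_exists[OF f] by metis
  show "\<exists>f'. (developing_form f a b has_field_derivative f') (at z)"
    using developing_lift_form_derivs(1)[OF l(2,1)] by (rule exI)
qed

lemma developing_form_Riccati:
  assumes "z \<in> upper_half_plane"
  shows "(deriv (developing_form f a b) z)\<^sup>2 - 2 * developing_form f a b z * deriv (deriv (developing_form f a b)) z = 2 * q z * (developing_form f a b z)\<^sup>2"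
proof -
  obtain B u v u' v' where l: "z \<in> B" "developing_lift q f B u v u' v'" using developing_lift_exists[OF f assms] .
  have "developing_form f a b z = (a * u z + b * v z)\<^sup>2" using l by (simp add: developing_lift_def)
  then show ?thesis
    unfolding developing_lift_form_derivs(2,5)[OF l(2,1)] by (simp add: power2_eq_square algebra_simps)
qed

lemma developing_form_rank_one:
  assumes "z \<in> upper_half_plane"
  obtains u v where "u \<noteq> 0 \<or> v \<noteq> 0" "\<And>a b. developing_form f a b z = (a * u + b * v)\<^sup>2"
proof -
  obtain B u v u' v' where l: "z \<in> B" "developing_lift q f B u v u' v'" using developing_lift_exists[OF f assms] .
  then have "u z * v' z - v z * u' z = -1" "\<And>a b. developing_form f a b z = (a * u z + b * v z)\<^sup>2"
    by (auto simp: developing_lift_def)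
  then show ?thesis using that[of "u z" "v z"] by fastforce
qed

lemma developing_form_third_order:
  assumes "z \<in> upper_half_plane"
  shows "((\<lambda>w. deriv (deriv (developing_form f a b)) w + q w * developing_form f a b w)
           has_field_derivative - q z * deriv (developing_form f a b) z) (at z)"
proof -
  obtain B u v u' v' where l: "z \<in> B" "developing_lift q f B u v u' v'" using developing_lift_exists[OF f assms] .
  show ?thesis by (rule developing_lift_form_derivs(4)[OF l(2,1)])
qed

text \<open>If \<open>v\<^sup>2\<close> vanished on an open set, so would \<open>v\<close> and \<open>v'\<close>, against the Wronskian. In other words, \<open>f\<close> takes a finite value somewhere
in every open set.\<close>

lemma developing_form_nonzero_ex:
  assumes W: "open W" "W \<noteq> {}" "W \<subseteq> upper_half_plane"
  shows "\<exists>z\<in>W. developing_form f 0 1 z \<noteq> 0"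
proof -
  obtain w where w: "w \<in> W" "w \<in> upper_half_plane" using W by blast
  obtain B u v u' v' where l: "w \<in> B" "developing_lift q f B u v u' v'" using developing_lift_exists[OF f w(2)] .
  have B: "open B" using l by (simp add: developing_lift_def)
  show ?thesis
  proof (rule ccontr)
    assume n: "\<not> ?thesis"
    have z: "v z = 0" if z: "z \<in> B \<inter> W" for z
    proof -
      have "developing_form f 0 1 z = (0 * u z + 1 * v z)\<^sup>2" using l(2) z unfolding developing_lift_def by blast
      moreover have "developing_form f 0 1 z = 0" using n z by blast
      ultimately show ?thesis by simp
    qed
    have "(v has_field_derivative 0) (at w)"
      by (rule has_field_derivative_transform_within_open[OF DERIV_const[of 0], of "B \<inter> W"])
         (use B W l w z in auto)
    moreover have "(v has_field_derivative v' w) (at w)" using l by (simp add: developing_lift_def)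
    ultimately have "v' w = 0" by (metis DERIV_unique)
    moreover have "v w = 0" using z l w by blast
    ultimately show False using l by (auto simp: developing_lift_def)
  qed
qed

text \<open>Near a point where \<open>f\<close> and \<open>f \<circ> \<gamma>\<close> are both finite, the lift at \<open>\<gamma> z\<close> and \<open>M (u, v)\<close> have the same quotient, hence are proportional;
comparing Wronskians, the square of the factor is \<open>\<gamma>'\<close>. The identity theorem extends the equation between holomorphic forms to the half-plane.\<close>

lemma developing_form_equivariant:
  assumes \<gamma>: "\<gamma> holomorphic_on upper_half_plane" "inj_on \<gamma> upper_half_plane" "\<gamma> ` upper_half_plane \<subseteq> upper_half_plane"
    and M: "det M = 1" and eq: "\<And>z. z \<in> upper_half_plane \<Longrightarrow> f (\<gamma> z) = moebius_act M (f z)"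
    and z: "z \<in> upper_half_plane"
  shows "developing_form f a b (\<gamma> z) = deriv \<gamma> z * developing_form f (a * M$1$1 + b * M$2$1) (a * M$1$2 + b * M$2$2) z"
proof -
  let ?H = upper_half_plane
  note H = open_upper_half_plane
  obtain z1 where z1: "z1 \<in> ?H" "developing_form f 0 1 z1 \<noteq> 0" using developing_form_nonzero_ex[of ?H] H z by blast
  define W where "W = {w \<in> ?H. developing_form f 0 1 w \<noteq> 0}"
  have oW: "open {w \<in> S. h w \<noteq> 0}" if "open S" "h holomorphic_on S" for S and h :: "complex \<Rightarrow> complex"
  proof -
    have "open (S \<inter> h -` (- {0}))" using that
      by (intro continuous_open_preimage holomorphic_on_imp_continuous_on) auto
    moreover have "{w \<in> S. h w \<noteq> 0} = S \<inter> h -` (- {0})" by auto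
    ultimately show ?thesis by simp
  qed
  have W: "open W" "z1 \<in> W" "W \<subseteq> ?H" using oW[OF H developing_form_holomorphic] z1 by (auto simp: W_def)
  have gW: "open (\<gamma> ` W)"
    using open_mapping_thm3[of \<gamma> W] W \<gamma> holomorphic_on_subset inj_on_subset by blast
  obtain z2 where z2: "z2 \<in> W" "developing_form f 0 1 (\<gamma> z2) \<noteq> 0"
    using developing_form_nonzero_ex[OF gW] W \<gamma>(3) by blast
  have hg: "(\<lambda>w. developing_form f a b (\<gamma> w)) holomorphic_on ?H" for a b
    using holomorphic_on_compose_gen[OF \<gamma>(1) developing_form_holomorphic, of a b] \<gamma>(3) by (auto simp: o_def)
  define W2 where "W2 = {w \<in> W. developing_form f 0 1 (\<gamma> w) \<noteq> 0}"
  have W2: "open W2" "z2 \<in> W2" "W2 \<subseteq> ?H"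
    using oW[OF W(1) holomorphic_on_subset[OF hg W(3)]] z2 W(3) by (auto simp: W2_def)
  have on: "developing_form f a b (\<gamma> w) = deriv \<gamma> w * developing_form f (a * M$1$1 + b * M$2$1) (a * M$1$2 + b * M$2$2) w"
    if w: "w \<in> W2" for w
  proof -
    have wH: "w \<in> ?H" "\<gamma> w \<in> ?H" using w W2 \<gamma>(3) by auto
    obtain B u v u' v' where l: "w \<in> B" "developing_lift q f B u v u' v'" using developing_lift_exists[OF f wH(1)] .
    obtain D x y x' y' where m: "\<gamma> w \<in> D" "developing_lift q f D x y x' y'" using developing_lift_exists[OF f wH(2)] .
    define k where "k = \<gamma> w"
    have gd: "(\<gamma> has_field_derivative deriv \<gamma> w) (at w)" using holomorphic_derivI[OF \<gamma>(1) H wH(1)] by simp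
    have v0: "v w \<noteq> 0" and y0: "y k \<noteq> 0" using w l m by (auto simp: W2_def W_def developing_lift_def k_def)
    have ud: "(u has_field_derivative u' w) (at w)" "(v has_field_derivative v' w) (at w)" "u w * v' w - v w * u' w = -1"
      using l by (auto simp: developing_lift_def)
    have xd: "(x has_field_derivative x' k) (at (\<gamma> w))" "(y has_field_derivative y' k) (at (\<gamma> w))" "x k * y' k - y k * x' k = -1"
      using m by (auto simp: developing_lift_def k_def)
    have xg: "((\<lambda>w. x (\<gamma> w)) has_field_derivative x' k * deriv \<gamma> w) (at w)"
      "((\<lambda>w. y (\<gamma> w)) has_field_derivative y' k * deriv \<gamma> w) (at w)"
      by (rule DERIV_chain2[OF xd(1) gd] DERIV_chain2[OF xd(2) gd])+
    have cross: "x (\<gamma> t) * (M$2$1 * u t + M$2$2 * v t) = y (\<gamma> t) * (M$1$1 * u t + M$1$2 * v t)"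
      if t: "t \<in> B \<inter> (\<gamma> -` D \<inter> ?H) \<inter> W2" for t
    proof -
      have tv: "v t \<noteq> 0" "y (\<gamma> t) \<noteq> 0" "t \<in> ?H" using t l m W2 by (auto simp: W2_def W_def developing_lift_def)
      have "Some (x (\<gamma> t) / y (\<gamma> t)) = moebius_act M (Some (u t / v t))"
        using eq[OF tv(3)] tv t l m by (auto simp: developing_lift_def)
      then have e: "M$2$1 * (u t / v t) + M$2$2 \<noteq> 0"
        "x (\<gamma> t) / y (\<gamma> t) = (M$1$1 * (u t / v t) + M$1$2) / (M$2$1 * (u t / v t) + M$2$2)"
        by (auto split: if_splits)
      have h: "(M$2$1 * (u t / v t) + M$2$2) * v t = M$2$1 * u t + M$2$2 * v t"
        "(M$1$1 * (u t / v t) + M$1$2) * v t = M$1$1 * u t + M$1$2 * v t"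
        using tv by (simp_all add: distrib_right)
      have "x (\<gamma> t) * (M$2$1 * (u t / v t) + M$2$2) = y (\<gamma> t) * (M$1$1 * (u t / v t) + M$1$2)"
        using e(2) unfolding frac_eq_eq[OF tv(2) e(1)] by (simp only: mult.commute)
      then have "x (\<gamma> t) * ((M$2$1 * (u t / v t) + M$2$2) * v t) = y (\<gamma> t) * ((M$1$1 * (u t / v t) + M$1$2) * v t)"
        by (simp only: mult.assoc[symmetric])
      then show ?thesis unfolding h .
    qed
    have "open (\<gamma> -` D \<inter> ?H)"
      using m holomorphic_on_imp_continuous_on[OF \<gamma>(1)] H
      by (metis Int_commute continuous_open_preimage developing_lift_def)
    then have o: "open (B \<inter> (\<gamma> -` D \<inter> ?H) \<inter> W2)" "w \<in> B \<inter> (\<gamma> -` D \<inter> ?H) \<inter> W2"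
      using l m w wH W2 by (auto simp: developing_lift_def)
    define N1 N2 where "N1 = M$1$1 * u w + M$1$2 * v w" "N2 = M$2$1 * u w + M$2$2 * v w"
    note N = this
    define N1' N2' where "N1' = M$1$1 * u' w + M$1$2 * v' w" "N2' = M$2$1 * u' w + M$2$2 * v' w"
    note N' = this
    have c0: "x k * N2 = y k * N1" using cross[OF o(2)] by (simp add: N k_def)
    have d1: "((\<lambda>t. x (\<gamma> t) * (M$2$1 * u t + M$2$2 * v t)) has_field_derivative x' k * deriv \<gamma> w * N2 + x k * N2') (at w)"
      unfolding N N' k_def[symmetric]
      by (auto intro!: derivative_eq_intros xg ud simp: k_def)
    have d2: "((\<lambda>t. y (\<gamma> t) * (M$1$1 * u t + M$1$2 * v t)) has_field_derivative y' k * deriv \<gamma> w * N1 + y k * N1') (at w)"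
      unfolding N N' k_def[symmetric]
      by (auto intro!: derivative_eq_intros xg ud simp: k_def)
    have "((\<lambda>t. x (\<gamma> t) * (M$2$1 * u t + M$2$2 * v t)) has_field_derivative y' k * deriv \<gamma> w * N1 + y k * N1') (at w)"
      by (rule has_field_derivative_transform_within_open[OF d2 o]) (use cross in simp)
    then have c1: "x' k * deriv \<gamma> w * N2 + x k * N2' = y' k * deriv \<gamma> w * N1 + y k * N1'"
      using DERIV_unique d1 by blast
    have wrN: "N1 * N2' - N2 * N1' = -1"
    proof -
      have "N1 * N2' - N2 * N1' = (M$1$1 * M$2$2 - M$1$2 * M$2$1) * (u w * v' w - v w * u' w)"
        unfolding N N' by (simp add: algebra_simps)
      then show ?thesis using M unfolding det_2 ud(3) by simp
    qed
    have N2y: "y k * y k = deriv \<gamma> w * (N2 * N2)"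
    proof -
      have "(x k * N2) * N2' * y k + deriv \<gamma> w * (x' k * N2 * N2 * y k)
          = N2 * y k * (x' k * deriv \<gamma> w * N2 + x k * N2')" by (simp add: algebra_simps)
      also have "\<dots> = N2 * y k * (y' k * deriv \<gamma> w * N1 + y k * N1')" unfolding c1 ..
      also have "\<dots> = N2 * y' k * deriv \<gamma> w * (y k * N1) + N2 * y k * y k * N1'" by (simp add: algebra_simps)
      also have "\<dots> = N2 * y' k * deriv \<gamma> w * (x k * N2) + N2 * y k * y k * N1'" unfolding c0 ..
      finally have fin: "(x k * N2) * N2' * y k + deriv \<gamma> w * (x' k * N2 * N2 * y k)
          = N2 * y' k * deriv \<gamma> w * (x k * N2) + N2 * y k * y k * N1'" .
      have s1: "(x k * N2) * N2' * y k = y k * y k * (N1 * N2')" unfolding c0 by (simp add: algebra_simps)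
      have "y k * y k * (N1 * N2' - N2 * N1') = deriv \<gamma> w * (N2 * N2) * (x k * y' k - y k * x' k)"
        using fin[unfolded s1] by (simp add: algebra_simps)
      then show ?thesis unfolding wrN xd(3) by simp
    qed
    have N20: "N2 \<noteq> 0"
    proof
      assume "N2 = 0"
      then have "y k * y k = 0" using N2y by simp
      then show False using y0 by simp
    qed
    have xk: "x k = y k * N1 / N2" using c0 N20 by (simp add: field_simps)
    have "developing_form f a b (\<gamma> w) = (a * x k + b * y k)\<^sup>2" using m by (simp add: developing_lift_def k_def)
    also have "\<dots> = (y k * y k) * ((a * N1 + b * N2) / N2)\<^sup>2"
      unfolding xk using N20 by (simp add: power2_eq_square field_simps)
    also have "\<dots> = deriv \<gamma> w * (a * N1 + b * N2)\<^sup>2"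
      unfolding N2y using N20 by (simp add: power2_eq_square field_simps)
    also have "a * N1 + b * N2 = (a * M$1$1 + b * M$2$1) * u w + (a * M$1$2 + b * M$2$2) * v w"
      unfolding N by (simp add: algebra_simps)
    also have "(\<dots>)\<^sup>2 = developing_form f (a * M$1$1 + b * M$2$1) (a * M$1$2 + b * M$2$2) w"
      using l by (simp add: developing_lift_def)
    finally show ?thesis .
  qed
  show ?thesis
  proof (rule analytic_continuation_open[OF W2(1) H _ _ W2(3) hg _ on z])
    show "connected ?H" using convex_upper_half_plane convex_connected by blast
    show "(\<lambda>w. deriv \<gamma> w * developing_form f (a * M$1$1 + b * M$2$1) (a * M$1$2 + b * M$2$2) w) holomorphic_on ?H"
      by (intro holomorphic_intros holomorphic_deriv \<gamma> H developing_form_holomorphic)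
  qed (use W2 in auto)
qed

end

section \<open>Growth along segments\<close>

lemma has_real_derivative_norm_sq:
  fixes g :: "real \<Rightarrow> complex"
  assumes "(g has_vector_derivative g') (at t)"
  shows "((\<lambda>t. (cmod (g t))\<^sup>2) has_real_derivative 2 * (g t \<bullet> g')) (at t)"
proof -
  have "((\<lambda>t. g t \<bullet> g t) has_vector_derivative (g t \<bullet> g' + g' \<bullet> g t)) (at t)"
    by (rule bounded_bilinear.has_vector_derivative[OF bounded_bilinear_inner assms assms])
  then show ?thesis
    by (simp add: has_real_derivative_iff_has_vector_derivative dot_square_norm inner_commute)
qed

lemma has_vector_derivative_along_segment:
  assumes "(F has_field_derivative F') (at (z0 + t *\<^sub>R v))"
  shows "((\<lambda>t. F (z0 + t *\<^sub>R v)) has_vector_derivative v * F') (at t)"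
proof -
  have "((\<lambda>t. z0 + t *\<^sub>R v) has_vector_derivative v) (at t)"
    by (auto intro!: derivative_eq_intros)
  then show ?thesis using field_vector_diff_chain_at[of "\<lambda>t. z0 + t *\<^sub>R v" v t F F'] assms by (simp add: o_def)
qed

text \<open>Gronwall's inequality for the weighted energy \<open>\<bar>Y\<bar>\<^sup>2 + \<bar>Y'\<bar>\<^sup>2 / \<kappa>\<^sup>2 + \<bar>Z\<bar>\<^sup>2 / \<kappa>\<^sup>4\<close> with \<open>Z = Y'' + q Y\<close>. The weights make every term of its
derivative at most a multiple of \<open>\<kappa>\<close> times the energy, so the growth rate is linear in \<open>\<kappa>\<close>, which is the square root of the potential.\<close>

lemma third_order_growth:
  assumes H: "\<And>z. z \<in> S \<Longrightarrow> (Y has_field_derivative Y1 z) (at z)"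
    "\<And>z. z \<in> S \<Longrightarrow> (Y1 has_field_derivative Z z - q z * Y z) (at z)"
    "\<And>z. z \<in> S \<Longrightarrow> (Z has_field_derivative - q z * Y1 z) (at z)"
    and S: "convex S" "z0 \<in> S" "z \<in> S" and \<kappa>: "\<kappa> > 0" "\<And>z. z \<in> S \<Longrightarrow> cmod (q z) \<le> \<kappa>\<^sup>2" and l: "cmod (z - z0) \<le> l"
  shows "(cmod (Y z))\<^sup>2 \<le> exp (4 * l * \<kappa>) * ((cmod (Y z0))\<^sup>2 + (cmod (Y1 z0))\<^sup>2 / \<kappa>\<^sup>2 + (cmod (Z z0))\<^sup>2 / \<kappa> ^ 4)"
proof -
  define v where "v = z - z0"
  define p where "p = (\<lambda>t. z0 + t *\<^sub>R v)"
  have p: "p t \<in> S" if "0 \<le> t" "t \<le> 1" for t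
  proof -
    have "p t = (1 - t) *\<^sub>R z0 + t *\<^sub>R z" by (simp add: p_def v_def algebra_simps)
    then show ?thesis using convexD_alt[OF S(1,2,3) that] by simp
  qed
  have l0: "l \<ge> 0" using l norm_ge_zero order_trans by blast
  define W where "W = (\<lambda>t. (cmod (Y (p t)))\<^sup>2 + (cmod (Y1 (p t)))\<^sup>2 / \<kappa>\<^sup>2 + (cmod (Z (p t)))\<^sup>2 / \<kappa> ^ 4)"
  define W' where "W' = (\<lambda>t. 2 * (Y (p t) \<bullet> (v * Y1 (p t))) + 2 * (Y1 (p t) \<bullet> (v * (Z (p t) - q (p t) * Y (p t)))) / \<kappa>\<^sup>2
      + 2 * (Z (p t) \<bullet> (v * (- q (p t) * Y1 (p t)))) / \<kappa> ^ 4)"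
  have dW: "(W has_real_derivative W' t) (at t)" if t: "0 \<le> t" "t \<le> 1" for t
    unfolding W_def W'_def p_def
    by (intro DERIV_add DERIV_cdivide has_real_derivative_norm_sq has_vector_derivative_along_segment
        H p[OF t, unfolded p_def])
  have W'le: "W' t \<le> 4 * l * \<kappa> * W t" if t: "0 \<le> t" "t \<le> 1" for t
  proof -
    define a b c where "a = cmod (Y (p t))" "b = cmod (Y1 (p t)) / \<kappa>" "c = cmod (Z (p t)) / \<kappa>\<^sup>2"
    have pos: "a \<ge> 0" "b \<ge> 0" "c \<ge> 0" using \<kappa> by (auto simp: a_b_c_def)
    have ab: "cmod (Y (p t)) = a" "cmod (Y1 (p t)) = \<kappa> * b" "cmod (Z (p t)) = \<kappa>\<^sup>2 * c"
      using \<kappa> by (auto simp: a_b_c_def)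
    have Q: "cmod (q (p t)) \<le> \<kappa>\<^sup>2" using \<kappa>(2) p[OF t] by blast
    have vl: "cmod v \<le> l" using l by (simp add: v_def)
    have h1: "Y (p t) \<bullet> (v * Y1 (p t)) \<le> a * (l * (\<kappa> * b))"
    proof -
      have "Y (p t) \<bullet> (v * Y1 (p t)) \<le> cmod (Y (p t)) * cmod (v * Y1 (p t))" by (rule norm_cauchy_schwarz)
      also have "\<dots> \<le> a * (l * (\<kappa> * b))" unfolding norm_mult ab using pos \<kappa> vl l0
        by (intro mult_mono) auto
      finally show ?thesis .
    qed
    have h2: "Y1 (p t) \<bullet> (v * (Z (p t) - q (p t) * Y (p t))) / \<kappa>\<^sup>2 \<le> l * \<kappa> * (b * (c + a))"
    proof -
      have "cmod (Z (p t) - q (p t) * Y (p t)) \<le> \<kappa>\<^sup>2 * c + \<kappa>\<^sup>2 * a"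
        using norm_triangle_ineq4[of "Z (p t)" "q (p t) * Y (p t)"] mult_right_mono[OF Q pos(1)]
        by (simp add: norm_mult ab)
      then have "cmod (v * (Z (p t) - q (p t) * Y (p t))) \<le> l * (\<kappa>\<^sup>2 * (c + a))"
        unfolding norm_mult using vl l0 by (intro mult_mono) (auto simp: algebra_simps)
      then have "cmod (Y1 (p t)) * cmod (v * (Z (p t) - q (p t) * Y (p t))) \<le> (\<kappa> * b) * (l * (\<kappa>\<^sup>2 * (c + a)))"
        unfolding ab using pos \<kappa> by (intro mult_left_mono) auto
      then have "Y1 (p t) \<bullet> (v * (Z (p t) - q (p t) * Y (p t))) \<le> (\<kappa> * b) * (l * (\<kappa>\<^sup>2 * (c + a)))"
        using norm_cauchy_schwarz order_trans by blast
      then have "Y1 (p t) \<bullet> (v * (Z (p t) - q (p t) * Y (p t))) / \<kappa>\<^sup>2 \<le> (\<kappa> * b) * (l * (\<kappa>\<^sup>2 * (c + a))) / \<kappa>\<^sup>2"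
        by (intro divide_right_mono) auto
      also have "\<dots> = l * \<kappa> * (b * (c + a))" using \<kappa> by simp
      finally show ?thesis .
    qed
    have h3: "Z (p t) \<bullet> (v * (- q (p t) * Y1 (p t))) / \<kappa> ^ 4 \<le> l * \<kappa> * (c * b)"
    proof -
      have "cmod (v * (- q (p t) * Y1 (p t))) \<le> l * (\<kappa>\<^sup>2 * (\<kappa> * b))"
        unfolding norm_mult norm_minus_cancel ab using vl l0 Q pos \<kappa> by (intro mult_mono) auto
      then have "cmod (Z (p t)) * cmod (v * (- q (p t) * Y1 (p t))) \<le> (\<kappa>\<^sup>2 * c) * (l * (\<kappa>\<^sup>2 * (\<kappa> * b)))"
        unfolding ab using pos by (intro mult_left_mono) auto
      then have "Z (p t) \<bullet> (v * (- q (p t) * Y1 (p t))) \<le> (\<kappa>\<^sup>2 * c) * (l * (\<kappa>\<^sup>2 * (\<kappa> * b)))"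
        using norm_cauchy_schwarz order_trans by blast
      then have "Z (p t) \<bullet> (v * (- q (p t) * Y1 (p t))) / \<kappa> ^ 4 \<le> (\<kappa>\<^sup>2 * c) * (l * (\<kappa>\<^sup>2 * (\<kappa> * b))) / \<kappa> ^ 4"
        using \<kappa> by (intro divide_right_mono) auto
      also have "\<dots> = l * \<kappa> * (c * b)" using \<kappa> by (simp add: power2_eq_square power4_eq_xxxx)
      finally show ?thesis .
    qed
    have "W' t \<le> 2 * (a * (l * (\<kappa> * b))) + 2 * (l * \<kappa> * (b * (c + a))) + 2 * (l * \<kappa> * (c * b))"
      using h1 h2 h3 unfolding W'_def times_divide_eq_right[symmetric] by linarith
    also have "\<dots> = l * \<kappa> * (4 * (a * b) + 4 * (b * c))" by (simp add: algebra_simps)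
    finally have "W' t \<le> l * \<kappa> * (4 * (a * b) + 4 * (b * c))" .
    also have "\<dots> \<le> l * \<kappa> * (4 * (a\<^sup>2 + b\<^sup>2 + c\<^sup>2))"
    proof (rule mult_left_mono)
      have "0 \<le> (a - b)\<^sup>2 + (b - c)\<^sup>2 + a\<^sup>2 + c\<^sup>2" by simp
      then show "4 * (a * b) + 4 * (b * c) \<le> 4 * (a\<^sup>2 + b\<^sup>2 + c\<^sup>2)"
        by (simp add: power2_eq_square algebra_simps)
    qed (use l0 \<kappa> in auto)
    also have "a\<^sup>2 + b\<^sup>2 + c\<^sup>2 = W t" by (simp add: W_def a_b_c_def power_divide flip: power_mult)
    finally show ?thesis by (simp add: algebra_simps)
  qed
  define V where "V = (\<lambda>t. W t * exp (- (4 * l * \<kappa>) * t))"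
  have "V 1 \<le> V 0"
  proof (rule DERIV_nonpos_imp_nonincreasing[of 0 1])
    fix t :: real assume t: "0 \<le> t" "t \<le> 1"
    have "(V has_real_derivative (W' t - 4 * l * \<kappa> * W t) * exp (- (4 * l * \<kappa>) * t)) (at t)"
      unfolding V_def by (auto intro!: derivative_eq_intros dW t simp: algebra_simps)
    moreover have "(W' t - 4 * l * \<kappa> * W t) * exp (- (4 * l * \<kappa>) * t) \<le> 0"
      using W'le[OF t] by (intro mult_nonpos_nonneg) auto
    ultimately show "\<exists>y. (V has_real_derivative y) (at t) \<and> y \<le> 0" by blast
  qed simp
  then have "W 1 * exp (- (4 * l * \<kappa>)) \<le> W 0" by (simp add: V_def)
  then have "W 1 \<le> exp (4 * l * \<kappa>) * W 0" by (simp add: exp_minus field_simps)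
  moreover have "(cmod (Y z))\<^sup>2 \<le> W 1" using \<kappa> by (simp add: W_def p_def v_def)
  ultimately show ?thesis by (simp add: W_def p_def)
qed

section \<open>The deck group of a uniformization\<close>

lemma covering_space_embedding:
  assumes cov: "covering_space c p S" and e: "homeomorphism S T e e'"
  shows "covering_space c (e \<circ> p) T"
proof
  show "continuous_on c (e \<circ> p)" "(e \<circ> p) ` c = T"
    using cov e continuous_on_compose[of c p e] by (auto simp: covering_space_def homeomorphism_def)
  fix x assume x: "x \<in> T"
  then have "e' x \<in> S" using e by (auto simp: homeomorphism_def)
  then obtain W v where W: "e' x \<in> W" "openin (top_of_set S) W" "\<Union>v = c \<inter> p -` W"
    "\<forall>u\<in>v. openin (top_of_set c) u" "pairwise disjnt v" "\<forall>u\<in>v. \<exists>q. homeomorphism u W p q"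
    using cov unfolding covering_space_def by meson
  have WS: "W \<subseteq> S" using W(2) openin_imp_subset by blast
  have hW: "homeomorphism W (e ` W) e e'"
    using e WS by (rule homeomorphism_of_subsets) auto
  have "e ` W = T \<inter> e' -` W" using e WS x by (force simp: homeomorphism_def)
  then have o: "openin (top_of_set T) (e ` W)"
    using continuous_openin_preimage_gen e W(2)
    by (metis continuous_openin_preimage homeomorphism_def image_subset_iff_funcset order_refl)
  have xe: "x \<in> e ` W" using W(1) e x by (auto simp: homeomorphism_def intro!: image_eqI[of _ _ "e' x"])
  have inj: "inj_on e S" using e by (metis homeomorphism_def inj_on_inverseI)
  have v: "\<Union>v = c \<inter> (e \<circ> p) -` (e ` W)"
  proof -
    have "p z \<in> W \<longleftrightarrow> e (p z) \<in> e ` W" if "z \<in> c" for z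
    proof -
      have "p z \<in> S" using cov that by (auto simp: covering_space_def)
      then show ?thesis using inj_on_image_mem_iff[OF inj _ WS] by blast
    qed
    then show ?thesis using W(3) by auto
  qed
  have "\<exists>q. homeomorphism u (e ` W) (e \<circ> p) q" if "u \<in> v" for u
    using W(6) that homeomorphism_compose[OF _ hW] by blast
  then show "\<exists>T'. x \<in> T' \<and> openin (top_of_set T) T' \<and>
          (\<exists>v. \<Union>v = c \<inter> (e \<circ> p) -` T' \<and> (\<forall>u\<in>v. openin (top_of_set c) u) \<and>
               pairwise disjnt v \<and> (\<forall>u\<in>v. \<exists>q. homeomorphism u T' (e \<circ> p) q))"
    using xe o v W(4,5) by blast
qed

lemma compact_inj_homeomorphism:
  fixes S :: "'a::topological_space set" and e :: "'a \<Rightarrow> 'b::t2_space"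
  assumes "compact S" "continuous_on S e" "inj_on e S"
  obtains e' where "homeomorphism S (e ` S) e e'"
  using homeomorphism_compact[OF assms(1,2) refl assms(3)] by blast

lemma chart_facts:
  assumes A: "complex_atlas X A" and c: "c \<in> A"
  shows "openin (top_of_set X) (fst c)" "open (snd c ` fst c)"
    "continuous_on (fst c) (snd c)" "continuous_on (snd c ` fst c) (chart_inv c)"
    "\<And>x. x \<in> fst c \<Longrightarrow> chart_inv c (snd c x) = x"
    "\<And>w. w \<in> snd c ` fst c \<Longrightarrow> snd c (chart_inv c w) = w"
    "chart_inv c ` (snd c ` fst c) = fst c" "fst c \<subseteq> X" "inj_on (snd c) (fst c)"
proof -
  have ch: "complex_chart X c" using A c by (simp add: complex_atlas_def)
  then have h: "homeomorphism (fst c) (snd c ` fst c) (snd c) (chart_inv c)" by (simp add: complex_chart_def)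
  show "openin (top_of_set X) (fst c)" "open (snd c ` fst c)" using ch by (auto simp: complex_chart_def)
  then show "fst c \<subseteq> X" using openin_imp_subset by blast
  show "continuous_on (fst c) (snd c)" "continuous_on (snd c ` fst c) (chart_inv c)"
    "chart_inv c ` (snd c ` fst c) = fst c" using h by (auto simp: homeomorphism_def)
  show "\<And>x. x \<in> fst c \<Longrightarrow> chart_inv c (snd c x) = x" using h by (auto simp: homeomorphism_def)
  then show "inj_on (snd c) (fst c)" by (rule inj_on_inverseI)
  show "\<And>w. w \<in> snd c ` fst c \<Longrightarrow> snd c (chart_inv c w) = w" using h by (auto simp: homeomorphism_def)
qed

lemma openin_chart_preimage:
  assumes A: "complex_atlas X A" and c: "c \<in> A" and V: "open V"
  shows "openin (top_of_set X) {x \<in> fst c. snd c x \<in> V}"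
proof -
  have "openin (top_of_set (fst c)) (fst c \<inter> snd c -` V)"
    using chart_facts(3)[OF A c] V by (rule continuous_openin_preimage_gen)
  moreover have "fst c \<inter> snd c -` V = {x \<in> fst c. snd c x \<in> V}" by auto
  ultimately show ?thesis using chart_facts(1)[OF A c] openin_trans by fastforce
qed

text \<open>The support of \<open>k\<close> pulled back by the chart is compact, hence closed in \<open>X\<close>; so the two formulas agree on the overlap of two sets open in \<open>X\<close>.\<close>

lemma continuous_on_extend_zero:
  fixes X :: "'a::t2_space set" and h :: "'a \<Rightarrow> 'b::real_normed_vector"
  assumes A: "complex_atlas X A" and c: "c \<in> A" and cb: "cball w r \<subseteq> snd c ` fst c"
    and k: "continuous_on UNIV k" "\<And>v. v \<notin> cball w r \<Longrightarrow> k v = 0"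
  shows "continuous_on X (\<lambda>x. if x \<in> fst c then k (snd c x) else (0 :: 'b))"
proof -
  define N where "N = chart_inv c ` cball w r"
  note cf = chart_facts[OF A c]
  have NS: "N \<subseteq> fst c" using image_mono[OF cb, of "chart_inv c"] cf(7) by (simp add: N_def)
  have "compact N" unfolding N_def using cf(4) cb
    by (intro compact_continuous_image continuous_on_subset[OF cf(4)]) auto
  then have "closed N" by (rule compact_imp_closed)
  have z: "k (snd c x) = 0" if "x \<in> fst c" "x \<notin> N" for x
  proof (rule k(2))
    show "snd c x \<notin> cball w r" using that cf(5) by (force simp: N_def)
  qed
  define T where "T = X - N"
  have T: "openin (top_of_set X) T" unfolding T_def using \<open>closed N\<close>
    by (metis openin_diff openin_subtopology_self closedin_closed_Int Diff_Int2 Int_absorb Diff_Int_distrib2 Int_commute)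
  have XU: "X = fst c \<union> T" using cf(8) NS by (auto simp: T_def)
  show ?thesis
  proof (subst XU, rule continuous_on_cases_local_open)
    show "openin (top_of_set (fst c \<union> T)) (fst c)" "openin (top_of_set (fst c \<union> T)) T"
      using T cf(1) XU by auto
    show "continuous_on (fst c) (\<lambda>x. k (snd c x))"
      using k(1) cf(3) by (rule continuous_on_compose2) auto
    show "continuous_on T (\<lambda>_. 0 :: 'b)" by simp
    fix x assume "x \<in> fst c \<and> \<not> x \<in> fst c \<or> x \<in> T \<and> x \<in> fst c"
    then show "k (snd c x) = 0" using z by (auto simp: T_def)
  qed
qed


lemma finite_chart_cover:
  assumes X: "compact X" and A: "complex_atlas X A"
  obtains J where "finite J" "\<And>c w r. (c, w, r) \<in> J \<Longrightarrow> c \<in> A \<and> cball w r \<subseteq> snd c ` fst c"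
    "\<And>x. x \<in> X \<Longrightarrow> \<exists>c w r. (c, w, r) \<in> J \<and> x \<in> fst c \<and> snd c x \<in> ball w r"
proof -
  define P where "P = {(c, w, r). c \<in> A \<and> cball w r \<subseteq> snd c ` fst c}"
  define N where "N = (\<lambda>(c :: 'a chart, w, r). {x \<in> fst c. snd c x \<in> ball w r})"
  have "\<forall>T\<in>N ` P. openin (top_of_set X) T"
    using openin_chart_preimage[OF A _ open_ball] by (auto simp: N_def P_def)
  moreover have "X \<subseteq> \<Union> (N ` P)"
  proof
    fix x assume x: "x \<in> X"
    then obtain c where c: "c \<in> A" "x \<in> fst c" using A by (auto simp: complex_atlas_def)
    then obtain r where r: "r > 0" "cball (snd c x) r \<subseteq> snd c ` fst c"
      using chart_facts(2)[OF A c(1)] open_contains_cball by blast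
    then have "(c, snd c x, r) \<in> P" "x \<in> N (c, snd c x, r)" using c by (auto simp: P_def N_def)
    then show "x \<in> \<Union> (N ` P)" by blast
  qed
  ultimately obtain D where D: "D \<subseteq> N ` P" "finite D" "X \<subseteq> \<Union>D"
    using X unfolding compact_eq_openin_cover by meson
  then obtain J where J: "J \<subseteq> P" "finite J" "D = N ` J" using finite_subset_image by metis
  show ?thesis
  proof (rule that[OF J(2)])
    show "c \<in> A \<and> cball w r \<subseteq> snd c ` fst c" if "(c, w, r) \<in> J" for c w r using J(1) that by (auto simp: P_def)
    show "\<exists>c w r. (c, w, r) \<in> J \<and> x \<in> fst c \<and> snd c x \<in> ball w r" if x: "x \<in> X" for x
    proof -
      obtain t where t: "t \<in> J" "x \<in> N t" using D(3) J(3) x by blast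
      obtain c w r where "t = (c, w, r)" by (cases t)
      then show ?thesis using t by (intro exI[of _ c] exI[of _ w] exI[of _ r]) (simp add: N_def)
    qed
  qed
qed

text \<open>Finitely many continuous functions that separate points are the components of an injective continuous map, which on a compact space is a homeomorphism onto
its image. Padding with zeros puts all finite numbers of components into one space, the bounded sequences.\<close>

lemma separating_functions_embedding:
  fixes X :: "'a::t2_space set" and k :: "nat \<Rightarrow> 'a \<Rightarrow> 'b::real_normed_vector"
  assumes X: "compact X" and k: "\<And>m. m < N \<Longrightarrow> continuous_on X (k m)"
    and sep: "\<And>x y. x \<in> X \<Longrightarrow> y \<in> X \<Longrightarrow> (\<And>m. m < N \<Longrightarrow> k m x = k m y) \<Longrightarrow> x = y"
  obtains e :: "'a \<Rightarrow> nat \<Rightarrow>\<^sub>C 'b" and e' where "homeomorphism X (e ` X) e e'"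
proof -
  define e where "e = (\<lambda>x. Bcontfun (\<lambda>m. if m < N then k m x else 0))"
  have b: "(\<lambda>m. if m < N then k m x else 0) \<in> bcontfun" for x
  proof (rule bcontfun_normI)
    show "continuous_on UNIV (\<lambda>m. if m < N then k m x else 0)" 
      unfolding continuous_on_open_vimage[OF open_UNIV] by (simp add: open_discrete)
    show "norm (if m < N then k m x else 0) \<le> (\<Sum>m<N. norm (k m x))" for m
      by (auto intro!: member_le_sum sum_nonneg)
  qed
  have ap: "apply_bcontfun (e x) m = (if m < N then k m x else 0)" for x m
    unfolding e_def using b by (simp add: Bcontfun_inverse)
  have "continuous_on X e"
    unfolding continuous_on_def
  proof
    fix x assume x: "x \<in> X"
    have le: "dist (e y) (e x) \<le> (\<Sum>m<N. dist (k m y) (k m x))" for y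
      by (rule dist_bound) (auto simp: ap intro!: member_le_sum sum_nonneg)
    have "((\<lambda>y. \<Sum>m<N. dist (k m y) (k m x)) \<longlongrightarrow> (\<Sum>m<N. dist (k m x) (k m x))) (at x within X)"
      using k x by (intro tendsto_sum tendsto_dist tendsto_const) (auto simp: continuous_on_def)
    then have "((\<lambda>y. \<Sum>m<N. dist (k m y) (k m x)) \<longlongrightarrow> 0) (at x within X)" by simp
    then have "((\<lambda>y. dist (e y) (e x)) \<longlongrightarrow> 0) (at x within X)"
      by (rule tendsto_sandwich[OF _ _ tendsto_const, rotated 2]) (use le in auto)
    then show "(e \<longlongrightarrow> e x) (at x within X)" using tendsto_dist_iff by blast
  qed
  moreover have "inj_on e X"
  proof (rule inj_onI)
    fix x y assume xy: "x \<in> X" "y \<in> X" "e x = e y"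
    show "x = y"
    proof (rule sep[OF xy(1,2)])
      fix m assume "m < N"
      then show "k m x = k m y" using ap[of x m] ap[of y m] xy(3) by simp
    qed
  qed
  ultimately show ?thesis using compact_inj_homeomorphism[OF X] that by blast
qed

text \<open>A bump function supported in a chart, together with its product with the coordinate, separates the points of its support from all other points; finitely many of
these pairs suffice. The embedding makes lifting theorems for maps into normed spaces applicable to the surface.\<close>

lemma surface_embedding:
  fixes X :: "'a::t2_space set"
  assumes X: "compact X" and A: "complex_atlas X A"
  obtains e :: "'a \<Rightarrow> nat \<Rightarrow>\<^sub>C (complex \<times> complex)" and e' where "homeomorphism X (e ` X) e e'"
proof -
  obtain J where J: "finite J" "\<And>c w r. (c, w, r) \<in> J \<Longrightarrow> c \<in> A \<and> cball w r \<subseteq> snd c ` fst c"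
    "\<And>x. x \<in> X \<Longrightarrow> \<exists>c w r. (c, w, r) \<in> J \<and> x \<in> fst c \<and> snd c x \<in> ball w r"
    using finite_chart_cover[OF X A] by metis
  obtain js where js: "set js = J" using finite_list[OF J(1)] by blast
  define bump where "bump = (\<lambda>w r v. (complex_of_real (max 0 (r - cmod (v - w))), of_real (max 0 (r - cmod (v - w))) * v))"
  define k where "k = (\<lambda>m (x::'a). case js ! m of (c, w, r) \<Rightarrow> if x \<in> fst c then bump w r (snd c x) else 0)"
  have kc: "continuous_on X (k m)" if m: "m < length js" for m
  proof -
    obtain c w r where t: "js ! m = (c, w, r)" by (cases "js ! m") auto
    then have "(c, w, r) \<in> J" using m js by (metis nth_mem)
    then have c: "c \<in> A" "cball w r \<subseteq> snd c ` fst c" using J(2) by auto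
    have "continuous_on X (\<lambda>x. if x \<in> fst c then bump w r (snd c x) else 0)"
    proof (rule continuous_on_extend_zero[OF A c])
      show "continuous_on UNIV (bump w r)" unfolding bump_def by (intro continuous_intros)
      show "bump w r v = 0" if "v \<notin> cball w r" for v
        using that by (simp add: bump_def dist_norm norm_minus_commute zero_prod_def)
    qed
    then show ?thesis by (simp add: k_def t)
  qed
  show ?thesis
  proof (rule separating_functions_embedding[OF X kc])
    fix x y assume xy: "x \<in> X" "y \<in> X" and eq: "\<And>m. m < length js \<Longrightarrow> k m x = k m y"
    obtain c w r where t: "(c, w, r) \<in> J" "x \<in> fst c" "snd c x \<in> ball w r" using J(3)[OF xy(1)] by blast
    then obtain m where m: "m < length js" "js ! m = (c, w, r)" using js by (metis in_set_conv_nth)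
    have pos: "r - cmod (snd c x - w) > 0" using t by (simp add: dist_norm norm_minus_commute)
    have "k m x = bump w r (snd c x)" using t m by (simp add: k_def)
    moreover have "bump w r (snd c x) \<noteq> 0" using pos by (simp add: bump_def zero_prod_def)
    ultimately have y: "y \<in> fst c" "bump w r (snd c x) = bump w r (snd c y)"
      using eq[OF m(1)] m by (auto simp: k_def split: if_splits)
    have e1: "max 0 (r - cmod (snd c x - w)) = max 0 (r - cmod (snd c y - w))"
      and e2: "of_real (max 0 (r - cmod (snd c x - w))) * snd c x = of_real (max 0 (r - cmod (snd c y - w))) * snd c y"
      using y(2) unfolding bump_def prod.inject of_real_eq_iff by blast+
    have "snd c x = snd c y" using e2 pos unfolding e1[symmetric] by simp
    then show "x = y" using chart_facts(9)[OF A] J(2) t y(1) by (metis inj_onD)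
  qed (assumption | erule that)+
qed


locale uniformized =
  fixes X :: "'a::t2_space set" and A :: "'a chart set" and p :: "complex \<Rightarrow> 'a"
  assumes X: "compact_riemann_surface X A" and p: "uniformization X A p"
begin

abbreviation "H \<equiv> upper_half_plane"

lemma X_compact: "compact X" and X_atlas: "complex_atlas X A" and X_nonempty: "X \<noteq> {}"
  using X by (auto simp: compact_riemann_surface_def)

lemma cov: "covering_space H p X"
  and p_chart: "\<And>c. c \<in> A \<Longrightarrow> (snd c \<circ> p) holomorphic_on {\<tau> \<in> H. p \<tau> \<in> fst c}"
  using p by (auto simp: uniformization_def)

lemma p_in: "z \<in> H \<Longrightarrow> p z \<in> X" and p_cont: "continuous_on H p" and p_surj: "p ` H = X"
  using cov by (auto simp: covering_space_def)

text \<open>A covering map is open because it is a local homeomorphism.\<close>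

lemma p_open: assumes V: "open V" "V \<subseteq> H" shows "openin (top_of_set X) (p ` V)"
proof (subst openin_subopen, intro ballI)
  fix y assume "y \<in> p ` V"
  then obtain z where z: "z \<in> V" "y = p z" by blast
  have zH: "z \<in> H" using z V by blast
  obtain T u q where T: "z \<in> T" "openin (top_of_set H) T" "p z \<in> u" "openin (top_of_set X) u" "homeomorphism T u p q"
    using covering_space_local_homeomorphism[OF cov zH] .
  have "openin (top_of_set T) (V \<inter> T)" using V(1) by (simp add: Int_commute openin_open_Int)
  then have "openin (top_of_set u) (p ` (V \<inter> T))" using homeomorphism_imp_open_map[OF T(5)] by blast
  then have "openin (top_of_set X) (p ` (V \<inter> T))" using T(4) openin_trans by blast
  then show "\<exists>T. openin (top_of_set X) T \<and> y \<in> T \<and> T \<subseteq> p ` V" using z T(1) by blast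
qed

lemma open_chart_domain: assumes "c \<in> A" shows "open {\<tau> \<in> H. p \<tau> \<in> fst c}"
proof -
  have "openin (top_of_set H) (H \<inter> p -` fst c)"
    using continuous_openin_preimage[OF p_cont _ chart_facts(1)[OF X_atlas assms]] p_in by auto
  moreover have "H \<inter> p -` fst c = {\<tau> \<in> H. p \<tau> \<in> fst c}" by auto
  ultimately show ?thesis using open_upper_half_plane openin_open_eq by auto
qed

lemma local_chart:
  assumes z: "z \<in> H"
  obtains c T where "c \<in> A" "open T" "z \<in> T" "T \<subseteq> {\<tau> \<in> H. p \<tau> \<in> fst c}" "inj_on p T" "inj_on (snd c \<circ> p) T"
    "(snd c \<circ> p) holomorphic_on T"
proof -
  obtain c where c: "c \<in> A" "p z \<in> fst c" using p_in[OF z] X_atlas by (auto simp: complex_atlas_def)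
  obtain T u q where T0: "z \<in> T" "openin (top_of_set H) T" "p z \<in> u" "openin (top_of_set X) u" "homeomorphism T u p q"
    using covering_space_local_homeomorphism[OF cov z] .
  note T = T0(1,2,5)
  define T' where "T' = T \<inter> {\<tau> \<in> H. p \<tau> \<in> fst c}"
  have "open T" using T(2) open_upper_half_plane openin_open_eq by blast
  then have o: "open T'" using open_chart_domain[OF c(1)] by (auto simp: T'_def)
  have "q (p x) = x" if "x \<in> T" for x using T(3) that by (simp add: homeomorphism_def)
  then have "inj_on p T" by (rule inj_on_inverseI)
  then have i: "inj_on p T'" by (rule inj_on_subset) (simp add: T'_def)
  have ic: "inj_on (snd c \<circ> p) T'"
    using chart_facts(9)[OF X_atlas c(1)] i by (intro comp_inj_on inj_on_subset[OF chart_facts(9)[OF X_atlas c(1)]]) (auto simp: T'_def)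
  have "(snd c \<circ> p) holomorphic_on T'" using p_chart[OF c(1)] by (rule holomorphic_on_subset) (auto simp: T'_def)
  then show ?thesis using that[OF c(1) o _ _ i ic] T(1) c z by (auto simp: T'_def)
qed

text \<open>The half-plane is simply connected, so the covering map itself lifts through the covering.\<close>

lemma deck_lift:
  assumes z: "z \<in> H" "w \<in> H" "p z = p w"
  obtains g where "continuous_on H g" "g \<in> H \<rightarrow> H" "g z = w" "\<forall>y\<in>H. p (g y) = p y"
proof -
  obtain e :: "'a \<Rightarrow> nat \<Rightarrow>\<^sub>C (complex \<times> complex)" and e' where e: "homeomorphism X (e ` X) e e'"
    using surface_embedding[OF X_compact X_atlas] by blast
  have cov': "covering_space H (e \<circ> p) (e ` X)" by (rule covering_space_embedding[OF cov e])
  obtain g where g: "continuous_on H g" "g \<in> H \<rightarrow> H" "g z = w" "\<And>y. y \<in> H \<Longrightarrow> (e \<circ> p) (g y) = (e \<circ> p) y"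
  proof (rule covering_space_lift_strong[OF cov' z(2,1), of "e \<circ> p"])
    show "simply_connected H" by (rule convex_imp_simply_connected[OF convex_upper_half_plane])
    show "locally path_connected H" by (rule open_imp_locally_path_connected[OF open_upper_half_plane])
    show "continuous_on H (e \<circ> p)" "e \<circ> p \<in> H \<rightarrow> e ` X" using cov' by (auto simp: covering_space_def)
    show "(e \<circ> p) z = (e \<circ> p) w" using z(3) by simp
  qed (use that in blast)
  have "p (g y) = p y" if "y \<in> H" for y
  proof -
    have "g y \<in> H" using g(2) that by blast
    then have "e' (e (p (g y))) = p (g y)" "e' (e (p y)) = p y" using e p_in that by (auto simp: homeomorphism_def)
    then show ?thesis using arg_cong[OF g(4)[OF that], of e'] by (simp only: o_apply)
  qed
  then have "\<forall>y\<in>H. p (g y) = p y" by blast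
  then show ?thesis by (rule that[OF g(1-3)])
qed

lemma deck_elem:
  assumes "\<gamma> \<in> carrier (deck_group p)"
  shows "bij_betw \<gamma> H H" "continuous_on H \<gamma>" "\<And>z. z \<in> H \<Longrightarrow> p (\<gamma> z) = p z" "\<And>z. z \<in> H \<Longrightarrow> \<gamma> z \<in> H"
proof -
  show "bij_betw \<gamma> H H" "\<And>z. z \<in> H \<Longrightarrow> p (\<gamma> z) = p z"
    using assms by (auto simp: deck_group_def Bij_def)
  then show "\<And>z. z \<in> H \<Longrightarrow> \<gamma> z \<in> H" by (auto simp: bij_betw_def)
  have "homeomorphic_map (top_of_set H) (top_of_set H) \<gamma>" using assms by (simp add: deck_group_def)
  then have "continuous_map (top_of_set H) (top_of_set H) \<gamma>" by (rule homeomorphic_imp_continuous_map)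
  then show "continuous_on H \<gamma>" by (simp add: continuous_map_in_subtopology)
qed

text \<open>Lift \<open>p\<close> through itself so that \<open>z\<close> goes to \<open>w\<close>, and so that \<open>w\<close> goes to \<open>z\<close>. Both composites lift \<open>p\<close> and fix a point, so by
uniqueness they are the identity.\<close>

lemma deck_transitive:
  assumes z: "z \<in> H" "w \<in> H" "p z = p w"
  obtains \<gamma> where "\<gamma> \<in> carrier (deck_group p)" "\<gamma> z = w"
proof -
  obtain g where g0: "continuous_on H g" "g \<in> H \<rightarrow> H" "g z = w" "\<forall>y\<in>H. p (g y) = p y"
    using deck_lift[OF z] .
  obtain h where h0: "continuous_on H h" "h \<in> H \<rightarrow> H" "h w = z" "\<forall>y\<in>H. p (h y) = p y"
    using deck_lift[OF z(2,1) z(3)[symmetric]] .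
  note g = g0(1-3) g0(4)[rule_format] and h = h0(1-3) h0(4)[rule_format]
  have conn: "connected H" by (rule convex_connected[OF convex_upper_half_plane])
  have id: "k (l y) = y" if "continuous_on H k" "k \<in> H \<rightarrow> H" "\<And>y. y \<in> H \<Longrightarrow> p (k y) = p y"
    "continuous_on H l" "l \<in> H \<rightarrow> H" "\<And>y. y \<in> H \<Longrightarrow> p (l y) = p y" "k (l a) = a" "a \<in> H" "y \<in> H" for k l a y
  proof -
    have "(k \<circ> l) y = (\<lambda>x. x) y"
    proof (rule covering_space_lift_unique[OF cov, of "k \<circ> l" a "\<lambda>x. x" H p])
      show "continuous_on H (k \<circ> l)"
        using that(1,4,5) by (intro continuous_on_compose) (auto intro: continuous_on_subset)
      show "k \<circ> l \<in> H \<rightarrow> H" using that(2,5) by auto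
      show "p x = p ((k \<circ> l) x)" if "x \<in> H" for x
        using \<open>\<And>y. y \<in> H \<Longrightarrow> p (k y) = p y\<close>[of "l x"] \<open>\<And>y. y \<in> H \<Longrightarrow> p (l y) = p y\<close>[OF that]
          funcset_mem[OF \<open>l \<in> H \<rightarrow> H\<close> that]
        by simp
    qed (use that conn p_cont p_in in \<open>auto simp: continuous_on_id\<close>)
    then show ?thesis by simp
  qed
  have gh: "h (g y) = y" "g (h y) = y" if "y \<in> H" for y
    using id[OF h(1,2,4) g(1,2,4) _ z(1) that] id[OF g(1,2,4) h(1,2,4) _ z(2) that] g(3) h(3) by auto
  define \<gamma> where "\<gamma> = restrict g H"
  have eq: "\<gamma> y = g y" if "y \<in> H" for y using that by (simp add: \<gamma>_def)
  have gH: "g y \<in> H" and hH: "h y \<in> H" if "y \<in> H" for y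
    using funcset_mem[OF g(2) that] funcset_mem[OF h(2) that] by auto
  have "bij_betw \<gamma> H H"
    by (rule bij_betwI[of _ _ _ h]) (use gH hH gh eq in auto)
  then have "\<gamma> \<in> Bij H" by (simp add: Bij_def \<gamma>_def)
  moreover have "homeomorphic_map (top_of_set H) (top_of_set H) \<gamma>"
  proof -
    have "homeomorphic_maps (top_of_set H) (top_of_set H) \<gamma> h"
      unfolding homeomorphic_maps_def using g(1) h(1) gH hH gh eq
      by (auto simp: continuous_map_in_subtopology cong: continuous_on_cong)
    then show ?thesis using homeomorphic_map_maps by blast
  qed
  moreover have "\<forall>y\<in>H. p (\<gamma> y) = p y" using g(4) eq by simp
  ultimately have "\<gamma> \<in> carrier (deck_group p)" by (simp add: deck_group_def)
  moreover have "\<gamma> z = w" using eq z g(3) by simp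
  ultimately show ?thesis using that by blast
qed

text \<open>Near each point \<open>\<gamma>\<close> is a coordinate of the surface followed by a local inverse of the same coordinate, both holomorphic on the half-plane.\<close>

lemma deck_holomorphic:
  assumes \<gamma>: "\<gamma> \<in> carrier (deck_group p)"
  shows "\<gamma> holomorphic_on H"
proof -
  have "\<exists>g'. (\<gamma> has_field_derivative g') (at z)" if z: "z \<in> H" for z
  proof -
    note d = deck_elem[OF \<gamma>]
    obtain c T where c: "c \<in> A" "open T" "\<gamma> z \<in> T" "T \<subseteq> {\<tau> \<in> H. p \<tau> \<in> fst c}" "inj_on p T" "inj_on (snd c \<circ> p) T"
      "(snd c \<circ> p) holomorphic_on T" using local_chart[OF d(4)[OF z]] by blast
    define k where "k = snd c \<circ> p"
    obtain h where h: "h holomorphic_on k ` T" "\<And>w. w \<in> T \<Longrightarrow> h (k w) = w"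
      using holomorphic_has_inverse[OF c(7,2,6)] unfolding k_def by metis
    have kT: "open (k ` T)" unfolding k_def using open_mapping_thm3[OF c(7,2,6)] .
    define B where "B = H \<inter> \<gamma> -` T"
    have B: "open B" unfolding B_def using d(2) open_upper_half_plane c(2) by (rule continuous_open_preimage)
    have zB: "z \<in> B" using z c(3) by (simp add: B_def)
    have kk: "k (\<gamma> w) = k w" if "w \<in> B" for w using d(3) that by (simp add: k_def B_def)
    have Bdom: "B \<subseteq> {\<tau> \<in> H. p \<tau> \<in> fst c}"
    proof
      fix w assume w: "w \<in> B"
      then have "p (\<gamma> w) \<in> fst c" "w \<in> H" using c(4) by (auto simp: B_def)
      then show "w \<in> {\<tau> \<in> H. p \<tau> \<in> fst c}" using d(3) by simp
    qed
    have kB: "k holomorphic_on B" unfolding k_def using p_chart[OF c(1)] Bdom holomorphic_on_subset by blast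
    have kim: "k ` B \<subseteq> k ` T" using kk by (auto simp: B_def intro!: image_eqI[of _ _ "\<gamma> _"])
    have "(h \<circ> k) holomorphic_on B" using holomorphic_on_compose_gen[OF kB h(1)] kim by auto
    moreover have "(h \<circ> k) w = \<gamma> w" if "w \<in> B" for w
      using kk[OF that] h(2)[of "\<gamma> w"] that by (simp add: B_def)
    ultimately have "\<gamma> holomorphic_on B" using holomorphic_transform by blast
    then show ?thesis using B zB holomorphic_on_open by blast
  qed
  then show ?thesis using holomorphic_on_open[OF open_upper_half_plane] by blast
qed

end

text \<open>The biholomorphic map from the unit disc to the half-plane that sends 0 to \<open>z\<close>; the boundary point 1 goes to infinity.\<close>

definition disc_to_half :: "complex \<Rightarrow> complex \<Rightarrow> complex" where
  "disc_to_half z w = (z - cnj z * w) / (1 - w)"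

lemma Im_disc_to_half:
  assumes "cmod w < 1"
  shows "Im (disc_to_half z w) = Im z * (1 - (cmod w)\<^sup>2) / (cmod (1 - w))\<^sup>2"
proof -
  have w1: "1 - w \<noteq> 0" using assms by auto
  have "disc_to_half z w = (z - cnj z * w) * cnj (1 - w) / of_real ((cmod (1 - w))\<^sup>2)"
  proof -
    have "cnj (1 - w) \<noteq> 0" using w1 by (metis complex_cnj_zero_iff)
    then show ?thesis unfolding disc_to_half_def complex_norm_square
      by (rule nonzero_mult_divide_mult_cancel_right[symmetric])
  qed
  then have "Im (disc_to_half z w) = Im ((z - cnj z * w) * cnj (1 - w)) / (cmod (1 - w))\<^sup>2"
    by (simp only: Im_divide_of_real)
  also have "Im ((z - cnj z * w) * cnj (1 - w)) = Im z * (1 - (cmod w)\<^sup>2)"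
    unfolding cmod_power2 by (simp add: power2_eq_square algebra_simps)
  finally show ?thesis .
qed

lemma disc_to_half_in:
  assumes "z \<in> upper_half_plane" "cmod w < 1"
  shows "disc_to_half z w \<in> upper_half_plane"
proof -
  have "(cmod w)\<^sup>2 < 1" using assms(2) by (simp add: power_less_one_iff)
  moreover have "1 - w \<noteq> 0" using assms(2) by auto
  ultimately show ?thesis using assms(1)
    by (simp add: upper_half_plane_def Im_disc_to_half[OF assms(2)])
qed

lemma disc_to_half_holomorphic: "disc_to_half z holomorphic_on ball 0 1"
  unfolding disc_to_half_def[abs_def] by (intro holomorphic_intros) auto

lemma disc_to_half_0: "disc_to_half z 0 = z" "(disc_to_half z has_field_derivative 2 * \<i> * Im z) (at 0)"
proof -
  show "disc_to_half z 0 = z" by (simp add: disc_to_half_def)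
  have "(disc_to_half z has_field_derivative - cnj z + z) (at 0)"
    unfolding disc_to_half_def[abs_def] by (auto intro!: derivative_eq_intros)
  also have "- cnj z + z = 2 * \<i> * Im z" by (simp add: complex_eq_iff)
  finally show "(disc_to_half z has_field_derivative 2 * \<i> * Im z) (at 0)" .
qed

text \<open>In the disc coordinate centred at \<open>z\<close> this is the derivative bound for maps into the right half-plane, applied to \<open>- \<i> F\<close>.\<close>

lemma Schwarz_Pick_half_plane:
  assumes F: "F holomorphic_on upper_half_plane" "\<And>z. z \<in> upper_half_plane \<Longrightarrow> F z \<in> upper_half_plane"
    and z: "z \<in> upper_half_plane"
  shows "cmod (deriv F z) * Im z \<le> Im (F z)"
proof -
  define G where "G = (\<lambda>w. - \<i> * F (disc_to_half z w))"
  have "disc_to_half z ` ball 0 1 \<subseteq> upper_half_plane" using disc_to_half_in[OF z] by auto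
  from holomorphic_on_compose_gen[OF disc_to_half_holomorphic F(1) this]
  have "(\<lambda>w. F (disc_to_half z w)) holomorphic_on ball 0 1" by (simp add: o_def)
  then have G: "G holomorphic_on ball 0 1" unfolding G_def by (intro holomorphic_intros)
  have Gpos: "Re (G w) > 0" if "w \<in> ball 0 1" for w
    using F(2)[OF disc_to_half_in[OF z, of w]] that by (simp add: G_def upper_half_plane_def)
  have Fd: "(F has_field_derivative deriv F z) (at (disc_to_half z 0))"
    using holomorphic_derivI[OF F(1) open_upper_half_plane z] disc_to_half_0(1)[of z] by simp
  have "(G has_field_derivative - \<i> * (deriv F z * (2 * \<i> * Im z))) (at 0)"
    unfolding G_def by (intro DERIV_cmult DERIV_chain2[OF Fd disc_to_half_0(2)])
  then have "deriv G 0 = - \<i> * (deriv F z * (2 * \<i> * Im z))" by (rule DERIV_imp_deriv)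
  then have "cmod (deriv G 0) = 2 * (cmod (deriv F z) * Im z)"
    using z by (simp add: norm_mult upper_half_plane_def)
  moreover have "cmod (deriv G 0) \<le> 2 * Re (G 0) / 1"
    by (rule deriv_bound_right_half_plane[OF G Gpos]) auto
  ultimately show ?thesis by (simp add: G_def disc_to_half_0(1))
qed

context uniformized begin

text \<open>Schwarz and Pick, for \<open>\<gamma>\<close> and for its inverse: deck transformations are hyperbolic isometries.\<close>

lemma deck_Im:
  assumes \<gamma>: "\<gamma> \<in> carrier (deck_group p)" and z: "z \<in> H"
  shows "cmod (deriv \<gamma> z) * Im z = Im (\<gamma> z)"
proof -
  note d = deck_elem[OF \<gamma>] and hol = deck_holomorphic[OF \<gamma>]
  have inj: "inj_on \<gamma> H" and im: "\<gamma> ` H = H" using d(1) by (auto simp: bij_betw_def)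
  obtain h where h: "h holomorphic_on \<gamma> ` H" "\<And>z. z \<in> H \<Longrightarrow> deriv \<gamma> z * deriv h (\<gamma> z) = 1" "\<And>z. z \<in> H \<Longrightarrow> h (\<gamma> z) = z"
    using holomorphic_has_inverse[OF hol open_upper_half_plane inj] by metis
  have hH: "h w \<in> H" if "w \<in> H" for w using that im h(3) by (metis imageE)
  have 1: "cmod (deriv \<gamma> z) * Im z \<le> Im (\<gamma> z)" by (rule Schwarz_Pick_half_plane[OF hol d(4) z])
  have "cmod (deriv h (\<gamma> z)) * Im (\<gamma> z) \<le> Im (h (\<gamma> z))"
    using h(1) im by (intro Schwarz_Pick_half_plane hH d(4) z) auto
  then have "cmod (deriv \<gamma> z) * (cmod (deriv h (\<gamma> z)) * Im (\<gamma> z)) \<le> cmod (deriv \<gamma> z) * Im z"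
    using h(3)[OF z] by (intro mult_left_mono) auto
  moreover have "cmod (deriv \<gamma> z) * cmod (deriv h (\<gamma> z)) = 1"
    using h(2)[OF z] by (metis norm_mult norm_one)
  ultimately have "Im (\<gamma> z) \<le> cmod (deriv \<gamma> z) * Im z" by (simp flip: mult.assoc)
  with 1 show ?thesis by simp
qed

text \<open>The discs with centre \<open>n \<i>\<close> and radius \<open>n - 1/n\<close> increase with \<open>n\<close> and exhaust the half-plane. Their images are an increasing open
cover of a compact surface, so one of them is everything.\<close>

lemma compact_fundamental_disc:
  obtains c r where "r > 0" "cball c r \<subseteq> H" "p ` ball c r = X"
proof -
  define B where "B = (\<lambda>n. ball (of_real n * \<i>) (n - 1 / n) :: complex set)"
  have mono: "B m \<subseteq> B n" if "1 \<le> m" "m \<le> n" for m n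
  proof
    fix z assume "z \<in> B m"
    then have "cmod (z - of_real m * \<i>) < m - 1 / m" by (simp add: B_def dist_norm norm_minus_commute)
    moreover have "cmod (z - of_real n * \<i>) \<le> cmod (z - of_real m * \<i>) + cmod (of_real (m - n) * \<i>)"
      using norm_triangle_ineq[of "z - of_real m * \<i>" "of_real (m - n) * \<i>"] by (simp add: algebra_simps)
    moreover have "cmod (of_real (m - n) * \<i>) = n - m" unfolding norm_mult norm_of_real using that by simp
    moreover have "1 / n \<le> 1 / m" using that by (intro divide_left_mono) auto
    ultimately have "cmod (z - of_real n * \<i>) < n - 1 / n" by linarith
    then show "z \<in> B n" by (simp add: B_def dist_norm norm_minus_commute)
  qed
  have cB: "cball (of_real n * \<i>) (n - 1 / n) \<subseteq> H" if "1 \<le> n" for n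
  proof
    fix z assume "z \<in> cball (of_real n * \<i>) (n - 1 / n)"
    then have "cmod (of_real n * \<i> - z) \<le> n - 1 / n" by (simp add: dist_norm)
    then have "\<bar>Im (of_real n * \<i> - z)\<bar> \<le> n - 1 / n" using abs_Im_le_cmod order_trans by blast
    then have "n - Im z \<le> n - 1 / n" by simp
    moreover have "1 / n > 0" using that by simp
    ultimately have "Im z > 0" by linarith
    then show "z \<in> H" unfolding upper_half_plane_def by simp
  qed
  have BH: "B n \<subseteq> H" if "1 \<le> n" for n using cB[OF that] ball_subset_cball unfolding B_def by blast
  have ex: "\<exists>n\<ge>2. z \<in> B n" if z: "z \<in> H" for z
  proof -
    define y where "y = Im z"
    have y: "y > 0" using z by (simp add: y_def upper_half_plane_def)
    define n where "n = 2 + ((cmod z)\<^sup>2 + 2) / (2 * y)"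
    have n: "n \<ge> 2" "n > ((cmod z)\<^sup>2 + 2) / (2 * y)" using y by (auto simp: n_def)
    have "(cmod z)\<^sup>2 + 2 < n * (2 * y)" using n(2) y by (simp add: pos_divide_less_eq)
    moreover have "(cmod (z - of_real n * \<i>))\<^sup>2 = (cmod z)\<^sup>2 - n * (2 * y) + n\<^sup>2"
      unfolding cmod_power2 by (simp add: y_def power2_eq_square algebra_simps)
    moreover have "(n - 1 / n)\<^sup>2 = n\<^sup>2 - 2 + (1 / n)\<^sup>2" using n by (simp add: power2_eq_square field_simps)
    moreover have "(1 / n)\<^sup>2 \<ge> 0" by simp
    ultimately have "(cmod (z - of_real n * \<i>))\<^sup>2 < (n - 1 / n)\<^sup>2" by linarith
    then have "cmod (z - of_real n * \<i>) < n - 1 / n"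
    proof (rule power2_less_imp_less)
      have "1 / n \<le> 1" using n by simp
      then show "0 \<le> n - 1 / n" using n by linarith
    qed
    then have "z \<in> B n" by (simp add: B_def dist_norm norm_minus_commute)
    then show ?thesis using n by blast
  qed
  have "\<forall>T\<in>(\<lambda>n. p ` B n) ` {2..}. openin (top_of_set X) T"
    using p_open BH by (auto simp: B_def)
  moreover have "X \<subseteq> \<Union> ((\<lambda>n. p ` B n) ` {2..})"
  proof
    fix x assume "x \<in> X"
    then obtain z where "z \<in> H" "x = p z" using p_surj by blast
    then show "x \<in> \<Union> ((\<lambda>n. p ` B n) ` {2..})" using ex[of z] by auto
  qed
  ultimately obtain D where D: "D \<subseteq> (\<lambda>n. p ` B n) ` {2..}" "finite D" "X \<subseteq> \<Union>D"
    using X_compact unfolding compact_eq_openin_cover by meson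
  then obtain N where N: "N \<subseteq> {2..}" "finite N" "D = (\<lambda>n. p ` B n) ` N" using finite_subset_image by metis
  have "D \<noteq> {}" using D(3) X_nonempty by auto
  then have Nne: "N \<noteq> {}" using N by auto
  define n where "n = Max N"
  have nN: "n \<in> N" unfolding n_def using N Nne by simp
  then have n2: "n \<ge> 2" using N by auto
  have le: "m \<le> n" if "m \<in> N" for m using that N(2) by (simp add: n_def)
  have "X \<subseteq> p ` B n"
  proof
    fix x assume "x \<in> X"
    then obtain m where m: "m \<in> N" "x \<in> p ` B m" using D(3) N(3) by blast
    have "B m \<subseteq> B n" using mono[of m n] m(1) N(1) le by force
    then show "x \<in> p ` B n" using m(2) by blast
  qed
  moreover have "p ` B n \<subseteq> X" using BH[of n] n2 p_in by auto
  ultimately have "p ` B n = X" by blast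
  moreover have "n - 1 / n > 0"
  proof -
    have "1 / n \<le> 1" using n2 by simp
    then show ?thesis using n2 by linarith
  qed
  ultimately show ?thesis using that[of "n - 1 / n" "of_real n * \<i>"] cB[of n] n2 by (auto simp: B_def)
qed

text \<open>Transitivity on fibres makes the translates of \<open>K\<close> an open cover of the half-plane.\<close>

lemma finite_deck_cover:
  assumes K: "open K" "K \<subseteq> H" "p ` K = X" and D: "compact D" "D \<subseteq> H"
  obtains S where "finite S" "S \<subseteq> carrier (deck_group p)" "\<And>z. z \<in> D \<Longrightarrow> \<exists>\<gamma>\<in>S. \<exists>k\<in>K. z = \<gamma> k"
proof -
  have op: "open (\<gamma> ` K)" if "\<gamma> \<in> carrier (deck_group p)" for \<gamma>
    using open_mapping_thm3[of \<gamma> K] deck_holomorphic[OF that] deck_elem(1)[OF that] K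
      holomorphic_on_subset inj_on_subset by (metis bij_betw_def)
  have "D \<subseteq> \<Union> ((\<lambda>\<gamma>. \<gamma> ` K) ` carrier (deck_group p))"
  proof
    fix z assume z: "z \<in> D"
    then have zH: "z \<in> H" using D by blast
    then obtain k where k: "k \<in> K" "p k = p z" using K(3) p_in by (metis imageE)
    then obtain \<gamma> where "\<gamma> \<in> carrier (deck_group p)" "\<gamma> k = z" using deck_transitive[of k z] zH K(2) by blast
    then show "z \<in> \<Union> ((\<lambda>\<gamma>. \<gamma> ` K) ` carrier (deck_group p))" using k(1) by blast
  qed
  then obtain S where S: "S \<subseteq> carrier (deck_group p)" "finite S" "D \<subseteq> (\<Union>\<gamma>\<in>S. \<gamma> ` K)"
    using compactE_image[OF D(1), of "carrier (deck_group p)" "\<lambda>\<gamma>. \<gamma> ` K"] op by blast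
  show ?thesis by (rule that[OF S(2,1)]) (use S(3) in blast)
qed

end

section \<open>The norm of a quadratic differential on the half-plane\<close>

context uniformized begin

lemma transition_open:
  assumes c: "c \<in> A" and d: "d \<in> A"
  shows "open (snd c ` (fst c \<inter> fst d))"
proof -
  note cf = chart_facts[OF X_atlas c]
  have "openin (top_of_set (snd c ` fst c)) (snd c ` fst c \<inter> chart_inv c -` fst d)"
    by (rule continuous_openin_preimage[OF cf(4) _ chart_facts(1)[OF X_atlas d]])
       (use cf(7,8) in blast)
  then have "open (snd c ` fst c \<inter> chart_inv c -` fst d)" using cf(2) openin_open_eq by blast
  also have "snd c ` fst c \<inter> chart_inv c -` fst d = snd c ` (fst c \<inter> fst d)"
    using cf(5) by auto
  finally show ?thesis .
qed

text \<open>The lift is defined through an arbitrarily chosen chart at each point; the transformation rule of quadratic differentials and the chain rule show that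
every chart gives the same value.\<close>

lemma qd_lift_chart:
  assumes \<phi>: "\<phi> \<in> quadratic_differentials A" and z: "z \<in> H" and c: "c \<in> A" "p z \<in> fst c"
  shows "qd_lift A p \<phi> z = \<phi> c (p z) * (deriv (snd c \<circ> p) z)\<^sup>2"
proof -
  define d where "d = (SOME c. c \<in> A \<and> p z \<in> fst c)"
  have d: "d \<in> A" "p z \<in> fst d" using someI[of "\<lambda>c. c \<in> A \<and> p z \<in> fst c" c] c by (auto simp: d_def)
  define t where "t = snd d \<circ> chart_inv c"
  note cf = chart_facts[OF X_atlas c(1)]
  have th: "t holomorphic_on snd c ` (fst c \<inter> fst d)"
    using X_atlas c(1) d(1) by (auto simp: complex_atlas_def t_def)
  have td: "(t has_field_derivative deriv t (snd c (p z))) (at ((snd c \<circ> p) z))"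
    using holomorphic_derivI[OF th transition_open[OF c(1) d(1)], of "snd c (p z)"] c d by simp
  have cd: "((snd c \<circ> p) has_field_derivative deriv (snd c \<circ> p) z) (at z)"
    using holomorphic_derivI[OF p_chart[OF c(1)] open_chart_domain[OF c(1)]] z c by auto
  have "((\<lambda>w. t ((snd c \<circ> p) w)) has_field_derivative deriv t (snd c (p z)) * deriv (snd c \<circ> p) z) (at z)"
    by (rule DERIV_chain2[OF td cd])
  moreover have "open ({\<tau> \<in> H. p \<tau> \<in> fst c} \<inter> {\<tau> \<in> H. p \<tau> \<in> fst d})"
    using open_chart_domain c d by blast
  ultimately have "((snd d \<circ> p) has_field_derivative deriv t (snd c (p z)) * deriv (snd c \<circ> p) z) (at z)"
    by (rule has_field_derivative_transform_within_open) (use c d z cf(5) in \<open>auto simp: t_def\<close>)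
  then have dd: "deriv (snd d \<circ> p) z = deriv t (snd c (p z)) * deriv (snd c \<circ> p) z" by (rule DERIV_imp_deriv)
  have "\<phi> c (p z) = \<phi> d (p z) * (deriv t (snd c (p z)))\<^sup>2"
    using \<phi>[unfolded quadratic_differentials_def mem_Collect_eq, THEN conjunct2, THEN conjunct2,
        rule_format, OF c(1) d(1), of "p z"] c d unfolding t_def by blast
  then show ?thesis
    unfolding qd_lift_def d_def[symmetric] Let_def dd by (simp add: power_mult_distrib)
qed

lemma qd_coeff_holomorphic:
  assumes \<phi>: "\<phi> \<in> quadratic_differentials A" and c: "c \<in> A"
  shows "(\<lambda>w. \<phi> c (chart_inv c w)) holomorphic_on snd c ` fst c"
  using \<phi>[unfolded quadratic_differentials_def mem_Collect_eq, THEN conjunct2, THEN conjunct1,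
      rule_format, OF c] by (simp only: o_def)

lemma qd_lift_holomorphic:
  assumes \<phi>: "\<phi> \<in> quadratic_differentials A"
  shows "qd_lift A p \<phi> holomorphic_on H"
proof -
  have "\<exists>q'. (qd_lift A p \<phi> has_field_derivative q') (at z)" if z: "z \<in> H" for z
  proof -
    obtain c where c: "c \<in> A" "p z \<in> fst c" using p_in[OF z] X_atlas by (auto simp: complex_atlas_def)
    define O' where "O' = {\<tau> \<in> H. p \<tau> \<in> fst c}"
    have O: "open O'" "z \<in> O'" "O' \<subseteq> H" using open_chart_domain[OF c(1)] z c by (auto simp: O'_def)
    have k: "(snd c \<circ> p) holomorphic_on O'" using p_chart[OF c(1)] by (simp add: O'_def)
    have im: "(snd c \<circ> p) ` O' \<subseteq> snd c ` fst c" by (auto simp: O'_def)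
    have "(\<lambda>z. \<phi> c (chart_inv c ((snd c \<circ> p) z))) holomorphic_on O'"
      using holomorphic_on_compose_gen[OF k qd_coeff_holomorphic[OF \<phi> c(1)] im] by (simp add: o_def)
    then have "(\<lambda>z. \<phi> c (chart_inv c ((snd c \<circ> p) z)) * (deriv (snd c \<circ> p) z)\<^sup>2) holomorphic_on O'"
      by (intro holomorphic_intros holomorphic_deriv k O(1))
    then have "qd_lift A p \<phi> holomorphic_on O'"
    proof (rule holomorphic_transform)
      fix w assume w: "w \<in> O'"
      then have "chart_inv c (snd c (p w)) = p w" using chart_facts(5)[OF X_atlas c(1)] by (simp add: O'_def)
      then show "\<phi> c (chart_inv c ((snd c \<circ> p) w)) * (deriv (snd c \<circ> p) w)\<^sup>2 = qd_lift A p \<phi> w"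
        using qd_lift_chart[OF \<phi> _ c(1)] w by (simp add: O'_def)
    qed
    then show ?thesis using O holomorphic_on_open by blast
  qed
  then show ?thesis using holomorphic_on_open[OF open_upper_half_plane] by blast
qed

text \<open>The partition that the norm of a quadratic differential is defined by: the same choice from the same nonempty family.\<close>

definition cell :: "'a chart \<Rightarrow> 'a set" where "cell = (SOME cell. chart_partition X A cell)"

lemma chart_domain_borel: "c \<in> A \<Longrightarrow> fst c \<in> sets borel"
proof -
  assume c: "c \<in> A"
  obtain V where V: "open V" "fst c = X \<inter> V"
    using chart_facts(1)[OF X_atlas c] by (auto simp: openin_open)
  have "closed X" by (rule compact_imp_closed[OF X_compact])
  then show ?thesis unfolding V(2) using V(1) by (intro sets.Int) auto
qed

text \<open>A compact surface has finitely many charts that cover it; after numbering them, assign each point to the first one that contains it.\<close>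

lemma cell_partition: "chart_partition X A cell"
proof -
  obtain J where J: "finite J" "\<And>c w r. (c, w, r) \<in> J \<Longrightarrow> c \<in> A \<and> cball w r \<subseteq> snd c ` fst c"
    "\<And>x. x \<in> X \<Longrightarrow> \<exists>c w r. (c, w, r) \<in> J \<and> x \<in> fst c \<and> snd c x \<in> ball w r"
    using finite_chart_cover[OF X_compact X_atlas] by metis
  define C where "C = fst ` J"
  have C: "finite C" "C \<subseteq> A" using J(1,2) by (auto simp: C_def)
  have Ccov: "\<exists>c\<in>C. x \<in> fst c" if "x \<in> X" for x
  proof -
    obtain c w r where "(c, w, r) \<in> J" "x \<in> fst c" using J(3)[OF \<open>x \<in> X\<close>] by blast
    then show ?thesis unfolding C_def by (intro bexI[of _ c]) (auto intro!: image_eqI[of _ _ "(c, w, r)"])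
  qed
  obtain idx :: "'a chart \<Rightarrow> nat" where idx: "inj_on idx C"
    using finite_imp_inj_to_nat_seg[OF C(1)] by blast
  \<comment> \<open>A point belongs to the cell of the first chart in the enumeration \<open>idx\<close> that contains it.\<close>
  define F where "F = (\<lambda>c. if c \<in> C then fst c - (\<Union>d\<in>{d \<in> C. idx d < idx c}. fst d) else {})"
  have "chart_partition X A F"
    unfolding chart_partition_def
  proof (intro conjI ballI)
    show "finite {c \<in> A. F c \<noteq> {}}" by (rule finite_subset[OF _ C(1)]) (auto simp: F_def split: if_splits)
    show "F c \<in> sets borel" if "c \<in> A" for c
    proof -
      have cb: "fst d \<in> sets borel" if "d \<in> C" for d using C(2) chart_domain_borel that by blast
      show ?thesis unfolding F_def using C(1) by (auto intro!: sets.Diff sets.finite_UN cb)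
    qed
    show "F c \<subseteq> fst c" for c by (auto simp: F_def)
    show "disjoint_family_on F A"
      unfolding disjoint_family_on_def
    proof (intro ballI impI)
      fix c d :: "'a chart" assume cd: "c \<noteq> d"
      show "F c \<inter> F d = {}"
      proof (cases "c \<in> C \<and> d \<in> C")
        case True
        then have "idx c < idx d \<or> idx d < idx c" using idx cd by (metis inj_onD nat_neq_iff)
        then show ?thesis using True by (auto simp: F_def)
      qed (auto simp: F_def)
    qed
    show "(\<Union>c\<in>A. F c) = X"
    proof
      show "(\<Union>c\<in>A. F c) \<subseteq> X" using chart_facts(8)[OF X_atlas] by (auto simp: F_def split: if_splits)
      show "X \<subseteq> (\<Union>c\<in>A. F c)"
      proof
        fix x assume "x \<in> X"
        then obtain c0 where "c0 \<in> C \<and> x \<in> fst c0" using Ccov by blast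
        then obtain c where c: "c \<in> C \<and> x \<in> fst c" "\<And>d. d \<in> C \<and> x \<in> fst d \<Longrightarrow> idx c \<le> idx d"
          using ex_has_least_nat[of "\<lambda>c. c \<in> C \<and> x \<in> fst c" c0 idx] by blast
        then have "x \<in> F c" by (force simp: F_def)
        then show "x \<in> (\<Union>c\<in>A. F c)" using c(1) C(2) by blast
      qed
    qed
  qed
  then show ?thesis unfolding cell_def by (rule someI[where P = "chart_partition X A"])
qed

definition used_charts :: "'a chart set" where "used_charts = {c \<in> A. cell c \<noteq> {}}"

lemma used_charts: "finite used_charts" "used_charts \<subseteq> A" "\<And>c. c \<in> A \<Longrightarrow> cell c \<in> sets borel" "\<And>c. c \<in> A \<Longrightarrow> cell c \<subseteq> fst c"
    "(\<Union>c\<in>used_charts. cell c) = X"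
proof -
  note P = cell_partition[unfolded chart_partition_def]
  show "finite used_charts" "used_charts \<subseteq> A" "\<And>c. c \<in> A \<Longrightarrow> cell c \<in> sets borel" "\<And>c. c \<in> A \<Longrightarrow> cell c \<subseteq> fst c"
    using P by (simp_all add: used_charts_def)
  have "(\<Union>c\<in>used_charts. cell c) = (\<Union>c\<in>A. cell c)" unfolding used_charts_def by blast
  then show "(\<Union>c\<in>used_charts. cell c) = X" using P by simp
qed

text \<open>The value 0 outside the chart makes this a Borel function on the whole plane.\<close>

definition coeff_density :: "'a qdiff \<Rightarrow> 'a chart \<Rightarrow> complex \<Rightarrow> ennreal" where
  "coeff_density \<phi> c w = ennreal (cmod (if w \<in> snd c ` fst c then \<phi> c (chart_inv c w) else 0))"

lemma coeff_density_measurable: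
  assumes "\<phi> \<in> quadratic_differentials A" "c \<in> A"
  shows "coeff_density \<phi> c \<in> borel_measurable borel"
proof -
  have "(\<lambda>w. if w \<in> snd c ` fst c then \<phi> c (chart_inv c w) else 0) \<in> borel_measurable borel"
    using chart_facts(2)[OF X_atlas assms(2)] holomorphic_on_imp_continuous_on[OF qd_coeff_holomorphic[OF assms]]
    by (intro borel_measurable_continuous_on_if) auto
  then show ?thesis unfolding coeff_density_def[abs_def] by measurable
qed

text \<open>The norm with values in \<open>[0, \<infinity>]\<close>, for which change of variables and additivity hold before integrability is known.\<close>

definition nn_norm :: "'a qdiff \<Rightarrow> ennreal" where
  "nn_norm \<phi> = (\<Sum>c\<in>used_charts. \<integral>\<^sup>+w\<in>snd c ` cell c. coeff_density \<phi> c w \<partial>lborel)"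

lemma p_vimage_borel:
  assumes "B \<in> sets borel"
  shows "{z \<in> H. p z \<in> B} \<in> sets borel"
proof -
  have "p -` B \<inter> H \<in> sets (restrict_space borel H)"
    using measurable_sets[OF borel_measurable_continuous_on_restrict[OF p_cont] assms]
    by (simp add: space_restrict_space)
  then have "p -` B \<inter> H \<in> sets borel" using open_upper_half_plane by (auto simp: sets_restrict_space_iff)
  moreover have "{z \<in> H. p z \<in> B} = p -` B \<inter> H" by auto
  ultimately show ?thesis by simp
qed

lemma chart_image_borel:
  assumes c: "c \<in> A" and B: "B \<in> sets borel" "B \<subseteq> fst c"
  shows "snd c ` B \<in> sets borel"
proof -
  note cf = chart_facts[OF X_atlas c]
  have "chart_inv c -` B \<inter> snd c ` fst c \<in> sets (restrict_space borel (snd c ` fst c))"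
    using measurable_sets[OF borel_measurable_continuous_on_restrict[OF cf(4)] B(1)]
    by (simp add: space_restrict_space)
  then have "chart_inv c -` B \<inter> snd c ` fst c \<in> sets borel" using cf(2) by (auto simp: sets_restrict_space_iff)
  moreover have "chart_inv c -` B \<inter> snd c ` fst c = snd c ` B" using cf(5) B(2) by auto
  ultimately show ?thesis by simp
qed

text \<open>The modulus of a quadratic differential is an area density: under a coordinate change its coefficient is multiplied by the square of the derivative, and area by
the square of its modulus.\<close>

lemma nn_integral_piece:
  assumes \<phi>: "\<phi> \<in> quadratic_differentials A" and c: "c \<in> A"
    and D: "open D" "D \<subseteq> H" "inj_on p D" and B: "B \<in> sets borel" "B \<subseteq> D" "p ` B \<subseteq> fst c"
  shows "(\<integral>\<^sup>+w\<in>snd c ` p ` B. coeff_density \<phi> c w \<partial>lborel) = (\<integral>\<^sup>+z\<in>B. ennreal (cmod (qd_lift A p \<phi> z)) \<partial>lborel)"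
proof -
  define U where "U = D \<inter> {\<tau> \<in> H. p \<tau> \<in> fst c}"
  define k where "k = snd c \<circ> p"
  have U: "open U" using D(1) open_chart_domain[OF c] by (auto simp: U_def)
  have k: "k holomorphic_on U" unfolding k_def using p_chart[OF c] by (rule holomorphic_on_subset) (auto simp: U_def)
  have ki: "inj_on k U" unfolding k_def
    by (intro comp_inj_on inj_on_subset[OF D(3)] inj_on_subset[OF chart_facts(9)[OF X_atlas c]]) (auto simp: U_def)
  have BU: "B \<subseteq> U" using B D by (auto simp: U_def)
  have "(\<integral>\<^sup>+w\<in>k ` B. coeff_density \<phi> c w \<partial>lborel) = (\<integral>\<^sup>+z\<in>B. coeff_density \<phi> c (k z) * ennreal ((cmod (deriv k z))\<^sup>2) \<partial>lborel)"
    by (rule nn_integral_image_holomorphic[OF U k ki B(1) BU coeff_density_measurable[OF \<phi> c]])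
  also have "\<dots> = (\<integral>\<^sup>+z\<in>B. ennreal (cmod (qd_lift A p \<phi> z)) \<partial>lborel)"
  proof (intro nn_integral_cong)
    fix z
    show "coeff_density \<phi> c (k z) * ennreal ((cmod (deriv k z))\<^sup>2) * indicator B z
        = ennreal (cmod (qd_lift A p \<phi> z)) * indicator B z"
    proof (cases "z \<in> B")
      case True
      then have z: "z \<in> H" "p z \<in> fst c" using BU by (auto simp: U_def)
      have "coeff_density \<phi> c (k z) = ennreal (cmod (\<phi> c (p z)))"
        using z chart_facts(5)[OF X_atlas c] by (auto simp: coeff_density_def k_def)
      then show ?thesis
        unfolding qd_lift_chart[OF \<phi> z(1) c z(2)] k_def
        by (simp add: norm_mult norm_power ennreal_mult)
    qed simp
  qed
  finally show ?thesis by (simp add: k_def image_comp)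
qed

lemma local_injectivity:
  assumes "z \<in> H"
  obtains d where "d > 0" "ball z d \<subseteq> H" "inj_on p (ball z d)"
proof -
  obtain c T where T: "c \<in> A" "open T" "z \<in> T" "T \<subseteq> {\<tau> \<in> H. p \<tau> \<in> fst c}" "inj_on p T" "inj_on (snd c \<circ> p) T"
    "(snd c \<circ> p) holomorphic_on T"
    using local_chart[OF assms] .
  obtain d where d: "d > 0" "ball z d \<subseteq> T" using T(2,3) openE by blast
  show ?thesis by (rule that[OF d(1)]) (use d T in \<open>auto intro: inj_on_subset\<close>)
qed

text \<open>Finitely many open sets on which \<open>p\<close> is injective cover the fundamental disc. Each cell is covered by the images of the corresponding parts of the disc, and each of these
parts contributes at most \<open>m\<close> times the area of the disc.\<close>

lemma nn_norm_le:
  assumes cr: "cball a r \<subseteq> H" "p ` ball a r = X" "r > 0"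
  obtains C where "C > 0" "\<And>\<phi> m. \<phi> \<in> quadratic_differentials A \<Longrightarrow> m \<ge> 0 \<Longrightarrow>
     (\<And>z. z \<in> cball a r \<Longrightarrow> cmod (qd_lift A p \<phi> z) \<le> m) \<Longrightarrow> nn_norm \<phi> \<le> ennreal (C * m)"
proof -
  define I where "I = {T. open T \<and> T \<subseteq> H \<and> inj_on p T}"
  have "\<forall>T\<in>I. open T" by (auto simp: I_def)
  moreover have "cball a r \<subseteq> \<Union>I"
  proof
    fix z assume "z \<in> cball a r"
    then have "z \<in> H" using cr(1) by blast
    then obtain d where "d > 0" "ball z d \<subseteq> H" "inj_on p (ball z d)" using local_injectivity by blast
    then show "z \<in> \<Union>I" unfolding I_def by (intro UnionI[of "ball z d"]) auto
  qed
  ultimately obtain T where T: "T \<subseteq> I" "finite T" "cball a r \<subseteq> \<Union>T"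
    using compactE[of "cball a r" I] by (metis compact_cball)
  define C where "C = real (card used_charts) * (real (card T) * (pi * r\<^sup>2)) + 1"
  show ?thesis
  proof (rule that[of C])
    show "C > 0" by (simp add: C_def add_nonneg_pos)
    fix \<phi> m assume \<phi>: "\<phi> \<in> quadratic_differentials A" and m: "m \<ge> 0"
      and q: "\<And>z. z \<in> cball a r \<Longrightarrow> cmod (qd_lift A p \<phi> z) \<le> m"
    have piece: "(\<integral>\<^sup>+w\<in>snd c ` cell c. coeff_density \<phi> c w \<partial>lborel) \<le> ennreal (real (card T) * (pi * r\<^sup>2 * m))"
      if c: "c \<in> used_charts" for c
    proof -
      have cA: "c \<in> A" using c used_charts(2) by blast
      define B where "B = (\<lambda>D. D \<inter> ball a r \<inter> {z \<in> H. p z \<in> cell c})"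
      have B: "B D \<in> sets borel" "B D \<subseteq> D" "p ` B D \<subseteq> fst c" "open D" "D \<subseteq> H" "inj_on p D" "B D \<subseteq> ball a r" if "D \<in> T" for D
        using that T(1) p_vimage_borel[OF used_charts(3)[OF cA]] used_charts(4)[OF cA] by (auto simp: B_def I_def)
      have cov: "snd c ` cell c \<subseteq> (\<Union>D\<in>T. snd c ` p ` B D)"
      proof
        fix w assume "w \<in> snd c ` cell c"
        then obtain x where x: "x \<in> cell c" "w = snd c x" by blast
        have "x \<in> X" using x(1) used_charts(5) c by blast
        then obtain z where z: "z \<in> ball a r" "x = p z" using cr(2) by blast
        then have "z \<in> cball a r" by simp
        then obtain D where "D \<in> T" "z \<in> D" using T(3) by blast
        moreover have "z \<in> B D" using z x(1) \<open>z \<in> D\<close> \<open>z \<in> cball a r\<close> cr(1) by (auto simp: B_def)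
        ultimately show "w \<in> (\<Union>D\<in>T. snd c ` p ` B D)" using x z by blast
      qed
      have Bb: "snd c ` p ` B D \<in> sets borel" if "D \<in> T" for D
      proof -
        define U where "U = D \<inter> {\<tau> \<in> H. p \<tau> \<in> fst c}"
        have "open U" using B(4)[OF that] open_chart_domain[OF cA] by (auto simp: U_def)
        moreover have "(snd c \<circ> p) holomorphic_on U" using p_chart[OF cA] by (rule holomorphic_on_subset) (auto simp: U_def)
        moreover have "inj_on (snd c \<circ> p) U"
          by (intro comp_inj_on inj_on_subset[OF B(6)[OF that]] inj_on_subset[OF chart_facts(9)[OF X_atlas cA]]) (auto simp: U_def)
        moreover have "B D \<subseteq> U" using used_charts(4)[OF cA] by (auto simp: B_def U_def)
        ultimately have "(snd c \<circ> p) ` B D \<in> sets borel" using borel_image_holomorphic B(1)[OF that] by blast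
        then show ?thesis by (simp add: image_comp)
      qed
      have "(\<integral>\<^sup>+w\<in>snd c ` cell c. coeff_density \<phi> c w \<partial>lborel)
          \<le> (\<integral>\<^sup>+w. (\<Sum>D\<in>T. coeff_density \<phi> c w * indicator (snd c ` p ` B D) w) \<partial>lborel)"
      proof (intro nn_integral_mono)
        fix w
        show "coeff_density \<phi> c w * indicator (snd c ` cell c) w \<le> (\<Sum>D\<in>T. coeff_density \<phi> c w * indicator (snd c ` p ` B D) w)"
        proof (cases "w \<in> snd c ` cell c")
          case True
          then obtain D where D: "D \<in> T" "w \<in> snd c ` p ` B D" using cov by blast
          have "coeff_density \<phi> c w * indicator (snd c ` cell c) w = coeff_density \<phi> c w * indicator (snd c ` p ` B D) w" using True D by simp
          also have "\<dots> \<le> (\<Sum>D\<in>T. coeff_density \<phi> c w * indicator (snd c ` p ` B D) w)"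
            by (rule member_le_sum) (use D T(2) in auto)
          finally show ?thesis .
        qed simp
      qed
      also have "\<dots> = (\<Sum>D\<in>T. \<integral>\<^sup>+w\<in>snd c ` p ` B D. coeff_density \<phi> c w \<partial>lborel)"
        using coeff_density_measurable[OF \<phi> cA] Bb
        by (intro nn_integral_sum) (auto intro!: borel_measurable_times_ennreal borel_measurable_indicator)
      also have "\<dots> \<le> (\<Sum>D\<in>T. ennreal (pi * r\<^sup>2 * m))"
      proof (rule sum_mono)
        fix D assume D: "D \<in> T"
        have "(\<integral>\<^sup>+w\<in>snd c ` p ` B D. coeff_density \<phi> c w \<partial>lborel) = (\<integral>\<^sup>+z\<in>B D. ennreal (cmod (qd_lift A p \<phi> z)) \<partial>lborel)"
          using B[OF D] by (intro nn_integral_piece \<phi> cA) auto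
        also have "\<dots> \<le> (\<integral>\<^sup>+z. ennreal m * indicator (ball a r) z \<partial>lborel)"
        proof (intro nn_integral_mono)
          fix z
          show "ennreal (cmod (qd_lift A p \<phi> z)) * indicator (B D) z \<le> ennreal m * indicator (ball a r) z"
            using B(7)[OF D] q[of z] by (auto simp: indicator_def ennreal_leI)
        qed
        also have "\<dots> = ennreal m * emeasure lborel (ball a r)"
          by (subst nn_integral_cmult) (auto intro!: borel_measurable_indicator)
        also have "\<dots> = ennreal (pi * r\<^sup>2 * m)"
          using cr(3) m by (simp add: emeasure_ball unit_ball_vol_2 ennreal_mult[symmetric] mult.commute)
        finally show "(\<integral>\<^sup>+w\<in>snd c ` p ` B D. coeff_density \<phi> c w \<partial>lborel) \<le> ennreal (pi * r\<^sup>2 * m)" .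
      qed
      also have "\<dots> = ennreal (real (card T) * (pi * r\<^sup>2 * m))"
        using m by (simp add: ennreal_mult ennreal_of_nat_eq_real_of_nat)
      finally show ?thesis .
    qed
    have "nn_norm \<phi> \<le> (\<Sum>c\<in>used_charts. ennreal (real (card T) * (pi * r\<^sup>2 * m)))"
      unfolding nn_norm_def by (intro sum_mono piece)
    also have "\<dots> = ennreal (real (card used_charts) * (real (card T) * (pi * r\<^sup>2 * m)))"
      using m by (simp add: ennreal_mult ennreal_of_nat_eq_real_of_nat)
    also have "\<dots> \<le> ennreal (C * m)"
      using m by (intro ennreal_leI) (simp add: C_def algebra_simps)
    finally show "nn_norm \<phi> \<le> ennreal (C * m)" .
  qed
qed

text \<open>The Lebesgue integral of a function that is not integrable is 0, so the real-valued norm is meaningful only once its integrals are known to be finite. They are, since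
the lift is bounded on a compact fundamental disc.\<close>

lemma nn_norm_eq:
  assumes \<phi>: "\<phi> \<in> quadratic_differentials A"
  shows "nn_norm \<phi> = ennreal (qd_norm X A \<phi>)" "qd_norm X A \<phi> \<ge> 0"
proof -
  obtain a r where cr: "r > 0" "cball a r \<subseteq> H" "p ` ball a r = X" using compact_fundamental_disc by blast
  have "continuous_on (cball a r) (qd_lift A p \<phi>)"
    using holomorphic_on_imp_continuous_on[OF qd_lift_holomorphic[OF \<phi>]] cr(2) continuous_on_subset by blast
  then have "bounded (qd_lift A p \<phi> ` cball a r)"
    by (intro compact_imp_bounded compact_continuous_image) auto
  then obtain m where "\<forall>y\<in>qd_lift A p \<phi> ` cball a r. cmod y \<le> m" unfolding bounded_iff by blast
  then have m: "cmod (qd_lift A p \<phi> z) \<le> m" if "z \<in> cball a r" for z using that by blast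
  have m0: "m \<ge> 0" using order_trans[OF norm_ge_zero m[of a]] cr(1) by simp
  obtain C where "C > 0" "\<And>\<phi> m. \<phi> \<in> quadratic_differentials A \<Longrightarrow> m \<ge> 0 \<Longrightarrow>
     (\<And>z. z \<in> cball a r \<Longrightarrow> cmod (qd_lift A p \<phi> z) \<le> m) \<Longrightarrow> nn_norm \<phi> \<le> ennreal (C * m)"
    using nn_norm_le[OF cr(2,3,1)] by metis
  then have "nn_norm \<phi> \<le> ennreal (C * m)" using \<phi> m0 m by blast
  then have fin: "nn_norm \<phi> < \<infinity>" using ennreal_less_top le_less_trans by (metis infinity_ennreal_def)
  have piecewise: "(LINT w:snd c ` cell c|lborel. cmod (\<phi> c (chart_inv c w))) = enn2real (\<integral>\<^sup>+w\<in>snd c ` cell c. coeff_density \<phi> c w \<partial>lborel)"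
    if c: "c \<in> used_charts" for c
  proof -
    have cA: "c \<in> A" using c used_charts(2) by blast
    have Eb: "snd c ` cell c \<in> sets borel" by (rule chart_image_borel[OF cA used_charts(3)[OF cA] used_charts(4)[OF cA]])
    define g where "g = (\<lambda>w. if w \<in> snd c ` fst c then \<phi> c (chart_inv c w) else 0)"
    have gm: "g \<in> borel_measurable borel" unfolding g_def
      using chart_facts(2)[OF X_atlas cA] holomorphic_on_imp_continuous_on[OF qd_coeff_holomorphic[OF \<phi> cA]]
      by (intro borel_measurable_continuous_on_if) auto
    have eq: "indicator (snd c ` cell c) w *\<^sub>R cmod (\<phi> c (chart_inv c w)) = indicator (snd c ` cell c) w * cmod (g w)" for w
      using used_charts(4)[OF cA] by (auto simp: indicator_def g_def)
    have "(LINT w:snd c ` cell c|lborel. cmod (\<phi> c (chart_inv c w))) = (LINT w|lborel. indicator (snd c ` cell c) w * cmod (g w))"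
      unfolding set_lebesgue_integral_def eq ..
    also have "\<dots> = enn2real (\<integral>\<^sup>+w. ennreal (indicator (snd c ` cell c) w * cmod (g w)) \<partial>lborel)"
    proof (rule integral_eq_nn_integral)
      have "(\<lambda>w. indicator (snd c ` cell c) w * cmod (g w)) \<in> borel_measurable borel"
        using gm Eb by (intro borel_measurable_times borel_measurable_indicator borel_measurable_norm) auto
      then show "(\<lambda>w. indicator (snd c ` cell c) w * cmod (g w)) \<in> borel_measurable lborel" by simp
    qed auto
    also have "(\<integral>\<^sup>+w. ennreal (indicator (snd c ` cell c) w * cmod (g w)) \<partial>lborel) = (\<integral>\<^sup>+w\<in>snd c ` cell c. coeff_density \<phi> c w \<partial>lborel)"
      by (intro nn_integral_cong) (auto simp: indicator_def coeff_density_def g_def)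
    finally show ?thesis .
  qed
  have "qd_norm X A \<phi> = (\<Sum>c\<in>used_charts. LINT w:snd c ` cell c|lborel. cmod (\<phi> c (chart_inv c w)))"
    unfolding qd_norm_def cell_def[symmetric] Let_def used_charts_def ..
  also have "\<dots> = (\<Sum>c\<in>used_charts. enn2real (\<integral>\<^sup>+w\<in>snd c ` cell c. coeff_density \<phi> c w \<partial>lborel))"
    by (intro sum.cong refl piecewise)
  finally have qn: "qd_norm X A \<phi> = \<dots>" .
  then show "qd_norm X A \<phi> \<ge> 0" by (simp add: sum_nonneg)
  have "ennreal (qd_norm X A \<phi>) = (\<Sum>c\<in>used_charts. ennreal (enn2real (\<integral>\<^sup>+w\<in>snd c ` cell c. coeff_density \<phi> c w \<partial>lborel)))"
    unfolding qn by (rule sum_ennreal[symmetric]) simp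
  also have "\<dots> = nn_norm \<phi>" unfolding nn_norm_def
  proof (intro sum.cong refl)
    fix c assume c: "c \<in> used_charts"
    have "(\<integral>\<^sup>+w\<in>snd c ` cell c. coeff_density \<phi> c w \<partial>lborel) \<le> nn_norm \<phi>"
      unfolding nn_norm_def using c used_charts(1) by (intro member_le_sum) auto
    then show "ennreal (enn2real (\<integral>\<^sup>+w\<in>snd c ` cell c. coeff_density \<phi> c w \<partial>lborel)) = (\<integral>\<^sup>+w\<in>snd c ` cell c. coeff_density \<phi> c w \<partial>lborel)"
      using fin by (intro ennreal_enn2real) (simp only: infinity_ennreal_def le_less_trans)
  qed
  finally show "nn_norm \<phi> = ennreal (qd_norm X A \<phi>)" by simp
qed

theorem qd_norm_le_sup:
  assumes cr: "cball a r \<subseteq> H" "p ` ball a r = X" "r > 0"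
  obtains C where "C > 0" "\<And>\<phi> m. \<phi> \<in> quadratic_differentials A \<Longrightarrow> m \<ge> 0 \<Longrightarrow>
     (\<And>z. z \<in> cball a r \<Longrightarrow> cmod (qd_lift A p \<phi> z) \<le> m) \<Longrightarrow> qd_norm X A \<phi> \<le> C * m"
proof -
  obtain C where C: "C > 0" "\<And>\<phi> m. \<phi> \<in> quadratic_differentials A \<Longrightarrow> m \<ge> 0 \<Longrightarrow>
     (\<And>z. z \<in> cball a r \<Longrightarrow> cmod (qd_lift A p \<phi> z) \<le> m) \<Longrightarrow> nn_norm \<phi> \<le> ennreal (C * m)"
    using nn_norm_le[OF cr] by metis
  show ?thesis
  proof (rule that[OF C(1)])
    fix \<phi> m assume a: "\<phi> \<in> quadratic_differentials A" "m \<ge> 0" "\<And>z. z \<in> cball a r \<Longrightarrow> cmod (qd_lift A p \<phi> z) \<le> m"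
    have "ennreal (qd_norm X A \<phi>) \<le> ennreal (C * m)" using C(2)[OF a] nn_norm_eq[OF a(1)] by simp
    then show "qd_norm X A \<phi> \<le> C * m" using a(2) C(1) by (simp add: ennreal_le_iff)
  qed
qed

text \<open>Where \<open>p\<close> is injective, the part of \<open>D\<close> over a cell maps bijectively to a subset of that cell.\<close>

lemma nn_integral_lift_le_norm:
  assumes \<phi>: "\<phi> \<in> quadratic_differentials A" and D: "open D" "D \<subseteq> H" "inj_on p D"
  shows "(\<integral>\<^sup>+z\<in>D. ennreal (cmod (qd_lift A p \<phi> z)) \<partial>lborel) \<le> nn_norm \<phi>"
proof -
  define B where "B = (\<lambda>c. D \<inter> {z \<in> H. p z \<in> cell c})"
  have B: "B c \<in> sets borel" "B c \<subseteq> D" "p ` B c \<subseteq> fst c" "p ` B c \<subseteq> cell c" if "c \<in> A" for c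
    using that D(1) p_vimage_borel[OF used_charts(3)[OF that]] used_charts(4)[OF that] by (auto simp: B_def)
  define Q where "Q = (\<lambda>z. if z \<in> H then qd_lift A p \<phi> z else 0)"
  have Q: "Q \<in> borel_measurable borel" unfolding Q_def
    using open_upper_half_plane holomorphic_on_imp_continuous_on[OF qd_lift_holomorphic[OF \<phi>]]
    by (intro borel_measurable_continuous_on_if) auto
  have "(\<integral>\<^sup>+z\<in>D. ennreal (cmod (qd_lift A p \<phi> z)) \<partial>lborel)
     \<le> (\<integral>\<^sup>+z. (\<Sum>c\<in>used_charts. ennreal (cmod (Q z)) * indicator (B c) z) \<partial>lborel)"
  proof (intro nn_integral_mono)
    fix z
    show "ennreal (cmod (qd_lift A p \<phi> z)) * indicator D z \<le> (\<Sum>c\<in>used_charts. ennreal (cmod (Q z)) * indicator (B c) z)"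
    proof (cases "z \<in> D")
      case True
      then have zH: "z \<in> H" using D by blast
      then obtain c where c: "c \<in> used_charts" "p z \<in> cell c" using p_in used_charts(5) by blast
      have "ennreal (cmod (qd_lift A p \<phi> z)) * indicator D z = ennreal (cmod (Q z)) * indicator (B c) z"
        using True zH c by (simp add: Q_def B_def)
      also have "\<dots> \<le> (\<Sum>c\<in>used_charts. ennreal (cmod (Q z)) * indicator (B c) z)"
        by (rule member_le_sum) (use c used_charts(1) in auto)
      finally show ?thesis .
    qed simp
  qed
  also have "\<dots> = (\<Sum>c\<in>used_charts. \<integral>\<^sup>+z. ennreal (cmod (Q z)) * indicator (B c) z \<partial>lborel)"
  proof (rule nn_integral_sum)
    fix c assume "c \<in> used_charts"
    then have "c \<in> A" using used_charts(2) by blast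
    then have "B c \<in> sets borel" by (rule B(1))
    moreover have "(\<lambda>z. ennreal (cmod (Q z))) \<in> borel_measurable borel" using Q by measurable
    ultimately show "(\<lambda>z. ennreal (cmod (Q z)) * indicator (B c) z) \<in> borel_measurable lborel"
      by (intro borel_measurable_times_ennreal borel_measurable_indicator) auto
  qed
  also have "\<dots> \<le> nn_norm \<phi>" unfolding nn_norm_def
  proof (rule sum_mono)
    fix c assume "c \<in> used_charts"
    then have c: "c \<in> A" using used_charts(2) by blast
    have "(\<integral>\<^sup>+z. ennreal (cmod (Q z)) * indicator (B c) z \<partial>lborel) = (\<integral>\<^sup>+z\<in>B c. ennreal (cmod (qd_lift A p \<phi> z)) \<partial>lborel)"
      by (intro nn_integral_cong) (auto simp: indicator_def Q_def B_def)
    also have "\<dots> = (\<integral>\<^sup>+w\<in>snd c ` p ` B c. coeff_density \<phi> c w \<partial>lborel)"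
      by (rule nn_integral_piece[OF \<phi> c D B(1,2,3)[OF c], symmetric])
    also have "\<dots> \<le> (\<integral>\<^sup>+w\<in>snd c ` cell c. coeff_density \<phi> c w \<partial>lborel)"
      using B(4)[OF c] by (intro nn_integral_mono) (auto simp: indicator_def)
    finally show "(\<integral>\<^sup>+z. ennreal (cmod (Q z)) * indicator (B c) z \<partial>lborel) \<le> (\<integral>\<^sup>+w\<in>snd c ` cell c. coeff_density \<phi> c w \<partial>lborel)" .
  qed
  finally show ?thesis .
qed

text \<open>Mean value inequality on discs contained in discs where \<open>p\<close> is injective. Compactness of \<open>D\<close> makes their radii bounded below.\<close>

theorem sup_le_qd_norm:
  assumes D: "compact D" "D \<subseteq> H"
  obtains C where "C > 0" "\<And>\<phi> z. \<phi> \<in> quadratic_differentials A \<Longrightarrow> z \<in> D \<Longrightarrow> cmod (qd_lift A p \<phi> z) \<le> C * qd_norm X A \<phi>"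
proof -
  have "\<exists>d>0. ball z (2 * d) \<subseteq> H \<and> inj_on p (ball z (2 * d))" if zH: "z \<in> H" for z
  proof -
    obtain d where "d > 0" "ball z d \<subseteq> H" "inj_on p (ball z d)" using local_injectivity[OF zH] .
    then show ?thesis by (intro exI[of _ "d / 2"]) auto
  qed
  then obtain d where d: "\<And>z. z \<in> H \<Longrightarrow> d z > 0 \<and> ball z (2 * d z) \<subseteq> H \<and> inj_on p (ball z (2 * d z))" by metis
  have cov: "D \<subseteq> (\<Union>z\<in>D. ball z (d z))" using d D(2) by force
  obtain S where S: "S \<subseteq> D" "finite S" "D \<subseteq> (\<Union>z\<in>S. ball z (d z))"
    using compactE_image[OF D(1) _ cov] by auto
  define C where "C = (\<Sum>z\<in>S. 4 / (pi * (d z)\<^sup>2)) + 1"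
  have nn: "0 \<le> 4 / (pi * (d z)\<^sup>2)" for z by simp
  show ?thesis
  proof (rule that[of C])
    show "C > 0" unfolding C_def using nn by (simp add: sum_nonneg add_nonneg_pos)
    fix \<phi> w assume \<phi>: "\<phi> \<in> quadratic_differentials A" and w: "w \<in> D"
    let ?q = "qd_lift A p \<phi>"
    obtain z where z: "z \<in> S" "w \<in> ball z (d z)" using S(3) w by blast
    have dz: "d z > 0" "ball z (2 * d z) \<subseteq> H" "inj_on p (ball z (2 * d z))" using d[of z] z(1) S(1) D(2) by auto
    have sub: "cball w (d z / 2) \<subseteq> ball z (2 * d z)"
    proof
      fix v assume "v \<in> cball w (d z / 2)"
      then have "dist z v < d z + d z / 2" using z(2) dist_triangle[of z v w] by (simp add: dist_commute)
      then show "v \<in> ball z (2 * d z)" using dz(1) by simp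
    qed
    have "ennreal (pi * (d z / 2)\<^sup>2 * cmod (?q w)) \<le> (\<integral>\<^sup>+v\<in>ball w (d z / 2). ennreal (cmod (?q v)) \<partial>lborel)"
      by (rule area_mean_value[OF open_upper_half_plane _ qd_lift_holomorphic[OF \<phi>]]) (use sub dz in auto)
    also have "\<dots> \<le> (\<integral>\<^sup>+v\<in>ball z (2 * d z). ennreal (cmod (?q v)) \<partial>lborel)"
    proof (intro nn_integral_mono)
      have "ball w (d z / 2) \<subseteq> ball z (2 * d z)" using sub ball_subset_cball by blast
      then show "ennreal (cmod (?q v)) * indicator (ball w (d z / 2)) v \<le> ennreal (cmod (?q v)) * indicator (ball z (2 * d z)) v" for v
        by (cases "v \<in> ball w (d z / 2)") auto
    qed
    also have "\<dots> \<le> nn_norm \<phi>" by (rule nn_integral_lift_le_norm[OF \<phi> open_ball dz(2,3)])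
    also have "\<dots> = ennreal (qd_norm X A \<phi>)" by (rule nn_norm_eq(1)[OF \<phi>])
    finally have "pi * (d z / 2)\<^sup>2 * cmod (?q w) \<le> qd_norm X A \<phi>"
      using nn_norm_eq(2)[OF \<phi>] by (simp add: ennreal_le_iff)
    then have "cmod (?q w) \<le> 4 / (pi * (d z)\<^sup>2) * qd_norm X A \<phi>"
      using dz(1) by (simp add: field_simps power_divide)
    also have "\<dots> \<le> C * qd_norm X A \<phi>"
    proof (rule mult_right_mono[OF _ nn_norm_eq(2)[OF \<phi>]])
      have "4 / (pi * (d z)\<^sup>2) \<le> (\<Sum>z\<in>S. 4 / (pi * (d z)\<^sup>2))" by (rule member_le_sum) (use z S nn in auto)
      then show "4 / (pi * (d z)\<^sup>2) \<le> C" by (simp add: C_def)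
    qed
    finally show "cmod (?q w) \<le> C * qd_norm X A \<phi>" .
  qed
qed

end

section \<open>Growth of holonomy\<close>

lemma frobenius_bounds_action:
  "(cmod (M$1$1 * x + M$1$2 * y))\<^sup>2 + (cmod (M$2$1 * x + M$2$2 * y))\<^sup>2 \<le> frobenius_sq M * ((cmod x)\<^sup>2 + (cmod y)\<^sup>2)"
proof -
  have row: "(cmod (a * x + b * y))\<^sup>2 \<le> ((cmod a)\<^sup>2 + (cmod b)\<^sup>2) * ((cmod x)\<^sup>2 + (cmod y)\<^sup>2)" for a b
  proof -
    have "(cmod (a * x + b * y))\<^sup>2 \<le> (cmod a * cmod x + cmod b * cmod y)\<^sup>2"
      by (intro power_mono order_trans[OF norm_triangle_ineq]) (auto simp: norm_mult)
    also have "\<dots> = ((cmod a)\<^sup>2 + (cmod b)\<^sup>2) * ((cmod x)\<^sup>2 + (cmod y)\<^sup>2) - (cmod a * cmod y - cmod b * cmod x)\<^sup>2"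
      by (simp add: power2_eq_square algebra_simps)
    also have "\<dots> \<le> ((cmod a)\<^sup>2 + (cmod b)\<^sup>2) * ((cmod x)\<^sup>2 + (cmod y)\<^sup>2)" by simp
    finally show ?thesis .
  qed
  show ?thesis using row[of "M$1$1" "M$1$2"] row[of "M$2$1" "M$2$2"]
    by (simp add: frobenius_sq_def algebra_simps)
qed

context uniformized begin

text \<open>The data that both bounds are about, for a single differential. Their constants do not depend on the choice of the developing map or of the
representation.\<close>

definition holonomy_pair :: "'a qdiff \<Rightarrow> (complex \<Rightarrow> sphere) \<Rightarrow> ((complex \<Rightarrow> complex) \<Rightarrow> complex^2^2) \<Rightarrow> bool" where
  "holonomy_pair \<phi> f r \<longleftrightarrow> \<phi> \<in> quadratic_differentials A \<and> developing_map (qd_lift A p \<phi>) f \<and>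
     r \<in> hom (deck_group p) SL2C \<and> (\<forall>\<gamma>\<in>carrier (deck_group p). \<forall>\<tau>\<in>H. f (\<gamma> \<tau>) = moebius_act (r \<gamma>) (f \<tau>))"

lemma deck_mult:
  assumes "\<gamma> \<in> carrier (deck_group p)" "\<delta> \<in> carrier (deck_group p)"
  shows "\<gamma> \<otimes>\<^bsub>deck_group p\<^esub> \<delta> \<in> carrier (deck_group p)"
proof -
  have B: "\<gamma> \<in> Bij H" "\<delta> \<in> Bij H" using assms by (auto simp: deck_group_def)
  have m: "\<gamma> \<otimes>\<^bsub>deck_group p\<^esub> \<delta> = compose H \<gamma> \<delta>"
    using B by (simp add: deck_group_def BijGroup_def)
  have "homeomorphic_map (top_of_set H) (top_of_set H) (\<gamma> \<circ> \<delta>)"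
    using assms by (intro homeomorphic_map_compose[of _ "top_of_set H"]) (auto simp: deck_group_def)
  then have "homeomorphic_map (top_of_set H) (top_of_set H) (compose H \<gamma> \<delta>)"
    by (rule homeomorphic_map_eq) (auto simp: compose_eq)
  then show ?thesis
    unfolding m using compose_Bij[OF B] assms deck_elem(4)[OF assms(2)]
    by (auto simp: deck_group_def compose_eq)
qed

lemma holonomy_det:
  assumes "holonomy_pair \<phi> f r" "\<gamma> \<in> carrier (deck_group p)"
  shows "det (r \<gamma>) = 1"
  using assms by (auto simp: holonomy_pair_def hom_def SL2C_def)

lemma holonomy_mult:
  assumes "holonomy_pair \<phi> f r" "\<gamma> \<in> carrier (deck_group p)" "\<delta> \<in> carrier (deck_group p)"
  shows "r (\<gamma> \<otimes>\<^bsub>deck_group p\<^esub> \<delta>) = r \<gamma> ** r \<delta>"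
  using assms by (auto simp: holonomy_pair_def hom_def SL2C_def)

lemma form_transform:
  assumes h: "holonomy_pair \<phi> f r" and \<gamma>: "\<gamma> \<in> carrier (deck_group p)" and z: "z \<in> H"
  shows "developing_form f a b (\<gamma> z) = deriv \<gamma> z * developing_form f (a * r \<gamma>$1$1 + b * r \<gamma>$2$1) (a * r \<gamma>$1$2 + b * r \<gamma>$2$2) z"
proof (rule developing_form_equivariant)
  show "developing_map (qd_lift A p \<phi>) f" using h by (simp add: holonomy_pair_def)
  show "\<gamma> holomorphic_on H" by (rule deck_holomorphic[OF \<gamma>])
  show "inj_on \<gamma> H" "\<gamma> ` H \<subseteq> H" using deck_elem(1)[OF \<gamma>] by (auto simp: bij_betw_def)
  show "det (r \<gamma>) = 1" by (rule holonomy_det[OF h \<gamma>])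
  show "\<And>z. z \<in> H \<Longrightarrow> f (\<gamma> z) = moebius_act (r \<gamma>) (f z)" using h \<gamma> by (simp add: holonomy_pair_def)
qed (rule z)

text \<open>The squared length of the vector \<open>B (u, v)\<close>, which is independent of the sign of \<open>(u, v)\<close>.\<close>

definition form_norm :: "(complex \<Rightarrow> sphere) \<Rightarrow> complex^2^2 \<Rightarrow> complex \<Rightarrow> real" where
  "form_norm f B z = cmod (developing_form f (B$1$1) (B$1$2) z) + cmod (developing_form f (B$2$1) (B$2$2) z)"

lemma form_norm_rank_one:
  assumes "\<And>a b. developing_form f a b z = (a * u + b * v)\<^sup>2"
  shows "form_norm f B z = (cmod (B$1$1 * u + B$1$2 * v))\<^sup>2 + (cmod (B$2$1 * u + B$2$2 * v))\<^sup>2"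
  by (simp add: form_norm_def assms norm_power)

text \<open>In the coordinates \<open>B (u, v)\<close> the holonomy of \<open>\<gamma>\<close> is the matrix \<open>B (r \<gamma>) C\<close>, which stretches vectors by at most its Frobenius norm. The
remaining factor \<open>\<bar>\<gamma>'\<bar>\<close> is the ratio of imaginary parts.\<close>

lemma form_norm_transform:
  assumes h: "holonomy_pair \<phi> f r" and \<gamma>: "\<gamma> \<in> carrier (deck_group p)" and z: "z \<in> H" and AB: "C ** B = mat 1"
  shows "form_norm f B (\<gamma> z) / Im (\<gamma> z) \<le> frobenius_sq (B ** r \<gamma> ** C) * (form_norm f B z / Im z)"
proof -
  have f: "developing_map (qd_lift A p \<phi>) f" using h by (simp add: holonomy_pair_def)
  obtain u v where uv: "\<And>a b. developing_form f a b z = (a * u + b * v)\<^sup>2" using developing_form_rank_one[OF f z] by metis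
  define M where "M = r \<gamma>"
  define x y where "x = B$1$1 * u + B$1$2 * v" "y = B$2$1 * u + B$2$2 * v"
  note xy = this
  define L where "L = B ** M ** C"
  have BM: "B ** M = L ** B" unfolding L_def using AB by (metis matrix_mul_assoc matrix_mul_rid)
  have ent: "(B ** M)$i$1 = L$i$1 * B$1$1 + L$i$2 * B$2$1" "(B ** M)$i$2 = L$i$1 * B$1$2 + L$i$2 * B$2$2" for i
    unfolding BM by (simp_all add: matrix_matrix_mult_def sum_2)
  have BMi: "(B ** M)$i$1 = B$i$1 * M$1$1 + B$i$2 * M$2$1" "(B ** M)$i$2 = B$i$1 * M$1$2 + B$i$2 * M$2$2" for i
    by (simp_all add: matrix_matrix_mult_def sum_2)
  have row: "developing_form f (B$i$1) (B$i$2) (\<gamma> z) = deriv \<gamma> z * (L$i$1 * x + L$i$2 * y)\<^sup>2" for i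
  proof -
    have "developing_form f (B$i$1) (B$i$2) (\<gamma> z) = deriv \<gamma> z * ((B ** M)$i$1 * u + (B ** M)$i$2 * v)\<^sup>2"
      unfolding form_transform[OF h \<gamma> z] M_def[symmetric] uv BMi ..
    also have "(B ** M)$i$1 * u + (B ** M)$i$2 * v = L$i$1 * x + L$i$2 * y"
      unfolding ent xy by (simp add: algebra_simps)
    finally show ?thesis .
  qed
  have "form_norm f B (\<gamma> z) = cmod (deriv \<gamma> z) * ((cmod (L$1$1 * x + L$1$2 * y))\<^sup>2 + (cmod (L$2$1 * x + L$2$2 * y))\<^sup>2)"
    unfolding form_norm_def row by (simp add: norm_mult norm_power algebra_simps)
  also have "\<dots> \<le> cmod (deriv \<gamma> z) * (frobenius_sq L * form_norm f B z)"
    unfolding form_norm_rank_one[OF uv] xy[symmetric] by (intro mult_left_mono frobenius_bounds_action) auto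
  finally have le: "form_norm f B (\<gamma> z) \<le> cmod (deriv \<gamma> z) * (frobenius_sq L * form_norm f B z)" .
  have Imz: "Im z > 0" "Im (\<gamma> z) > 0" using z deck_elem(4)[OF \<gamma> z] by (auto simp: upper_half_plane_def)
  have dz: "cmod (deriv \<gamma> z) = Im (\<gamma> z) / Im z" using deck_Im[OF \<gamma> z] Imz by (simp add: field_simps)
  show ?thesis using le[unfolded dz L_def M_def] Imz by (simp add: field_simps)
qed

text \<open>The function \<open>\<bar>B (u, v)\<bar>\<^sup>2 / Im z\<close> has a maximum on \<open>K\<close>, at \<open>z1\<close> say, and the transformation rule bounds it on the translates of \<open>K\<close> by \<open>\<Lambda>\<close> times this
maximum. The required form is the square of the linear functional dual to the vector at \<open>z1\<close>.\<close>

lemma extremal_form: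
  assumes h: "holonomy_pair \<phi> f r" and AB: "C ** B = mat 1" and K: "compact K" "K \<subseteq> H" "K \<noteq> {}"
    and S: "S \<subseteq> carrier (deck_group p)" "\<And>z. z \<in> D \<Longrightarrow> \<exists>\<gamma>\<in>S. \<exists>k\<in>K. z = \<gamma> k"
    and \<Lambda>: "\<And>\<gamma>. \<gamma> \<in> S \<Longrightarrow> frobenius_sq (B ** r \<gamma> ** C) \<le> \<Lambda>"
  obtains z1 a b where "z1 \<in> K" "developing_form f a b z1 = 1" "\<And>z. z \<in> D \<Longrightarrow> cmod (developing_form f a b z) \<le> \<Lambda> * (Im z / Im z1)"
proof -
  have f: "developing_map (qd_lift A p \<phi>) f" using h by (simp add: holonomy_pair_def)
  have ch: "continuous_on H (developing_form f a b)" for a b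
    by (rule holomorphic_on_imp_continuous_on[OF developing_form_holomorphic[OF f]])
  have "continuous_on H (\<lambda>z. form_norm f B z / Im z)"
    unfolding form_norm_def by (intro continuous_intros ch) (auto simp: upper_half_plane_def)
  then have "continuous_on K (\<lambda>z. form_norm f B z / Im z)" using K(2) continuous_on_subset by blast
  then obtain z1 where z1: "z1 \<in> K" "\<And>z. z \<in> K \<Longrightarrow> form_norm f B z / Im z \<le> form_norm f B z1 / Im z1"
    using continuous_attains_sup[OF K(1,3)] by blast
  have z1H: "z1 \<in> H" using z1(1) K(2) by blast
  obtain u v where uv: "u \<noteq> 0 \<or> v \<noteq> 0" "\<And>a b. developing_form f a b z1 = (a * u + b * v)\<^sup>2"
    using developing_form_rank_one[OF f z1H] by metis
  define x y where "x = B$1$1 * u + B$1$2 * v" "y = B$2$1 * u + B$2$2 * v"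
  note xy = this
  define n where "n = (cmod x)\<^sup>2 + (cmod y)\<^sup>2"
  have fn: "form_norm f B z1 = n" unfolding form_norm_rank_one[OF uv(2)] n_def xy ..
  have "x \<noteq> 0 \<or> y \<noteq> 0"
  proof (rule ccontr)
    assume "\<not> (x \<noteq> 0 \<or> y \<noteq> 0)"
    then have 0: "x = 0" "y = 0" by auto
    have e: "C$1$1 * B$1$1 + C$1$2 * B$2$1 = 1" "C$1$1 * B$1$2 + C$1$2 * B$2$2 = 0"
      "C$2$1 * B$1$1 + C$2$2 * B$2$1 = 0" "C$2$1 * B$1$2 + C$2$2 * B$2$2 = 1"
      using AB unfolding mat2_eq_iff mat2_mult mat2_one by auto
    have "C$1$1 * x + C$1$2 * y = (C$1$1 * B$1$1 + C$1$2 * B$2$1) * u + (C$1$1 * B$1$2 + C$1$2 * B$2$2) * v"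
      "C$2$1 * x + C$2$2 * y = (C$2$1 * B$1$1 + C$2$2 * B$2$1) * u + (C$2$1 * B$1$2 + C$2$2 * B$2$2) * v"
      by (simp_all add: xy algebra_simps)
    then show False using uv(1) 0 unfolding e by simp
  qed
  then have n: "n > 0" by (auto simp: n_def intro: add_pos_nonneg add_nonneg_pos)
  \<comment> \<open>The functional of least norm, namely \<open>1 / \<surd>n\<close>, that takes the value 1 on \<open>(x, y)\<close>.\<close>
  define \<alpha> \<beta> where "\<alpha> = cnj x / of_real n" "\<beta> = cnj y / of_real n"
  note ab = this
  define a b where "a = \<alpha> * B$1$1 + \<beta> * B$2$1" "b = \<alpha> * B$1$2 + \<beta> * B$2$2"
  note AB' = this
  have nrm: "(cmod \<alpha>)\<^sup>2 + (cmod \<beta>)\<^sup>2 = 1 / n"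
  proof -
    have "(cmod \<alpha>)\<^sup>2 + (cmod \<beta>)\<^sup>2 = ((cmod x)\<^sup>2 + (cmod y)\<^sup>2) / n\<^sup>2"
      using n by (simp add: ab norm_divide power_divide add_divide_distrib)
    also have "\<dots> = n / n\<^sup>2" by (simp only: n_def)
    finally have "(cmod \<alpha>)\<^sup>2 + (cmod \<beta>)\<^sup>2 = n / n\<^sup>2" .
    then show ?thesis using n by (simp add: power2_eq_square)
  qed
  have "a * u + b * v = \<alpha> * x + \<beta> * y" by (simp add: AB' xy algebra_simps)
  also have "\<dots> = (x * cnj x + y * cnj y) / of_real n" by (simp add: ab add_divide_distrib mult.commute)
  also have "x * cnj x + y * cnj y = of_real n" by (simp add: n_def of_real_cmod_sq)
  finally have one: "developing_form f a b z1 = 1" using n uv(2)[of a b] by simp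
  have bound: "cmod (developing_form f a b z) \<le> \<Lambda> * (Im z / Im z1)" if z: "z \<in> D" for z
  proof -
    obtain \<gamma> k where gk: "\<gamma> \<in> S" "k \<in> K" "z = \<gamma> k" using S(2)[OF z] by blast
    have \<gamma>: "\<gamma> \<in> carrier (deck_group p)" using gk(1) S(1) by blast
    have kH: "k \<in> H" using gk(2) K(2) by blast
    then have zH: "z \<in> H" using deck_elem(4)[OF \<gamma>] gk(3) by simp
    have Im: "Im z > 0" "Im z1 > 0" "Im k > 0" using zH z1H kH by (auto simp: upper_half_plane_def)
    obtain u' v' where uv': "\<And>a b. developing_form f a b z = (a * u' + b * v')\<^sup>2" using developing_form_rank_one[OF f zH] by metis
    define x' y' where "x' = B$1$1 * u' + B$1$2 * v'" "y' = B$2$1 * u' + B$2$2 * v'"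
    note xy' = this
    have "form_norm f B z / Im z \<le> frobenius_sq (B ** r \<gamma> ** C) * (form_norm f B k / Im k)"
      using form_norm_transform[OF h \<gamma> kH AB] gk(3) by simp
    also have "\<dots> \<le> \<Lambda> * (n / Im z1)"
    proof (intro mult_mono)
      show "form_norm f B k / Im k \<le> n / Im z1" using z1(2)[OF gk(2)] fn by simp
      show "0 \<le> form_norm f B k / Im k" using Im by (simp add: form_norm_def)
      have "0 \<le> frobenius_sq (B ** r \<gamma> ** C)" by (simp add: frobenius_sq_def)
      then show "0 \<le> \<Lambda>" using \<Lambda>[OF gk(1)] by linarith
    qed (rule \<Lambda>[OF gk(1)])
    finally have N: "form_norm f B z \<le> \<Lambda> * n * (Im z / Im z1)" using Im by (simp add: field_simps)
    have "a * u' + b * v' = \<alpha> * x' + \<beta> * y'" by (simp add: AB' xy' algebra_simps)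
    then have "cmod (developing_form f a b z) = (cmod (\<alpha> * x' + \<beta> * y'))\<^sup>2" by (simp add: uv' norm_power)
    also have "\<dots> \<le> frobenius_sq (mat2 \<alpha> \<beta> 0 0) * ((cmod x')\<^sup>2 + (cmod y')\<^sup>2)"
      using frobenius_bounds_action[of "mat2 \<alpha> \<beta> 0 0" x' y'] by simp
    also have "\<dots> = 1 / n * form_norm f B z"
      unfolding form_norm_rank_one[OF uv'] xy'[symmetric] using nrm by (simp add: frobenius_sq_def)
    also have "\<dots> \<le> 1 / n * (\<Lambda> * n * (Im z / Im z1))" using N n by (intro mult_left_mono) auto
    also have "\<dots> = \<Lambda> * (Im z / Im z1)" using n by simp
    finally show ?thesis .
  qed
  show ?thesis by (rule that[OF z1(1) one bound])
qed

text \<open>In the disc coordinate centred at \<open>z1\<close> the imaginary part is \<open>Im z1 (1 - \<bar>w\<bar>\<^sup>2) / \<bar>1 - w\<bar>\<^sup>2\<close>. Multiplying the form by \<open>(1 - w)\<^sup>2\<close> gives a holomorphic function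
with value 1 at the centre and modulus at most \<open>\<Lambda> (1 - t\<^sup>2)\<close> on the circle of radius \<open>t\<close>. For \<open>t\<close> near 1 this excludes small \<open>\<Lambda>\<close>.\<close>

lemma form_forces_expansion:
  assumes f: "developing_map q f" and z1: "z1 \<in> H" "developing_form f a b z1 = 1" and t: "0 < t" "t < 1"
    and le: "\<And>w. cmod w \<le> t \<Longrightarrow> cmod (developing_form f a b (disc_to_half z1 w)) \<le> \<Lambda> * (Im (disc_to_half z1 w) / Im z1)"
  shows "1 \<le> \<Lambda> * (1 - t\<^sup>2)"
proof -
  define g where "g = (\<lambda>w. developing_form f a b (disc_to_half z1 w) * (1 - w)\<^sup>2)"
  have im: "disc_to_half z1 ` ball 0 1 \<subseteq> H" using disc_to_half_in[OF z1(1)] by auto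
  from holomorphic_on_compose_gen[OF disc_to_half_holomorphic developing_form_holomorphic[OF f] this, of a b]
  have "(\<lambda>w. developing_form f a b (disc_to_half z1 w)) holomorphic_on ball 0 1" by (simp add: o_def)
  then have g: "g holomorphic_on ball 0 1" unfolding g_def by (intro holomorphic_intros)
  have sub: "cball 0 t \<subseteq> ball (0::complex) 1" using t by auto
  have "cmod (g 0) \<le> \<Lambda> * (1 - t\<^sup>2)"
  proof (rule maximum_modulus_frontier[of g "cball 0 t"])
    show "g holomorphic_on interior (cball 0 t)"
      using g sub by (metis holomorphic_on_subset interior_subset order_trans)
    show "continuous_on (closure (cball 0 t)) g"
      using holomorphic_on_imp_continuous_on[OF g] sub by (metis closed_cball closure_closed continuous_on_subset)
    fix w :: complex assume "w \<in> frontier (cball 0 t)"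
    then have w: "cmod w = t" using t by (simp add: frontier_cball)
    have w1: "cmod (1 - w) > 0" using w t by auto
    have Imz: "Im z1 > 0" using z1(1) by (simp add: upper_half_plane_def)
    have "cmod (g w) \<le> \<Lambda> * (Im (disc_to_half z1 w) / Im z1) * (cmod (1 - w))\<^sup>2"
      unfolding g_def norm_mult norm_power using le[of w] w by (intro mult_right_mono) auto
    also have "Im (disc_to_half z1 w) = Im z1 * (1 - t\<^sup>2) / (cmod (1 - w))\<^sup>2"
      using Im_disc_to_half[of w z1] w t by simp
    also have "\<Lambda> * (Im z1 * (1 - t\<^sup>2) / (cmod (1 - w))\<^sup>2 / Im z1) * (cmod (1 - w))\<^sup>2 = \<Lambda> * (1 - t\<^sup>2)"
      using w1 Imz by simp
    finally show "cmod (g w) \<le> \<Lambda> * (1 - t\<^sup>2)" .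
  qed (use t in auto)
  moreover have "g 0 = 1" by (simp add: g_def disc_to_half_0(1) z1(2))
  ultimately show ?thesis by simp
qed

text \<open>Let \<open>\<tau>\<close> be the largest modulus of a trace over a fixed finite set of deck transformations and their products. The extremal form shows
first \<open>\<tau> > 4\<close> and then \<open>\<surd>\<parallel>\<phi>\<parallel> = O(ln \<tau>)\<close>.\<close>

theorem holonomy_lower_bound:
  obtains c where "c > 0" "\<And>\<phi> f r. holonomy_pair \<phi> f r \<Longrightarrow>
    \<exists>\<gamma>\<in>carrier (deck_group p). translation_length (r \<gamma>) \<ge> c * sqrt (qd_norm X A \<phi>)"
proof -
  obtain a0 r0 where r0: "r0 > 0" "cball a0 r0 \<subseteq> H" "p ` ball a0 r0 = X" using compact_fundamental_disc by blast
  define R1 where "R1 = (Im a0 + r0) / 2"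
  have "a0 - of_real r0 * \<i> \<in> cball a0 r0" using r0(1) by (simp add: dist_norm norm_mult)
  then have "a0 - of_real r0 * \<i> \<in> H" using r0(2) by blast
  then have ra: "r0 < Im a0" by (simp add: upper_half_plane_def)
  have R1: "r0 < R1" "R1 < Im a0" using ra by (auto simp: R1_def)
  have ImD: "\<bar>Im z - Im a0\<bar> \<le> d" if "z \<in> cball a0 d" for z d
  proof -
    have "cmod (z - a0) \<le> d" using that by (simp add: dist_norm norm_minus_commute)
    then show ?thesis using abs_Im_le_cmod[of "z - a0"] by simp
  qed
  have R1H: "cball a0 R1 \<subseteq> H"
  proof
    fix z assume "z \<in> cball a0 R1"
    then have "Im z > 0" using ImD[of z R1] R1 by auto
    then show "z \<in> H" by (simp add: upper_half_plane_def)
  qed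
  \<comment> \<open>Since \<open>82945 = 5184 * 16 + 1\<close>, the inequality \<open>1 \<le> 5184 \<tau>\<^sup>2 (1 - t\<^sup>2)\<close> will give \<open>\<tau>\<^sup>2 > 16\<close>.\<close>
  define t where "t = sqrt (1 - 1 / 82945)"
  have t: "0 < t" "t < 1" "1 - t\<^sup>2 = 1 / 82945" by (auto simp: t_def)
  define K where "K = cball a0 r0"
  have K: "compact K" "K \<subseteq> H" "K \<noteq> {}" using r0 by (auto simp: K_def)
  define \<Psi> where "\<Psi> = (\<lambda>(z, w). disc_to_half z w)"
  \<comment> \<open>The extremal form is needed on a disc larger than \<open>K\<close> and on hyperbolic discs of fixed radius about all points of \<open>K\<close>.\<close>
  define D where "D = cball a0 R1 \<union> \<Psi> ` (K \<times> cball 0 t)"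
  have "continuous_on (K \<times> cball 0 t) \<Psi>"
    unfolding \<Psi>_def disc_to_half_def case_prod_beta using t(2)
    by (intro continuous_intros) (auto simp: dest!: sym[of "1 :: complex"])
  then have "compact D" unfolding D_def using K(1)
    by (intro compact_Un compact_continuous_image compact_Times compact_cball)
  moreover have "D \<subseteq> H" using R1H K(2) disc_to_half_in t(2) by (fastforce simp: D_def \<Psi>_def)
  ultimately obtain S where S: "finite S" "S \<subseteq> carrier (deck_group p)" "\<And>z. z \<in> D \<Longrightarrow> \<exists>\<gamma>\<in>S. \<exists>k\<in>ball a0 r0. z = \<gamma> k"
    using finite_deck_cover[of "ball a0 r0" D] r0 by (metis K_def K(2) ball_subset_cball open_ball order_trans)
  obtain CA where CA: "CA > 0" "\<And>U Y q K z1. \<lbrakk>open U; cball 0 R1 \<subseteq> U; Y holomorphic_on U; q holomorphic_on U;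
      \<And>z. z \<in> U \<Longrightarrow> (deriv Y z)\<^sup>2 - 2 * Y z * deriv (deriv Y) z = 2 * q z * (Y z)\<^sup>2;
      \<And>z. cmod z \<le> R1 \<Longrightarrow> cmod (Y z) \<le> K; cmod z1 \<le> r0; 1 \<le> cmod (Y z1)\<rbrakk> \<Longrightarrow>
      \<forall>z. cmod z \<le> r0 \<longrightarrow> cmod (q z) \<le> CA * (1 + ln K)\<^sup>2"
    by (rule potential_le_growth[OF r0(1) R1(1)]) blast
  obtain CQ where CQ: "CQ > 0" "\<And>\<phi> m. \<phi> \<in> quadratic_differentials A \<Longrightarrow> m \<ge> 0 \<Longrightarrow>
     (\<And>z. z \<in> cball a0 r0 \<Longrightarrow> cmod (qd_lift A p \<phi> z) \<le> m) \<Longrightarrow> qd_norm X A \<phi> \<le> CQ * m"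
    using qd_norm_le_sup[OF r0(2,3,1)] by metis
  define B0 where "B0 = 5184 * ((Im a0 + R1) / (Im a0 - r0))"
  have B0: "B0 > 0" using R1 r0 by (simp add: B0_def)
  define CL where "CL = 3 + \<bar>ln B0\<bar>"
  define c where "c = 1 / (sqrt (CQ * CA) * CL)"
  have c: "c > 0" using CQ(1) CA(1) by (simp add: c_def CL_def add_pos_nonneg)
  show ?thesis
  proof (rule that[OF c])
    fix \<phi> f r assume h: "holonomy_pair \<phi> f r"
    have \<phi>: "\<phi> \<in> quadratic_differentials A" and f: "developing_map (qd_lift A p \<phi>) f"
      using h by (auto simp: holonomy_pair_def)
    define q where "q = qd_lift A p \<phi>"
    define G where "G = S \<union> (\<lambda>(s, s'). s \<otimes>\<^bsub>deck_group p\<^esub> s') ` (S \<times> S)"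
    have G: "finite G" "G \<subseteq> carrier (deck_group p)" using S(1,2) deck_mult by (auto simp: G_def)
    define T where "T = insert 1 ((\<lambda>\<gamma>. cmod (trace (r \<gamma>))) ` G)"
    define \<tau> where "\<tau> = Max T"
    have T: "finite T" "T \<noteq> {}" using G by (auto simp: T_def)
    have \<tau>1: "\<tau> \<ge> 1" unfolding \<tau>_def using T by (intro Max_ge) (auto simp: T_def)
    have \<tau>G: "cmod (trace (r \<gamma>)) \<le> \<tau>" if "\<gamma> \<in> G" for \<gamma>
      unfolding \<tau>_def using T that by (intro Max_ge) (auto simp: T_def)
    obtain C B where CB: "C ** B = mat 1" "\<And>s. s \<in> r ` S \<Longrightarrow> frobenius_sq (B ** s ** C) \<le> 5184 * \<tau>\<^sup>2"
    proof (rule conj_bounded_by_traces[of "r ` S" \<tau>])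
      show "finite (r ` S)" using S(1) by simp
      show "det s = 1" if "s \<in> r ` S" for s using that holonomy_det[OF h] S(2) by blast
      show "cmod (trace s) \<le> \<tau>" if "s \<in> r ` S" for s using that \<tau>G by (auto simp: G_def)
      show "cmod (trace (s ** s')) \<le> \<tau>" if ss: "s \<in> r ` S" "s' \<in> r ` S" for s s'
      proof -
        obtain x y where x: "x \<in> S" "s = r x" and y: "y \<in> S" "s' = r y" using ss by blast
        have "s ** s' = r (x \<otimes>\<^bsub>deck_group p\<^esub> y)" 
          using holonomy_mult[OF h subsetD[OF S(2) x(1)] subsetD[OF S(2) y(1)]] x y by simp
        moreover have "x \<otimes>\<^bsub>deck_group p\<^esub> y \<in> G" using x y by (force simp: G_def)
        ultimately show ?thesis using \<tau>G by simp
      qed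
    qed (use \<tau>1 in auto)
    define \<Lambda> where "\<Lambda> = 5184 * \<tau>\<^sup>2"
    have SD: "\<exists>\<gamma>\<in>S. \<exists>k\<in>K. z = \<gamma> k" if "z \<in> D" for z 
      using S(3)[OF that] ball_subset_cball unfolding K_def by blast
    obtain z1 a b where z1: "z1 \<in> K" "developing_form f a b z1 = 1"
      "\<And>z. z \<in> D \<Longrightarrow> cmod (developing_form f a b z) \<le> \<Lambda> * (Im z / Im z1)"
      by (rule extremal_form[OF h CB(1) K S(2) SD, where \<Lambda> = \<Lambda>]) (use CB(2) in \<open>auto simp: \<Lambda>_def\<close>)
    have z1H: "z1 \<in> H" using z1(1) K(2) by blast
    have "1 \<le> \<Lambda> * (1 - t\<^sup>2)"
    proof (rule form_forces_expansion[OF f z1H z1(2) t(1,2)])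
      fix w assume "cmod w \<le> t"
      then have "disc_to_half z1 w \<in> D" using z1(1) by (force simp: D_def \<Psi>_def)
      then show "cmod (developing_form f a b (disc_to_half z1 w)) \<le> \<Lambda> * (Im (disc_to_half z1 w) / Im z1)" by (rule z1(3))
    qed
    then have "16 < \<tau>\<^sup>2" unfolding t(3) \<Lambda>_def by simp
    then have "4\<^sup>2 < \<tau>\<^sup>2" by simp
    then have \<tau>4: "4 < \<tau>" using \<tau>1 power2_less_imp_less[of 4 \<tau>] by simp
    have ln4: "ln \<tau> \<ge> 1"
    proof -
      have "exp (1::real) \<le> 3" by (rule exp_le)
      then have "exp 1 \<le> \<tau>" using \<tau>4 by simp
      then show ?thesis using \<tau>1 by (simp add: ln_ge_iff)
    qed
    define K2 where "K2 = B0 * \<tau>\<^sup>2"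
    have "\<forall>z. cmod z \<le> r0 \<longrightarrow> cmod (q (a0 + z)) \<le> CA * (1 + ln K2)\<^sup>2"
    proof (rule CA(2)[of "(\<lambda>z. a0 + z) -` H" "\<lambda>z. developing_form f a b (a0 + z)" "\<lambda>z. q (a0 + z)" K2 "z1 - a0"])
      show oU: "open ((\<lambda>z. a0 + z) -` H)" by (intro open_vimage open_upper_half_plane continuous_intros)
      show "cball 0 R1 \<subseteq> (\<lambda>z. a0 + z) -` H" using R1H by (auto simp: dist_norm subset_iff)
      have comp: "(\<lambda>z. g (a0 + z)) holomorphic_on (\<lambda>z. a0 + z) -` H" if "g holomorphic_on H" for g
        using holomorphic_on_compose_gen[of "\<lambda>z. a0 + z" "(\<lambda>z. a0 + z) -` H" g H] that
        by (force simp: o_def intro!: holomorphic_intros)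
      note Yh = developing_form_holomorphic[OF f, of a b]
      show "(\<lambda>z. developing_form f a b (a0 + z)) holomorphic_on (\<lambda>z. a0 + z) -` H" by (rule comp[OF Yh])
      show "(\<lambda>z. q (a0 + z)) holomorphic_on (\<lambda>z. a0 + z) -` H"
        unfolding q_def by (rule comp[OF qd_lift_holomorphic[OF \<phi>]])
      have shift: "deriv (\<lambda>z. g (a0 + z)) z = deriv g (a0 + z)" if "g holomorphic_on H" "a0 + z \<in> H" for g z
      proof (rule DERIV_imp_deriv)
        have "(g has_field_derivative deriv g (a0 + z)) (at (a0 + z))"
          using holomorphic_derivI[OF that(1) open_upper_half_plane that(2)] by simp
        then show "((\<lambda>z. g (a0 + z)) has_field_derivative deriv g (a0 + z)) (at z)"
          using DERIV_shift[of g "deriv g (a0 + z)" z a0] by (simp add: add.commute)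
      qed
      show "(deriv (\<lambda>z. developing_form f a b (a0 + z)) z)\<^sup>2 - 2 * developing_form f a b (a0 + z) * deriv (deriv (\<lambda>z. developing_form f a b (a0 + z))) z
         = 2 * q (a0 + z) * (developing_form f a b (a0 + z))\<^sup>2" if z: "z \<in> (\<lambda>z. a0 + z) -` H" for z
      proof -
        have "deriv (deriv (\<lambda>z. developing_form f a b (a0 + z))) z = deriv (\<lambda>z. deriv (developing_form f a b) (a0 + z)) z"
        proof (rule complex_derivative_transform_within_open[OF _ _ oU z])
          show "deriv (\<lambda>z. developing_form f a b (a0 + z)) holomorphic_on (\<lambda>z. a0 + z) -` H"
            by (intro holomorphic_deriv comp[OF Yh] oU)
          show "(\<lambda>z. deriv (developing_form f a b) (a0 + z)) holomorphic_on (\<lambda>z. a0 + z) -` H"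
            by (intro comp holomorphic_deriv Yh open_upper_half_plane)
        qed (use shift[OF Yh] in auto)
        also have "\<dots> = deriv (deriv (developing_form f a b)) (a0 + z)"
          using z by (intro shift holomorphic_deriv Yh open_upper_half_plane) auto
        finally show ?thesis
          using developing_form_Riccati[OF f, of "a0 + z" a b] shift[OF Yh, of z] z by (simp add: q_def)
      qed
      show "cmod (developing_form f a b (a0 + z)) \<le> K2" if z: "cmod z \<le> R1" for z
      proof -
        have zc: "a0 + z \<in> cball a0 R1" using z by (simp add: dist_norm)
        have "cmod (developing_form f a b (a0 + z)) \<le> \<Lambda> * (Im (a0 + z) / Im z1)"
          by (rule z1(3)) (use zc in \<open>simp add: D_def\<close>)
        also have "\<dots> \<le> \<Lambda> * ((Im a0 + R1) / (Im a0 - r0))"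
        proof (intro mult_left_mono frac_le)
          show "Im (a0 + z) \<le> Im a0 + R1" using ImD[OF zc] by auto
          show "Im a0 - r0 \<le> Im z1" using ImD[of z1 r0] z1(1) by (auto simp: K_def)
        qed (use ra R1 r0 in \<open>auto simp: \<Lambda>_def\<close>)
        also have "\<dots> = K2" by (simp add: K2_def B0_def \<Lambda>_def)
        finally show ?thesis .
      qed
      show "cmod (z1 - a0) \<le> r0" using z1(1) by (simp add: K_def dist_norm norm_minus_commute)
      show "1 \<le> cmod (developing_form f a b (a0 + (z1 - a0)))" using z1(2) by simp
    qed
    then have qb: "cmod (q z) \<le> CA * (1 + ln K2)\<^sup>2" if "z \<in> cball a0 r0" for z
      using that by (metis add_diff_cancel_left' diff_add_cancel add.commute dist_norm mem_cball norm_minus_commute)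
    have "1 + ln K2 = 1 + ln B0 + 2 * ln \<tau>" unfolding K2_def using B0 \<tau>1 by (simp add: ln_mult ln_realpow)
    then have L1: "1 + ln K2 \<le> CL * ln \<tau>"
    proof -
      assume e: "1 + ln K2 = 1 + ln B0 + 2 * ln \<tau>"
      have "(1 + \<bar>ln B0\<bar>) * 1 \<le> (1 + \<bar>ln B0\<bar>) * ln \<tau>" using ln4 by (intro mult_left_mono) auto
      then show ?thesis using e by (simp add: CL_def algebra_simps)
    qed
    have K21: "1 + ln K2 \<ge> 0"
    proof -
      have "K2 \<ge> 1"
      proof -
        have "1 \<le> (Im a0 + R1) / (Im a0 - r0)" using ra R1 r0 by (simp add: le_divide_eq_1)
        then have "B0 \<ge> 1" unfolding B0_def by linarith
        moreover have "\<tau>\<^sup>2 \<ge> 1" using \<tau>1 by (simp add: one_le_power)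
        ultimately have "1 * 1 \<le> B0 * \<tau>\<^sup>2" by (intro mult_mono) auto
        then show ?thesis by (simp add: K2_def)
      qed
      then show ?thesis by simp
    qed
    have "qd_norm X A \<phi> \<le> CQ * (CA * (1 + ln K2)\<^sup>2)"
      using qb CA(1) by (intro CQ(2)[OF \<phi>]) (auto simp: q_def)
    also have "\<dots> \<le> CQ * (CA * (CL * ln \<tau>)\<^sup>2)"
      using L1 K21 CQ(1) CA(1) by (intro mult_left_mono power_mono) auto
    finally have "sqrt (qd_norm X A \<phi>) \<le> sqrt (CQ * CA * (CL * ln \<tau>)\<^sup>2)" by (intro real_sqrt_le_mono) (simp add: mult.assoc)
    also have "\<dots> = sqrt (CQ * CA) * CL * ln \<tau>" using ln4 by (simp add: real_sqrt_mult CL_def)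
    finally have "c * sqrt (qd_norm X A \<phi>) \<le> c * (sqrt (CQ * CA) * CL * ln \<tau>)" using c by (intro mult_left_mono) auto
    also have "\<dots> = ln \<tau>"
    proof -
      have "sqrt (CQ * CA) * CL > 0" using CQ(1) CA(1) by (simp add: CL_def add_pos_nonneg)
      moreover have "1 / P * (P * x) = x" if "P > 0" for P x :: real using that by simp
      ultimately show ?thesis unfolding c_def by blast
    qed
    finally have small: "c * sqrt (qd_norm X A \<phi>) \<le> ln \<tau>" .
    have "\<tau> \<in> T" unfolding \<tau>_def using T by (rule Max_in)
    then obtain \<gamma> where \<gamma>: "\<gamma> \<in> G" "cmod (trace (r \<gamma>)) = \<tau>" using \<tau>4 by (auto simp: T_def)
    have \<gamma>c: "\<gamma> \<in> carrier (deck_group p)" using \<gamma>(1) G(2) by blast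
    have "2 * ln (\<tau> / 2) \<le> translation_length (r \<gamma>)"
      using translation_length_ge[OF holonomy_det[OF h \<gamma>c]] \<gamma>(2) \<tau>4 by simp
    moreover have "ln \<tau> \<le> 2 * ln (\<tau> / 2)"
    proof -
      have "ln (4::real) \<le> ln \<tau>" using \<tau>4 by simp
      moreover have "ln (4::real) = 2 * ln 2" using ln_realpow[of 2 2] by simp
      ultimately show ?thesis using \<tau>4 by (simp add: ln_div)
    qed
    ultimately have "c * sqrt (qd_norm X A \<phi>) \<le> translation_length (r \<gamma>)" using small by linarith
    then show "\<exists>\<gamma>\<in>carrier (deck_group p). translation_length (r \<gamma>) \<ge> c * sqrt (qd_norm X A \<phi>)" using \<gamma>c by blast
  qed
qed

text \<open>The rows of the holonomy of \<open>\<gamma>\<close>, in the basis of solutions normalized at \<open>\<i>\<close>, are the initial values at \<open>\<i>\<close> of the solutions of that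
basis continued around \<open>\<gamma>\<close>. Their squares are read off from the values and second derivatives at \<open>\<i>\<close> of forms bounded near
\<open>\<i>\<close> by \<open>exp (O(\<kappa>))\<close>; a Cauchy estimate handles the derivatives.\<close>

theorem holonomy_upper_bound:
  assumes \<gamma>: "\<gamma> \<in> carrier (deck_group p)"
  obtains C where "C > 0" "\<And>\<phi> f r. holonomy_pair \<phi> f r \<Longrightarrow> qd_norm X A \<phi> > 1 \<Longrightarrow>
    translation_length (r \<gamma>) \<le> C * sqrt (qd_norm X A \<phi>)"
proof -
  note d = deck_elem[OF \<gamma>] and hol = deck_holomorphic[OF \<gamma>]
  define N where "N = cball \<i> (1 / 2)"
  have NH: "N \<subseteq> H"
  proof
    fix z assume "z \<in> N"
    then have "\<bar>Im (\<i> - z)\<bar> \<le> 1 / 2" unfolding N_def using abs_Im_le_cmod[of "\<i> - z"] by (simp add: dist_norm)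
    then have "\<bar>1 - Im z\<bar> \<le> 1 / 2" by simp
    then have "Im z > 0" by linarith
    then show "z \<in> H" by (simp add: upper_half_plane_def)
  qed
  have iH: "\<i> \<in> H" by (simp add: upper_half_plane_def)
  define S where "S = convex hull (insert \<i> (\<gamma> ` N))"
  have cg: "compact (\<gamma> ` N)" using d(2) NH by (intro compact_continuous_image) (auto simp: N_def intro: continuous_on_subset)
  then have S: "compact S" "convex S" unfolding S_def by (auto intro: compact_convex_hull convex_convex_hull)
  have SH: "S \<subseteq> H" unfolding S_def
    by (rule hull_minimal) (use d(4) NH iH convex_upper_half_plane in auto)
  have iS: "\<i> \<in> S" and gS: "\<gamma> z \<in> S" if "z \<in> N" for z
    using that hull_subset[of "insert \<i> (\<gamma> ` N)" convex] by (auto simp: S_def)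
  have iN: "\<i> \<in> N" by (simp add: N_def)
  have "bounded S" by (rule compact_imp_bounded[OF S(1)])
  then obtain l0 where l0: "\<And>z. z \<in> S \<Longrightarrow> cmod z \<le> l0" by (auto simp: bounded_iff)
  define l where "l = l0 + 1"
  have l: "cmod (z - \<i>) \<le> l" if "z \<in> S" for z
    using norm_triangle_ineq4[of z \<i>] l0[OF that] by (simp add: l_def)
  have l00: "l \<ge> 0" using l[OF iS[OF iN]] by simp
  have gn: "deriv \<gamma> z \<noteq> 0" if "z \<in> N" for z
    using deck_Im[OF \<gamma>, of z] d(4)[of z] that NH by (auto simp: upper_half_plane_def)
  have "continuous_on N (\<lambda>z. cmod (deriv \<gamma> z))"
    using holomorphic_on_imp_continuous_on[OF holomorphic_deriv[OF hol open_upper_half_plane]] NH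
    by (intro continuous_intros) (auto intro: continuous_on_subset)
  then obtain z' where z': "z' \<in> N" "\<And>z. z \<in> N \<Longrightarrow> cmod (deriv \<gamma> z') \<le> cmod (deriv \<gamma> z)"
    using continuous_attains_inf[of N "\<lambda>z. cmod (deriv \<gamma> z)"] iN by (auto simp: N_def)
  define m where "m = cmod (deriv \<gamma> z')"
  have m: "m > 0" using gn[OF z'(1)] by (simp add: m_def)
  obtain C0 where C0: "C0 > 0" "\<And>\<phi> z. \<phi> \<in> quadratic_differentials A \<Longrightarrow> z \<in> S \<Longrightarrow> cmod (qd_lift A p \<phi> z) \<le> C0 * qd_norm X A \<phi>"
    using sup_le_qd_norm[OF S(1) SH] by metis
  define C1 where "C1 = max C0 1"
  have C1: "C1 \<ge> 1" "C0 \<le> C1" by (auto simp: C1_def)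
  define E0 where "E0 = \<bar>ln (36 / m)\<bar> + (2 * l + 1)"
  have E0: "E0 > 0" using l00 by (simp add: E0_def add_nonneg_pos)
  show ?thesis
  proof (rule that[of "E0 * sqrt C1"])
    show "E0 * sqrt C1 > 0" using E0 C1 by simp
    fix \<phi> f r assume h: "holonomy_pair \<phi> f r" and big: "qd_norm X A \<phi> > 1"
    have \<phi>: "\<phi> \<in> quadratic_differentials A" and f: "developing_map (qd_lift A p \<phi>) f"
      using h by (auto simp: holonomy_pair_def)
    define q where "q = qd_lift A p \<phi>"
    define \<kappa> where "\<kappa> = sqrt (C1 * qd_norm X A \<phi>)"
    have "1 * 1 \<le> C1 * qd_norm X A \<phi>" using C1 big by (intro mult_mono) auto
    then have \<kappa>: "\<kappa> \<ge> 1" "\<kappa>\<^sup>2 = C1 * qd_norm X A \<phi>" by (auto simp: \<kappa>_def)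
    have qk: "cmod (q z) \<le> \<kappa>\<^sup>2" if "z \<in> S" for z
    proof -
      have "cmod (q z) \<le> C0 * qd_norm X A \<phi>" using C0(2)[OF \<phi> that] by (simp add: q_def)
      also have "\<dots> \<le> C1 * qd_norm X A \<phi>" using C1 big by (intro mult_right_mono) auto
      finally show ?thesis by (simp add: \<kappa>)
    qed
    obtain V u v u' v' where L: "\<i> \<in> V" "developing_lift q f V u v u' v'"
      using developing_lift_exists[OF f iH] unfolding q_def .
    have wr: "u \<i> * v' \<i> - v \<i> * u' \<i> = -1" using L by (simp add: developing_lift_def)
    \<comment> \<open>The rows of \<open>B\<close> are the combinations of \<open>u\<close> and \<open>v\<close> with value and derivative \<open>(1, 0)\<close> and \<open>(0, 1)\<close> at \<open>\<i>\<close>.\<close>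
    define B where "B = mat2 (- v' \<i>) (u' \<i>) (v \<i>) (- u \<i>)"
    define C where "C = mat2 (u \<i>) (u' \<i>) (v \<i>) (v' \<i>)"
    have BC: "B ** C = mat 1"
      using wr unfolding mat2_eq_iff mat2_mult mat2_one B_def C_def mat2_nth by (simp add: algebra_simps)
    then have CB: "C ** B = mat 1" using matrix_left_right_inverse by blast
    have init: "B$1$1 * u \<i> + B$1$2 * v \<i> = 1" "B$1$1 * u' \<i> + B$1$2 * v' \<i> = 0"
      "B$2$1 * u \<i> + B$2$2 * v \<i> = 0" "B$2$1 * u' \<i> + B$2$2 * v' \<i> = 1"
      using BC unfolding mat2_eq_iff mat2_mult mat2_one C_def mat2_nth by auto
    define Z where "Z = (\<lambda>a b w. deriv (deriv (developing_form f a b)) w + q w * developing_form f a b w)"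
    have Ysmall: "cmod (developing_form f (B$i$1) (B$i$2) z) \<le> 3 * exp (2 * l * \<kappa>)" if i: "i = 1 \<or> i = 2" and z: "z \<in> S" for i z
    proof -
      define a b where "a = B$i$1" "b = B$i$2"
      note ab = this
      define Y where "Y = developing_form f a b"
      have Yh: "Y holomorphic_on H" unfolding Y_def by (rule developing_form_holomorphic[OF f])
      have "(cmod (Y z))\<^sup>2 \<le> exp (4 * l * \<kappa>) * ((cmod (Y \<i>))\<^sup>2 + (cmod (deriv Y \<i>))\<^sup>2 / \<kappa>\<^sup>2 + (cmod (Z a b \<i>))\<^sup>2 / \<kappa> ^ 4)"
      proof (rule third_order_growth[of S Y "deriv Y" "Z a b" q])
        fix w assume w: "w \<in> S"
        then have wH: "w \<in> H" using SH by blast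
        show "(Y has_field_derivative deriv Y w) (at w)"
          using holomorphic_derivI[OF Yh open_upper_half_plane wH] by simp
        show "(deriv Y has_field_derivative Z a b w - q w * Y w) (at w)"
          using holomorphic_derivI[OF holomorphic_deriv[OF Yh open_upper_half_plane] open_upper_half_plane wH]
          by (simp add: Z_def Y_def)
        show "(Z a b has_field_derivative - q w * deriv Y w) (at w)"
          unfolding Z_def Y_def q_def by (rule developing_form_third_order[OF f wH])
      qed (use S iS[OF iN] z \<kappa> qk l in auto)
      also have "\<dots> \<le> exp (4 * l * \<kappa>) * 5"
      proof (rule mult_left_mono)
        have Yi: "Y \<i> = (a * u \<i> + b * v \<i>)\<^sup>2" using L by (simp add: Y_def developing_lift_def)
        have Y'i: "deriv Y \<i> = 2 * (a * u \<i> + b * v \<i>) * (a * u' \<i> + b * v' \<i>)"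
          unfolding Y_def by (rule developing_lift_form_derivs(2)[OF L(2,1)])
        have Zi: "Z a b \<i> = 2 * (a * u' \<i> + b * v' \<i>)\<^sup>2"
          unfolding Z_def developing_lift_form_derivs(5)[OF L(2,1)] by simp
        have k4: "4 / \<kappa> ^ 4 \<le> 4" using \<kappa>(1) by (simp add: divide_le_eq one_le_power)
        show "(cmod (Y \<i>))\<^sup>2 + (cmod (deriv Y \<i>))\<^sup>2 / \<kappa>\<^sup>2 + (cmod (Z a b \<i>))\<^sup>2 / \<kappa> ^ 4 \<le> 5"
        proof -
          have "a * u \<i> + b * v \<i> = 1 \<and> a * u' \<i> + b * v' \<i> = 0 \<or> a * u \<i> + b * v \<i> = 0 \<and> a * u' \<i> + b * v' \<i> = 1"
            using i init by (auto simp: ab)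
          then show ?thesis
          proof (elim disjE conjE)
            assume e: "a * u \<i> + b * v \<i> = 1" "a * u' \<i> + b * v' \<i> = 0"
            show ?thesis unfolding Yi Y'i Zi e by simp
          next
            assume e: "a * u \<i> + b * v \<i> = 0" "a * u' \<i> + b * v' \<i> = 1"
            show ?thesis unfolding Yi Y'i Zi e using k4 by simp
          qed
        qed
      qed simp
      also have "\<dots> \<le> (3 * exp (2 * l * \<kappa>))\<^sup>2"
        by (simp add: power_mult_distrib exp_double[symmetric] mult.assoc)
      finally have "cmod (Y z) \<le> 3 * exp (2 * l * \<kappa>)" by (rule power2_le_imp_le) simp
      then show ?thesis by (simp add: Y_def ab)
    qed
    define M where "M = B ** r \<gamma> ** C"
    have MB: "M ** B = B ** r \<gamma>" unfolding M_def using CB by (metis matrix_mul_assoc matrix_mul_rid)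
    \<comment> \<open>A bound near \<open>\<i>\<close> for the forms of the continued basis: values on the image of \<open>N\<close> divided by the least modulus of the derivative of \<open>\<gamma>\<close>.\<close>
    define g where "g = 3 * exp (2 * l * \<kappa>) / m"
    have g: "g > 0" using m by (simp add: g_def)
    have rowb: "(cmod (M$i$1))\<^sup>2 + (cmod (M$i$2))\<^sup>2 \<le> g * (5 + \<kappa>\<^sup>2)" if i: "i = 1 \<or> i = 2" for i
    proof -
      define a b where "a = B$i$1 * r \<gamma>$1$1 + B$i$2 * r \<gamma>$2$1" "b = B$i$1 * r \<gamma>$1$2 + B$i$2 * r \<gamma>$2$2"
      note ab = this
      have ab2: "a = M$i$1 * B$1$1 + M$i$2 * B$2$1" "b = M$i$1 * B$1$2 + M$i$2 * B$2$2"
      proof -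
        have "a = (B ** r \<gamma>)$i$1" "b = (B ** r \<gamma>)$i$2" by (simp_all add: ab matrix_matrix_mult_def sum_2)
        then show "a = M$i$1 * B$1$1 + M$i$2 * B$2$1" "b = M$i$1 * B$1$2 + M$i$2 * B$2$2"
          unfolding MB[symmetric] by (simp_all add: matrix_matrix_mult_def sum_2)
      qed
      define Y where "Y = developing_form f a b"
      have Yh: "Y holomorphic_on H" unfolding Y_def by (rule developing_form_holomorphic[OF f])
      have YN: "cmod (Y z) \<le> g" if z: "z \<in> N" for z
      proof -
        have zH: "z \<in> H" using z NH by blast
        have "developing_form f (B$i$1) (B$i$2) (\<gamma> z) = deriv \<gamma> z * Y z"
          unfolding Y_def ab by (rule form_transform[OF h \<gamma> zH])
        then have "cmod (deriv \<gamma> z) * cmod (Y z) \<le> 3 * exp (2 * l * \<kappa>)"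
          using Ysmall[OF i gS[OF z]] by (metis norm_mult)
        moreover have "m * cmod (Y z) \<le> cmod (deriv \<gamma> z) * cmod (Y z)"
          using z'(2)[OF z] by (intro mult_right_mono) (auto simp: m_def)
        ultimately show ?thesis unfolding g_def using m by (simp add: field_simps)
      qed
      have NH': "ball \<i> (1 / 2) \<subseteq> H" using NH ball_subset_cball unfolding N_def by blast
      have "cmod ((deriv ^^ 2) Y \<i>) \<le> fact 2 * g / (1 / 2) ^ 2"
      proof (rule Cauchy_inequality)
        show "Y holomorphic_on ball \<i> (1 / 2)" using Yh NH' holomorphic_on_subset by blast
        show "continuous_on (cball \<i> (1 / 2)) Y"
          using holomorphic_on_imp_continuous_on[OF Yh] NH continuous_on_subset unfolding N_def by blast
        show "cmod (Y x) \<le> g" if "cmod (\<i> - x) = 1 / 2" for x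
          using that by (intro YN) (simp add: N_def dist_norm)
      qed simp
      then have c2: "cmod (deriv (deriv Y) \<i>) \<le> 8 * g" by (simp add: numeral_2_eq_2)
      have y1: "a * u \<i> + b * v \<i> = M$i$1" and y2: "a * u' \<i> + b * v' \<i> = M$i$2"
      proof -
        have "a * u \<i> + b * v \<i> = M$i$1 * (B$1$1 * u \<i> + B$1$2 * v \<i>) + M$i$2 * (B$2$1 * u \<i> + B$2$2 * v \<i>)"
          "a * u' \<i> + b * v' \<i> = M$i$1 * (B$1$1 * u' \<i> + B$1$2 * v' \<i>) + M$i$2 * (B$2$1 * u' \<i> + B$2$2 * v' \<i>)"
          unfolding ab2 by (simp_all add: algebra_simps)
        then show "a * u \<i> + b * v \<i> = M$i$1" "a * u' \<i> + b * v' \<i> = M$i$2" unfolding init by simp_all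
      qed
      \<comment> \<open>The value of the form at \<open>\<i>\<close> is the square of one entry; the second derivative contains the square of the other.\<close>
      have Yi: "Y \<i> = (M$i$1)\<^sup>2" using L y1 by (simp add: Y_def developing_lift_def)
      have Zi: "deriv (deriv Y) \<i> = 2 * (M$i$2)\<^sup>2 - q \<i> * Y \<i>"
        unfolding Y_def developing_lift_form_derivs(5)[OF L(2,1)] y2 ..
      have Yig: "cmod (Y \<i>) \<le> g" by (rule YN[OF iN])
      have 1: "(cmod (M$i$1))\<^sup>2 \<le> g" using Yig by (simp add: Yi norm_power)
      have "2 * (M$i$2)\<^sup>2 = deriv (deriv Y) \<i> + q \<i> * Y \<i>" using Zi by simp
      then have "cmod (2 * (M$i$2)\<^sup>2) \<le> cmod (deriv (deriv Y) \<i>) + cmod (q \<i>) * cmod (Y \<i>)"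
        by (metis norm_mult norm_triangle_ineq)
      also have "\<dots> \<le> 8 * g + \<kappa>\<^sup>2 * g"
        using c2 qk[OF iS[OF iN]] Yig by (intro add_mono mult_mono) auto
      finally have "2 * (cmod (M$i$2))\<^sup>2 \<le> (8 + \<kappa>\<^sup>2) * g" by (simp add: norm_mult norm_power algebra_simps)
      moreover have "0 \<le> \<kappa>\<^sup>2 * g" using g by simp
      ultimately show ?thesis using 1 by (simp add: algebra_simps)
    qed
    have fr: "frobenius_sq M \<le> (36 / m) * exp ((2 * l + 1) * \<kappa>)"
    proof -
      have "frobenius_sq M \<le> 2 * (g * (5 + \<kappa>\<^sup>2))" using rowb[of 1] rowb[of 2] by (simp add: frobenius_sq_def)
      also have "\<dots> \<le> 2 * (g * (6 * exp \<kappa>))"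
      proof -
        have "\<kappa>\<^sup>2 / 2 \<le> exp \<kappa> - 1"
          using exp_lower_Taylor_quadratic[of \<kappa>] \<kappa>(1) by simp
        moreover have "1 \<le> exp \<kappa>" using \<kappa>(1) by simp
        ultimately have "5 + \<kappa>\<^sup>2 \<le> 6 * exp \<kappa>" by linarith
        then show ?thesis using g by simp
      qed
      also have "\<dots> = (36 / m) * (exp (2 * l * \<kappa>) * exp \<kappa>)" by (simp add: g_def)
      also have "exp (2 * l * \<kappa>) * exp \<kappa> = exp ((2 * l + 1) * \<kappa>)" by (simp add: exp_add[symmetric] algebra_simps)
      finally show ?thesis .
    qed
    have "frobenius_sq M > 0"
    proof -
      obtain z t where "t > 0" "frobenius_sq M = displacement_form (r \<gamma>) z t" using frobenius_conj_displacement[OF CB] unfolding M_def by blast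
      then show ?thesis using displacement_form_ge_2[OF holonomy_det[OF h \<gamma>], of t z] by simp
    qed
    have "translation_length (r \<gamma>) \<le> ln (frobenius_sq M)"
      unfolding M_def by (rule translation_length_le[OF holonomy_det[OF h \<gamma>] CB])
    also have "\<dots> \<le> ln ((36 / m) * exp ((2 * l + 1) * \<kappa>))"
      using fr \<open>frobenius_sq M > 0\<close> by (subst ln_le_cancel_iff) (auto simp: m)
    also have "\<dots> = ln (36 / m) + (2 * l + 1) * \<kappa>" using m by (subst ln_mult) auto
    also have "\<dots> \<le> \<bar>ln (36 / m)\<bar> * \<kappa> + (2 * l + 1) * \<kappa>"
    proof -
      have "\<bar>ln (36 / m)\<bar> * 1 \<le> \<bar>ln (36 / m)\<bar> * \<kappa>" using \<kappa>(1) by (intro mult_left_mono) auto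
      then show ?thesis by simp
    qed
    also have "\<dots> = E0 * sqrt C1 * sqrt (qd_norm X A \<phi>)"
      by (simp add: E0_def \<kappa>_def real_sqrt_mult algebra_simps)
    finally show "translation_length (r \<gamma>) \<le> E0 * sqrt C1 * sqrt (qd_norm X A \<phi>)" .
  qed
qed

end

theorem theorem4:
  fixes X :: "'a::t2_space set" and A :: "'a chart set" and g :: nat
    and p :: "complex \<Rightarrow> 'a"
    and \<rho> :: "'a qdiff \<Rightarrow> (complex \<Rightarrow> complex) \<Rightarrow> complex^2^2"
  assumes "compact_riemann_surface X A" and "has_genus X g" and "g \<ge> 2"
    and "uniformization X A p"
    and "holonomy_family X A p \<rho>"
  shows "(\<forall>\<gamma>\<in>carrier (deck_group p). \<exists>C>0. \<exists>N>0. \<forall>\<phi>\<in>quadratic_differentials A.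
            qd_norm X A \<phi> > N \<longrightarrow>
            translation_length (\<rho> \<phi> \<gamma>) \<le> C * sqrt (qd_norm X A \<phi>)) \<and>
         (\<exists>c>0. \<forall>\<phi>\<in>quadratic_differentials A. \<exists>\<gamma>\<in>carrier (deck_group p).
            translation_length (\<rho> \<phi> \<gamma>) \<ge> c * sqrt (qd_norm X A \<phi>))"
proof -
  interpret uniformized X A p by standard (use assms in auto)
  have h: "\<exists>f. holonomy_pair \<phi> f (\<rho> \<phi>)" if "\<phi> \<in> quadratic_differentials A" for \<phi>
    using assms(5) that unfolding holonomy_family_def holonomy_lift_def holonomy_pair_def by blast
  show ?thesis
  proof (intro conjI ballI)
    fix \<gamma> assume "\<gamma> \<in> carrier (deck_group p)"
    then obtain C where "C > 0" "\<And>\<phi> f r. holonomy_pair \<phi> f r \<Longrightarrow> qd_norm X A \<phi> > 1 \<Longrightarrow>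
      translation_length (r \<gamma>) \<le> C * sqrt (qd_norm X A \<phi>)"
      using holonomy_upper_bound by metis
    then show "\<exists>C>0. \<exists>N>0. \<forall>\<phi>\<in>quadratic_differentials A. qd_norm X A \<phi> > N \<longrightarrow>
            translation_length (\<rho> \<phi> \<gamma>) \<le> C * sqrt (qd_norm X A \<phi>)"
      using h by (intro exI[of _ C] conjI exI[of _ "1::real"]) (auto, metis)
  next
    obtain c where "c > 0" "\<And>\<phi> f r. holonomy_pair \<phi> f r \<Longrightarrow>
      \<exists>\<gamma>\<in>carrier (deck_group p). translation_length (r \<gamma>) \<ge> c * sqrt (qd_norm X A \<phi>)"
      using holonomy_lower_bound by metis
    then show "\<exists>c>0. \<forall>\<phi>\<in>quadratic_differentials A. \<exists>\<gamma>\<in>carrier (deck_group p).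
            translation_length (\<rho> \<phi> \<gamma>) \<ge> c * sqrt (qd_norm X A \<phi>)"
      using h by (intro exI[of _ c]) metis
  qed
qed

end
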